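(* There is a randomized Monte Carlo algorithm solving Perfect Matching with Hitting Constraints in time $2^k\cdot n^{O(1)}$, where $k$ is the number of edge subsets and $n$ the input size.
   Context: Perfect Matching with Hitting Constraints: given a graph $G=\langle V,E\rangle$ and $k$ (not necessarily disjoint) edge subsets $E_1,\dots,E_k\subseteq E$, decide whether there is a perfect matching $M$ of $G$ containing $k$ distinct edges $e_1,\dots,e_k\in M$ with $e_i\in E_i$ for every $i\in[k]$. The parameter is $k$. *)

theory Defs
  imports "HOL-Library.Log_Nat" "HOL-Probability.Probability_Mass_Function"
begin

section \<open>Perfect Matching with Hitting Constraints\<close>

definition simple_graph :: "'a set \<Rightarrow> 'a set set \<Rightarrow> bool" where
  "simple_graph V E \<longleftrightarrow> finite V \<and> (\<forall>e\<in>E. e \<subseteq> V \<and> card e = 2)"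

definition perfect_matching :: "'a set \<Rightarrow> 'a set set \<Rightarrow> 'a set set \<Rightarrow> bool" where
  "perfect_matching V E M \<longleftrightarrow> M \<subseteq> E \<and> (\<forall>v\<in>V. \<exists>!e. e \<in> M \<and> v \<in> e)"

definition pmhc_instance :: "'a set \<Rightarrow> 'a set set \<Rightarrow> 'a set set list \<Rightarrow> bool" where
  "pmhc_instance V E Es \<longleftrightarrow> simple_graph V E \<and> (\<forall>F\<in>set Es. F \<subseteq> E)"

definition pmhc :: "'a set \<Rightarrow> 'a set set \<Rightarrow> 'a set set list \<Rightarrow> bool" where
  "pmhc V E Es \<longleftrightarrow>
     (\<exists>M e. perfect_matching V E M \<and>
            (\<forall>i<length Es. e i \<in> M \<and> e i \<in> Es ! i) \<and>
            inj_on e {..<length Es})"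

text \<open>
  Instances on the vertex set \<open>{..<N}\<close> are written as bit strings: \<open>N\<close> and \<open>k\<close> in unary, each
  terminated by a zero, then the \<open>N \<times> N\<close> adjacency matrices of \<open>E, E\<^sub>1, \<dots>, E\<^sub>k\<close>, row by row.
  The length \<open>N + k + 2 + (k + 1) N\<^sup>2\<close> is polynomially related to that of other usual
  encodings such as edge lists.
\<close>

definition encode_edges :: "nat \<Rightarrow> nat set set \<Rightarrow> bool list" where
  "encode_edges N F = concat (map (\<lambda>u. map (\<lambda>v. {u, v} \<in> F) [0..<N]) [0..<N])"

definition encode :: "nat \<Rightarrow> nat set set \<Rightarrow> nat set set list \<Rightarrow> bool list" where
  "encode N E Es =
     replicate N True @ [False] @ replicate (length Es) True @ [False] @
     encode_edges N E @ concat (map (encode_edges N) Es)"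


section \<open>Probabilistic random access machine with logarithmic cost\<close>

text \<open>
  The machine is given by structured programs. Every name denotes an unbounded array of natural
  numbers; scalars live at index \<open>0\<close>. A program mentions finitely many names.
  Subtraction is truncated, division is integer division, and \<open>a div 0 = 0\<close>.
\<close>

type_synonym vname = string
type_synonym state = "vname \<Rightarrow> nat \<Rightarrow> nat"

datatype exp =
    Const nat
  | Get vname exp
  | Plus exp exp
  | Minus exp exp
  | Times exp exp
  | Div exp exp

datatype com =
    Skip
  | Put vname exp exp
  | Flip vname
  | Seq com com
  | Cond exp com com
  | While exp com

fun val :: "exp \<Rightarrow> state \<Rightarrow> nat" where
  "val (Const a) s = a"
| "val (Get x i) s = s x (val i s)"
| "val (Plus a b) s = val a s + val b s"
| "val (Minus a b) s = val a s - val b s"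
| "val (Times a b) s = val a s * val b s"
| "val (Div a b) s = val a s div val b s"

definition len :: "nat \<Rightarrow> nat" where
  "len a = 1 + floorlog 2 a"

text \<open>
  Operations are charged for the binary lengths of their operands; an array access is charged for
  the address and the contents, and multiplication and division at the schoolbook rate.
\<close>

fun cost :: "exp \<Rightarrow> state \<Rightarrow> nat" where
  "cost (Const a) s = len a"
| "cost (Get x i) s = cost i s + len (val i s) + len (s x (val i s))"
| "cost (Plus a b) s = cost a s + cost b s + len (val a s) + len (val b s)"
| "cost (Minus a b) s = cost a s + cost b s + len (val a s) + len (val b s)"
| "cost (Times a b) s = cost a s + cost b s + len (val a s) * len (val b s)"
| "cost (Div a b) s = cost a s + cost b s + len (val a s) * len (val b s)"

text \<open>
  \<open>exec p s r t s' r'\<close>: started in state \<open>s\<close> with the random bits \<open>r\<close> ahead, \<open>p\<close> halts after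
  time \<open>t\<close> in state \<open>s'\<close> with the bits \<open>r'\<close> unread. There is no execution if the bits run out.
\<close>

inductive exec :: "com \<Rightarrow> state \<Rightarrow> bool list \<Rightarrow> nat \<Rightarrow> state \<Rightarrow> bool list \<Rightarrow> bool" where
  Skip: "exec Skip s r 1 s r"
| Put: "exec (Put x i a) s r (cost i s + cost a s + len (val i s) + len (val a s))
          (s(x := (s x)(val i s := val a s))) r"
| Flip: "exec (Flip x) s (b # r) 1 (s(x := (s x)(0 := of_bool b))) r"
| Seq: "exec p s r t s' r' \<Longrightarrow> exec q s' r' t' s'' r'' \<Longrightarrow>
          exec (Seq p q) s r (t + t') s'' r''"
| CondTrue: "val a s \<noteq> 0 \<Longrightarrow> exec p s r t s' r' \<Longrightarrow>
          exec (Cond a p q) s r (cost a s + len (val a s) + t) s' r'"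
| CondFalse: "val a s = 0 \<Longrightarrow> exec q s r t s' r' \<Longrightarrow>
          exec (Cond a p q) s r (cost a s + len (val a s) + t) s' r'"
| WhileTrue: "val a s \<noteq> 0 \<Longrightarrow> exec p s r t s' r' \<Longrightarrow> exec (While a p) s' r' t' s'' r'' \<Longrightarrow>
          exec (While a p) s r (cost a s + len (val a s) + t + t') s'' r''"
| WhileFalse: "val a s = 0 \<Longrightarrow> exec (While a p) s r (cost a s + len (val a s)) s r"

inductive_cases exec_SkipE: "exec Skip s r t s' r'"
inductive_cases exec_PutE: "exec (Put x i a) s r t s' r'"
inductive_cases exec_FlipE: "exec (Flip x) s r t s' r'"
inductive_cases exec_SeqE: "exec (Seq p q) s r t s' r'"
inductive_cases exec_CondE: "exec (Cond a p q) s r t s' r'"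
inductive_cases exec_WhileE: "exec (While a p) s r t s' r'"

lemma exec_deterministic:
  "exec p s r t s' r' \<Longrightarrow> exec p s r u s'' r'' \<Longrightarrow> t = u \<and> s' = s'' \<and> r' = r''"
proof (induction arbitrary: u s'' r'' rule: exec.induct)
  case Skip
  then show ?case by (rule exec_SkipE) simp
next
  case Put
  then show ?case by (rule exec_PutE) simp
next
  case Flip
  then show ?case by (rule exec_FlipE) simp
next
  case Seq
  from Seq.prems show ?case by (rule exec_SeqE) (use Seq.IH in blast)
next
  case CondTrue
  from CondTrue.prems show ?case
    by (rule exec_CondE) (use CondTrue.hyps in \<open>auto dest: CondTrue.IH\<close>)
next
  case CondFalse
  from CondFalse.prems show ?case
    by (rule exec_CondE) (use CondFalse.hyps in \<open>auto dest: CondFalse.IH\<close>)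
next
  case WhileTrue
  from WhileTrue.prems show ?case
    by (rule exec_WhileE) (use WhileTrue.hyps in \<open>auto dest: WhileTrue.IH\<close>)
next
  case WhileFalse
  from WhileFalse.prems show ?case
    by (rule exec_WhileE) (use WhileFalse.hyps in simp_all)
qed

definition initial :: "bool list \<Rightarrow> state" where
  "initial w = (\<lambda>x i.
     if x = ''in'' \<and> i < length w then of_bool (w ! i)
     else if x = ''n'' \<and> i = 0 then length w
     else 0)"

definition answers :: "com \<Rightarrow> bool list \<Rightarrow> bool list \<Rightarrow> nat \<Rightarrow> bool \<Rightarrow> bool" where
  "answers p w r t b \<longleftrightarrow> (\<exists>s' r'. exec p (initial w) r t s' r' \<and> (b \<longleftrightarrow> s' ''out'' 0 \<noteq> 0))"

text \<open>
  On input \<open>w\<close> the program halts within time \<open>T\<close> for all outcomes of its coin flips, and gives the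
  answer \<open>b\<close> with probability at least \<open>2/3\<close>. Every flip takes time \<open>1\<close>, so within time \<open>T\<close>
  at most \<open>T\<close> random bits are read.
\<close>

definition monte_carlo :: "com \<Rightarrow> bool list \<Rightarrow> bool \<Rightarrow> nat \<Rightarrow> bool" where
  "monte_carlo p w b T \<longleftrightarrow>
     (\<forall>r. length r = T \<longrightarrow> (\<exists>t\<le>T. \<exists>b'. answers p w r t b')) \<and>
     measure_pmf.prob (pmf_of_set {r :: bool list. length r = T}) {r. \<exists>t. answers p w r t b} \<ge> 2 / 3"

end

theory Submission
  imports Defs "HOL-Library.Z2" "Jordan_Normal_Form.Determinant"
    "HOL-Computational_Algebra.Formal_Power_Series"
begin

text \<open>
  Give every edge \<open>e\<close> a variable \<open>y\<^sub>0\<^sub>,\<^sub>e\<close> and, for each \<open>i\<close> with \<open>e \<in> E\<^sub>i\<close>, a variable \<open>y\<^sub>i\<^sub>,\<^sub>e\<close>.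
  For a set \<open>S\<close> of indices let \<open>A\<^sub>S\<close> be the symmetric matrix with zero diagonal and entries
  \<open>y\<^sub>0\<^sub>,\<^sub>e + (\<Sum>i\<in>S. y\<^sub>i\<^sub>,\<^sub>e)\<close>. In characteristic two \<open>det A\<^sub>S\<close> is the square of the sum over perfect
  matchings of the products of entries, since a permutation cancels against its inverse. Squaring
  is additive, so \<open>\<Sum>\<^sub>S det A\<^sub>S\<close> is a square as well, and inclusion-exclusion (without signs) leaves
  under the square exactly the monomials of perfect matchings whose edges are coloured by
  \<open>0, \<dots>, k\<close> with every colour \<open>1, \<dots>, k\<close> in use. These monomials are multilinear and distinct,
  so the form vanishes identically iff there is no solution, and otherwise it rarely vanishes at
  random elements of \<open>GF(2)[t]\<close>.

  The determinant is computed without divisions by summing over closed walk sequences (clows),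
  which in characteristic two needs only additions and multiplications. Hence all of the
  computation can take place in \<open>\<nat>[t]\<close>, and there in \<open>\<nat>\<close> by evaluation at a power \<open>B\<close> of two that
  exceeds all coefficients; reduction modulo two is postponed to the base \<open>B\<close> digits of the
  result.
\<close>

text \<open>The obstacle is the machine: it stores natural numbers at logarithmic cost and offers no
  field for a random evaluation. \<open>GF(2)[t]\<close> is an integral domain of characteristic two
  that comes without a search for an irreducible polynomial, and \<open>n\<close> coin flips, read
  as coefficients, give \<open>2^n\<close> distinct values per variable. With at most
  \<open>n\<close> variables the form then vanishes with probability at most \<open>n / 2^n\<close>.
  The clow recurrences make sense over every commutative semiring and commute with homomorphisms, so
  one family of polynomials over the natural numbers can be evaluated at \<open>B\<close> by the
  machine and reduced modulo two in the analysis. Only the link to determinants needs characteristic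
  two. The price is numbers of order \<open>n^4\<close> bits, which is still polynomial; the factor
  \<open>2^k\<close> comes from the number of masks alone. The error is one-sided: without a
  solution the form is identically zero.\<close>

section \<open>Determinants and matchings in characteristic two\<close>

text \<open>
  A clow with head \<open>h\<close> is a closed walk through \<open>h\<close> that otherwise stays below \<open>h\<close>. Here \<open>d l\<close> is the
  weight of the sequences of clows with heads below \<open>h\<close> and total length \<open>l\<close>, and \<open>clow_open A h d l v\<close>
  that of those followed by an unfinished clow with head \<open>h\<close> that has reached \<open>v\<close>; being at \<open>v = h\<close>
  means that this clow has not left its head yet.
\<close>

primrec clow_open :: "(nat \<Rightarrow> nat \<Rightarrow> 'a::comm_semiring_1) \<Rightarrow> nat \<Rightarrow> (nat \<Rightarrow> 'a) \<Rightarrow> nat \<Rightarrow> nat \<Rightarrow> 'a" where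
  "clow_open A h d 0 = (\<lambda>v. if v = h then d 0 else 0)"
| "clow_open A h d (Suc l) =
     (\<lambda>v. if v = h then d (Suc l) else \<Sum>u\<le>h. clow_open A h d l u * A u v)"

primrec clow :: "(nat \<Rightarrow> nat \<Rightarrow> 'a::comm_semiring_1) \<Rightarrow> nat \<Rightarrow> nat \<Rightarrow> 'a" where
  "clow A 0 = (\<lambda>l. if l = 0 then 1 else 0)"
| "clow A (Suc h) = (\<lambda>l. case l of 0 \<Rightarrow> 1
     | Suc l' \<Rightarrow> clow A h l + (\<Sum>u\<le>h. clow_open A h (clow A h) l' u * A u h))"

lemma clow_open_head: "clow_open A h d l h = d l"
  by (cases l) auto

lemma clow_0: "clow A h 0 = 1"
  by (cases h) auto

lemma uminus_char2:
  fixes x :: "'a::comm_ring_1"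
  assumes "(1::'a) + 1 = 0"
  shows "- x = x"
proof -
  have "x + x = x * (1 + 1)" by (simp only: distrib_left mult_1_right)
  then have "x + x = 0" using assms by simp
  then show ?thesis by (simp only: neg_eq_iff_add_eq_0)
qed

text \<open>With \<open>M = I - x A\<close> restricted to the indices up to \<open>h\<close>, the generating functions \<open>g\<close> of the
  unfinished clows satisfy \<open>g M = c e\<^sub>h\<close>; multiplying by the adjugate matrix relates the clow series
  for \<open>h\<close> and \<open>h + 1\<close> in the same way as the two determinants.\<close>

lemma clow_det:
  fixes A :: "nat \<Rightarrow> nat \<Rightarrow> 'a::idom"
  assumes two: "(1::'a) + 1 = 0"
  shows "Abs_fps (clow A h) = det (mat h h (\<lambda>(u, v). (if u = v then 1 else 0) - fps_X * fps_const (A u v)))"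
proof (induction h)
  case 0
  show ?case
    by (simp add: det_dim_zero fps_eq_iff)
next
  case (Suc h)
  define n where "n = Suc h"
  define M where "M = mat n n (\<lambda>(u, v). (if u = v then 1 else 0) - fps_X * fps_const (A u v))"
  define g where "g u = Abs_fps (\<lambda>l. clow_open A h (clow A h) l u)" for u
  define c where "c = Abs_fps (clow A (Suc h))"
  define D where "D = Abs_fps (clow A h)"
  have M: "M \<in> carrier_mat n n" by (simp add: M_def)
  have col: "(\<Sum>u<n. g u * M $$ (u, v)) = (if v = h then c else 0)" if v: "v < n" for v
  proof -
    have "(\<Sum>u<n. g u * M $$ (u, v)) = (\<Sum>u<n. (if u = v then g u else 0) - fps_X * (g u * fps_const (A u v)))"
      using v by (intro sum.cong) (auto simp: M_def algebra_simps)
    also have "\<dots> = g v - fps_X * (\<Sum>u<n. g u * fps_const (A u v))"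
      using v by (simp add: sum_subtractf sum_distrib_left)
    also have "\<dots> = (if v = h then c else 0)"
    proof (rule fps_ext)
      fix l
      have le: "{..<n} = {..h}" by (auto simp: n_def)
      have u: "- x = x" for x :: 'a by (rule uminus_char2[OF two])
      show "fps_nth (g v - fps_X * (\<Sum>u<n. g u * fps_const (A u v))) l = fps_nth (if v = h then c else 0) l"
      proof (cases l)
        case 0
        then show ?thesis by (simp add: g_def c_def clow_0)
      next
        case (Suc l')
        \<comment> \<open>The clow recurrence adds where \<open>I - x A\<close> subtracts;
          characteristic two makes them agree.\<close>
        have "x - y = x + y" for x y :: 'a using u[of y] by (simp add: diff_conv_add_uminus del: add_uminus_conv_diff)
        with Suc show ?thesis
          by (auto simp: g_def c_def fps_sum_nth le clow_open_head)
      qed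
    qed
    finally show ?thesis .
  qed
  define J where "J = adj_mat M"
  have J: "J \<in> carrier_mat n n" "M * J = det M \<cdot>\<^sub>m 1\<^sub>m n"
    using adj_mat[OF M] by (auto simp: J_def)
  have MJ: "(\<Sum>v<n. M $$ (u, v) * J $$ (v, h)) = (if u = h then det M else 0)" if u: "u < n" for u
  proof -
    have "(M * J) $$ (u, h) = (\<Sum>v<n. M $$ (u, v) * J $$ (v, h))"
      using u carrier_matD[OF M] carrier_matD[OF J(1)]
      by (simp add: n_def Matrix.scalar_prod_def lessThan_atLeast0)
    then show ?thesis using u by (cases "u = h") (simp_all add: J(2) n_def)
  qed
  \<comment> \<open>The product \<open>g M J\<close> is evaluated in both orders:
    \<open>g M = c e_h\<close> on one side, \<open>M J = det M\<close> times the identity on the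
    other.\<close>
  have "c * J $$ (h, h) = (\<Sum>v<n. (if v = h then c else 0) * J $$ (v, h))"
    by (simp add: n_def)
  also have "\<dots> = (\<Sum>v<n. \<Sum>u<n. g u * M $$ (u, v) * J $$ (v, h))"
    by (rule sum.cong) (auto simp flip: col simp: sum_distrib_right)
  also have "\<dots> = (\<Sum>u<n. g u * (\<Sum>v<n. M $$ (u, v) * J $$ (v, h)))"
    by (subst sum.swap) (simp add: sum_distrib_left mult.assoc)
  also have "\<dots> = (\<Sum>u<n. g u * (if u = h then det M else 0))"
    by (rule sum.cong) (auto simp: MJ)
  also have "\<dots> = g h * det M" by (simp add: n_def)
  also have "g h = D" by (simp add: g_def D_def clow_open_head)
  finally have 1: "c * J $$ (h, h) = D * det M" .
  have "J $$ (h, h) = det (mat_delete M h h)"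
    using M by (simp add: J_def adj_mat_def cofactor_def n_def flip: mult_2)
  also have "mat_delete M h h = mat h h (\<lambda>(u, v). (if u = v then 1 else 0) - fps_X * fps_const (A u v))"
    by (rule eq_matI) (auto simp: mat_delete_def M_def n_def)
  also have "det \<dots> = D" using Suc.IH by (simp add: D_def)
  finally have "D * c = D * det M" using 1 by (simp add: mult.commute)
  \<comment> \<open>The minor \<open>J $$ (h, h)\<close> is \<open>D\<close> again, so it remains to
    cancel \<open>D\<close>. Power series over a domain form a domain, and the constant term of
    \<open>D\<close> is 1, from the empty clow sequence.\<close>
  moreover have "D \<noteq> 0"
  proof
    assume "D = 0"
    then have "fps_nth D 0 = 0" by simp
    then show False by (simp add: D_def clow_0)
  qed
  ultimately show ?case by (simp add: c_def M_def n_def)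
qed

text \<open>Each factor has degree at most one, so the top coefficient takes the linear part of
  every factor. The vanishing of all higher coefficients is carried along because the induction step
  needs it. The lemma extracts \<open>det A\<close> from \<open>det (I - x A)\<close>.\<close>

lemma fps_nth_prod_linear:
  fixes a b :: "'i \<Rightarrow> 'a::comm_ring_1"
  assumes "finite S"
  shows "fps_nth (\<Prod>i\<in>S. fps_const (a i) - fps_X * fps_const (b i)) (card S) = (\<Prod>i\<in>S. - b i) \<and>
    (\<forall>l>card S. fps_nth (\<Prod>i\<in>S. fps_const (a i) - fps_X * fps_const (b i)) l = 0)"
  using assms
proof (induction S rule: finite_induct)
  case (insert x S)
  have e: "fps_nth ((fps_const (a x) - fps_X * fps_const (b x)) * P) (Suc l) = a x * fps_nth P (Suc l) - b x * fps_nth P l" for P l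
    by (simp add: left_diff_distrib mult.assoc)
  let ?P = "\<Prod>i\<in>S. fps_const (a i) - fps_X * fps_const (b i)"
  have p: "(\<Prod>i\<in>insert x S. fps_const (a i) - fps_X * fps_const (b i)) = (fps_const (a x) - fps_X * fps_const (b x)) * ?P"
    using insert.hyps by simp
  have "fps_nth ((fps_const (a x) - fps_X * fps_const (b x)) * ?P) l = 0" if "l > Suc (card S)" for l
  proof -
    obtain l' where "l = Suc l'" "l' > card S" using \<open>l > _\<close> by (cases l) auto
    then show ?thesis using insert.IH by (simp only: e) simp
  qed
  moreover have "fps_nth ((fps_const (a x) - fps_X * fps_const (b x)) * ?P) (Suc (card S)) = (\<Prod>i\<in>insert x S. - b i)"
    using insert.IH insert.hyps by (simp only: e) simp
  ultimately show ?case
    unfolding p using insert.hyps by simp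
qed auto

text \<open>By \<open>clow_det\<close> the left side is the coefficient of \<open>x^N\<close> in
  \<open>det (I - x A)\<close>, which is the determinant of \<open>A\<close> up to sign; in
  characteristic two signs disappear and the determinant is a permanent.\<close>

lemma clow_eq_sum_permutes:
  fixes A :: "nat \<Rightarrow> nat \<Rightarrow> 'a::idom"
  assumes two: "(1::'a) + 1 = 0"
  shows "clow A N N = (\<Sum>p | p permutes {..<N}. \<Prod>i<N. A i (p i))"
proof -
  have u: "- x = x" for x :: 'a by (rule uminus_char2[OF two])
  have sg: "(signof p :: 'a fps) = 1" for p :: "nat \<Rightarrow> nat"
    by (auto simp: sign_def fps_eq_iff u)
  have "clow A N N = fps_nth (Abs_fps (clow A N)) N" by simp
  also have "\<dots> = (\<Sum>p | p permutes {0..<N}. fps_nth (\<Prod>i=0..<N. fps_const (if i = p i then 1 else 0) - fps_X * fps_const (A i (p i))) N)"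
    unfolding clow_det[OF two] det_def
    by (auto simp: fps_sum_nth sg intro!: sum.cong prod.cong arg_cong2[where f = fps_nth] dest: permutes_in_image)
  also have "\<dots> = (\<Sum>p | p permutes {0..<N}. \<Prod>i=0..<N. A i (p i))"
  proof (rule sum.cong[OF refl])
    fix p
    show "fps_nth (\<Prod>i=0..<N. fps_const (if i = p i then 1 else 0) - fps_X * fps_const (A i (p i))) N = (\<Prod>i=0..<N. A i (p i))"
      using fps_nth_prod_linear[of "{0..<N}" "\<lambda>i. if i = p i then 1 else 0" "\<lambda>i. A i (p i)"]
      by (simp add: u del: fps_const_0_eq_0 fps_const_1_eq_1)
  qed
  finally show ?thesis by (simp add: lessThan_atLeast0)
qed


text \<open>Points moved by \<open>f\<close> form pairs of equal weight, and each pair contributes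
  \<open>w x + w x = 0\<close>. This is used for inverting permutations and for toggling a bit of a
  mask.\<close>

lemma sum_involution_char2:
  fixes w :: "'b \<Rightarrow> 'a::comm_ring_1"
  assumes two: "(1::'a) + 1 = 0" and "finite S"
    and inv: "\<And>x. x \<in> S \<Longrightarrow> f x \<in> S \<and> f (f x) = x \<and> w (f x) = w x"
  shows "sum w S = sum w {x \<in> S. f x = x}"
  using assms(2,3)
proof (induction S rule: finite_psubset_induct)
  case (psubset S)
  show ?case
  proof (cases "\<exists>x\<in>S. f x \<noteq> x")
    case True
    then obtain x where x: "x \<in> S" "f x \<noteq> x" by blast
    define S' where "S' = S - {x, f x}"
    have fx: "f x \<in> S" "f (f x) = x" "w (f x) = w x" using psubset.prems[OF x(1)] by auto
    have "sum w S = sum w S' + (w x + w x)"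
      using sum.subset_diff[of "{x, f x}" S w] psubset.hyps x fx by (simp add: S'_def)
    also have "w x + w x = 0"
      using uminus_char2[OF two, of "w x"] by (simp add: eq_neg_iff_add_eq_0 flip: neg_eq_iff_add_eq_0)
    also have "sum w S' = sum w {x \<in> S'. f x = x}"
    proof (rule psubset.IH)
      show "S' \<subset> S" using x by (auto simp: S'_def)
      show "f y \<in> S' \<and> f (f y) = y \<and> w (f y) = w y" if "y \<in> S'" for y
        using that psubset.prems[of y] fx by (auto simp: S'_def)
    qed
    also have "{x \<in> S'. f x = x} = {x \<in> S. f x = x}" using x fx by (auto simp: S'_def)
    finally show ?thesis by simp
  next
    case False
    then have "{x \<in> S. f x = x} = S" by auto
    then show ?thesis by simp
  qed
qed

lemma sum_square_char2:
  fixes w :: "'b \<Rightarrow> 'a::comm_ring_1"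
  assumes two: "(1::'a) + 1 = 0"
  shows "(\<Sum>x\<in>S. (w x)\<^sup>2) = (sum w S)\<^sup>2"
proof (induction S rule: infinite_finite_induct)
  case (insert x S)
  have "2 * a = 0" for a :: 'a
    using two by (metis mult_zero_left one_add_one)
  with insert show ?case by (simp add: power2_sum mult.assoc)
qed auto

text \<open>Perfect matchings of the complete graph, encoded as fixed-point-free involutions: these
  are literally the permutations that survive in the determinant. Missing edges are handled later by
  zero weights.\<close>

definition matchings :: "nat \<Rightarrow> (nat \<Rightarrow> nat) set" where
  "matchings N = {p. p permutes {..<N} \<and> (\<forall>i<N. p (p i) = i \<and> p i \<noteq> i)}"

text \<open>The smaller endpoint represents each pair, so a product over openers meets every
  matching edge once.\<close>

definition openers :: "nat \<Rightarrow> (nat \<Rightarrow> nat) \<Rightarrow> nat set" where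
  "openers N p = {i. i < N \<and> i < p i}"

lemma finite_matchings: "finite (matchings N)"
  by (rule finite_subset[of _ "{p. p permutes {..<N}}"]) (auto simp: matchings_def finite_permutations)

lemma finite_openers: "finite (openers N p)"
  by (auto simp: openers_def)

lemma matchings_lt: "p \<in> matchings N \<Longrightarrow> i < N \<Longrightarrow> p i < N"
  using permutes_in_image[of p "{..<N}" i] by (auto simp: matchings_def)

text \<open>For symmetric \<open>A\<close> a permutation and its inverse have the same weight, so
  only involutions survive; the zero diagonal removes those with a fixed point. In the remaining
  products every pair contributes its entry twice, which yields the square.\<close>

lemma clow_eq_sum_matchings:
  fixes A :: "nat \<Rightarrow> nat \<Rightarrow> 'a::idom"
  assumes two: "(1::'a) + 1 = 0"
    and sym: "\<And>u v. u < N \<Longrightarrow> v < N \<Longrightarrow> A u v = A v u"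
    and diag: "\<And>u. u < N \<Longrightarrow> A u u = 0"
  shows "clow A N N = (\<Sum>p\<in>matchings N. \<Prod>i\<in>openers N p. A i (p i))\<^sup>2"
proof -
  define w where "w p = (\<Prod>i<N. A i (p i))" for p
  let ?P = "{p. p permutes {..<N}}"
  have "clow A N N = sum w ?P" unfolding clow_eq_sum_permutes[OF two] w_def ..
  also have "\<dots> = sum w {p \<in> ?P. inv_into UNIV p = p}"
  proof (rule sum_involution_char2[OF two])
    show "finite ?P" by (simp add: finite_permutations)
    fix p assume "p \<in> ?P"
    then have p: "p permutes {..<N}" by simp
    have "w (inv_into UNIV p) = (\<Prod>i<N. A (inv_into UNIV p i) i)"
      using permutes_in_image[OF permutes_inv[OF p]] by (auto simp: w_def sym intro!: prod.cong)
    also have "\<dots> = (\<Prod>i<N. A (inv_into UNIV p (p i)) (p i))"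
      using prod.permute[OF p, of "\<lambda>i. A (inv_into UNIV p i) i"] by (simp add: o_def)
    also have "\<dots> = w p" using permutes_inverses[OF p] by (simp add: w_def)
    finally show "inv_into UNIV p \<in> ?P \<and> inv_into UNIV (inv_into UNIV p) = p \<and> w (inv_into UNIV p) = w p"
      using p permutes_inv[OF p] permutes_inv_inv[OF p] by simp
  qed
  also have "\<dots> = sum w (matchings N)"
  proof (rule sum.mono_neutral_right)
    show "finite {p \<in> ?P. inv_into UNIV p = p}" by (simp add: finite_permutations)
    have inv: "inv_into UNIV p = p \<longleftrightarrow> (\<forall>i<N. p (p i) = i)" if p: "p permutes {..<N}" for p
    proof
      assume "inv_into UNIV p = p"
      then show "\<forall>i<N. p (p i) = i" using permutes_inverses[OF p] by metis
    next
      assume *: "\<forall>i<N. p (p i) = i"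
      have "p (p i) = i" for i
        by (cases "i < N") (use * p in \<open>auto simp: permutes_def\<close>)
      then show "inv_into UNIV p = p" by (intro inv_equality) auto
    qed
    then show "matchings N \<subseteq> {p \<in> ?P. inv_into UNIV p = p}" by (auto simp: matchings_def)
    show "\<forall>p\<in>{p \<in> ?P. inv_into UNIV p = p} - matchings N. w p = 0"
    proof
      fix p assume "p \<in> {p \<in> ?P. inv_into UNIV p = p} - matchings N"
      then obtain i where "i < N" "p i = i" using inv by (auto simp: matchings_def)
      then show "w p = 0" unfolding w_def using diag[of i] by (intro prod_zero) force+
    qed
  qed
  also have "\<dots> = (\<Sum>p\<in>matchings N. (\<Prod>i\<in>openers N p. A i (p i))\<^sup>2)"
  proof (rule sum.cong[OF refl])
    fix p assume p: "p \<in> matchings N"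
    have pp: "p (p i) = i" "p i \<noteq> i" "p i < N" if "i < N" for i
      using p that matchings_lt[OF p that] by (auto simp: matchings_def)
    have eq: "{..<N} = openers N p \<union> p ` openers N p"
    proof (rule equalityI; rule subsetI)
      fix i assume "i \<in> {..<N}"
      then have "i < N" by simp
      then show "i \<in> openers N p \<union> p ` openers N p"
        using pp[of i] by (cases "i < p i") (auto simp: openers_def intro!: image_eqI[of _ p "p i"])
    qed (use pp in \<open>auto simp: openers_def\<close>)
    have "w p = (\<Prod>i\<in>openers N p. A i (p i)) * (\<Prod>i\<in>p ` openers N p. A i (p i))"
      unfolding w_def eq
      by (rule prod.union_disjoint) (use pp in \<open>auto simp: finite_openers openers_def\<close>)
    also have "(\<Prod>i\<in>p ` openers N p. A i (p i)) = (\<Prod>i\<in>openers N p. A (p i) (p (p i)))"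
    proof -
      have "inj_on p (openers N p)"
        using p permutes_inj[of p] by (auto simp: matchings_def intro: inj_on_subset)
      then show ?thesis by (simp add: prod.reindex)
    qed
    also have "\<dots> = (\<Prod>i\<in>openers N p. A i (p i))"
      using pp by (intro prod.cong) (auto simp: openers_def sym)
    finally show "w p = (\<Prod>i\<in>openers N p. A i (p i))\<^sup>2" by (simp add: power2_eq_square)
  qed
  also have "\<dots> = (\<Sum>p\<in>matchings N. \<Prod>i\<in>openers N p. A i (p i))\<^sup>2"
    by (rule sum_square_char2[OF two])
  finally show ?thesis .
qed

section \<open>Colour masks and inclusion-exclusion modulo two\<close>

text \<open>Colour \<open>0\<close> stands for the edge set itself and colour \<open>i + 1\<close> for the \<open>i\<close>-th required
  subset, which is enabled by the \<open>i\<close>-th bit of the mask \<open>m\<close>.\<close>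

definition mask_weight :: "nat \<Rightarrow> (nat \<Rightarrow> nat \<Rightarrow> nat \<Rightarrow> 'a::comm_semiring_1) \<Rightarrow> nat \<Rightarrow> nat \<Rightarrow> nat \<Rightarrow> 'a" where
  "mask_weight k y m u v = y 0 u v + (\<Sum>i<k. of_nat (m div 2 ^ i mod 2) * y (Suc i) u v)"

definition mask_matrix :: "nat \<Rightarrow> (nat \<Rightarrow> nat \<Rightarrow> nat \<Rightarrow> 'a::comm_semiring_1) \<Rightarrow> nat \<Rightarrow> nat \<Rightarrow> nat \<Rightarrow> 'a" where
  "mask_matrix k y m u v =
     (if u < v then mask_weight k y m u v else if v < u then mask_weight k y m v u else 0)"

text \<open>Extensionality outside \<open>openers\<close> makes a colouring determined by its values
  on the edges, so that distinct colourings will give distinct monomials.\<close>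

definition colourings :: "nat \<Rightarrow> nat \<Rightarrow> (nat \<Rightarrow> nat) \<Rightarrow> (nat \<Rightarrow> nat) set" where
  "colourings k N p = {\<phi> \<in> openers N p \<rightarrow>\<^sub>E {..k}. {1..k} \<subseteq> \<phi> ` openers N p}"

definition enabled :: "nat \<Rightarrow> nat \<Rightarrow> bool" where
  "enabled m c \<longleftrightarrow> c = 0 \<or> odd (m div 2 ^ (c - 1))"

lemma mask_weight_eq:
  "mask_weight k y m u v = (\<Sum>c\<le>k. of_bool (enabled m c) * y c u v)"
proof -
  have en: "of_bool (enabled m (Suc i)) = (of_nat (m div 2 ^ i mod 2) :: 'a)" for i
    by (cases "even (m div 2 ^ i)") (simp_all add: enabled_def odd_iff_mod_2_eq_one)
  have "(\<Sum>c\<le>k. of_bool (enabled m c) * y c u v) =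
      y 0 u v + (\<Sum>c\<in>Suc ` {..<k}. of_bool (enabled m c) * y c u v)"
    unfolding lessThan_Suc_atMost[symmetric] lessThan_Suc_eq_insert_0
    by (subst sum.insert) (auto simp: enabled_def)
  also have "(\<Sum>c\<in>Suc ` {..<k}. of_bool (enabled m c) * y c u v) =
      (\<Sum>i<k. of_nat (m div 2 ^ i mod 2) * y (Suc i) u v)"
    by (subst sum.reindex) (simp_all add: en)
  finally show ?thesis by (simp add: mask_weight_def)
qed

text \<open>The number of masks that enable all colours of \<open>C\<close> is two to the number of
  colours in \<open>1..k\<close> missing from \<open>C\<close>. This is odd exactly if none is
  missing, so no alternating signs are required.\<close>

lemma sum_masks_covering:
  fixes C :: "nat set"
  assumes two: "(1::'a::comm_ring_1) + 1 = 0" and C: "finite C" "C \<subseteq> {..k}"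
  shows "(\<Sum>m<2 ^ k. \<Prod>c\<in>C. of_bool (enabled m c) :: 'a) = of_bool ({1..k} \<subseteq> C)"
proof -
  let ?w = "\<lambda>D. of_bool (\<forall>c\<in>C. c = 0 \<or> c - 1 \<in> D) :: 'a"
  have bij: "bij_betw set_encode (Pow {..<k}) {..<2 ^ k}"
  proof (rule bij_betwI[where g = set_decode])
    have *: "set_encode D < 2 ^ k" if "D \<subseteq> {..<k}" for D
    proof -
      have "set_encode D \<le> set_encode {..<k}"
        using that by (auto intro!: subset_decode_imp_le simp: finite_subset)
      also have "\<dots> < 2 ^ k" by (simp add: set_encode_def lessThan_atLeast0 sum_power2)
      finally show ?thesis .
    qed
    then show "set_encode \<in> Pow {..<k} \<rightarrow> {..<2 ^ k}" by auto
    have "i < k" if "m < 2 ^ k" "i \<in> set_decode m" for m i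
    proof (rule ccontr)
      assume "\<not> i < k"
      then have "(2::nat) ^ k \<le> 2 ^ i" by (simp add: power_increasing)
      then have "m div 2 ^ i = 0" using that(1) by (intro div_less) linarith
      then show False using that(2) by (simp add: set_decode_def)
    qed
    then show "set_decode \<in> {..<2 ^ k} \<rightarrow> Pow {..<k}" by auto
  qed (auto simp: finite_subset)
  have "(\<Sum>m<2 ^ k. \<Prod>c\<in>C. of_bool (enabled m c) :: 'a) =
     (\<Sum>D\<in>Pow {..<k}. \<Prod>c\<in>C. of_bool (enabled (set_encode D) c))"
    by (rule sum.reindex_bij_betw[OF bij, symmetric])
  also have "\<dots> = sum ?w (Pow {..<k})"
  proof (rule sum.cong[OF refl])
    fix D assume "D \<in> Pow {..<k}"
    then have "finite D" by (auto simp: finite_subset)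
    then have en: "enabled (set_encode D) c \<longleftrightarrow> c = 0 \<or> c - 1 \<in> D" for c
      using set_encode_inverse[of D] by (auto simp: enabled_def set_decode_def)
    show "(\<Prod>c\<in>C. of_bool (enabled (set_encode D) c)) = ?w D"
      unfolding en using C(1) by (induction C rule: finite_induct) auto
  qed
  also have "\<dots> = of_bool ({1..k} \<subseteq> C)"
  proof (cases "{1..k} \<subseteq> C")
    case True
    have "sum ?w (Pow {..<k}) = sum ?w {{..<k}}"
    proof (rule sum.mono_neutral_right)
      show "\<forall>D\<in>Pow {..<k} - {{..<k}}. ?w D = 0"
      proof
        fix D assume "D \<in> Pow {..<k} - {{..<k}}"
        then obtain i where i: "i < k" "i \<notin> D" by auto
        then have "Suc i \<in> C" using True by auto
        then show "?w D = 0" using i by (auto intro!: bexI[of _ "Suc i"])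
      qed
    qed auto
    also have "\<dots> = 1" using C by auto
    finally show ?thesis using True by simp
  next
    case False
    then obtain i where i: "1 \<le> i" "i \<le> k" "i \<notin> C" by (meson atLeastAtMost_iff subsetI)
    \<comment> \<open>Toggling the bit of a missing colour does not affect whether \<open>C\<close>
      is enabled and has no fixed point.\<close>
    define f where "f D = (if i - 1 \<in> D then D - {i - 1} else insert (i - 1) D)" for D
    have "sum ?w (Pow {..<k}) = sum ?w {D \<in> Pow {..<k}. f D = D}"
    proof (rule sum_involution_char2[OF two])
      fix D assume D: "D \<in> Pow {..<k}"
      have "c = 0 \<or> c - 1 \<in> f D \<longleftrightarrow> c = 0 \<or> c - 1 \<in> D" if "c \<in> C" for c
        using that i by (cases c; cases i) (auto simp: f_def)
      then have "?w (f D) = ?w D" by (auto simp: of_bool_def)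
      moreover have "f D \<in> Pow {..<k}" using D i by (auto simp: f_def)
      moreover have "f (f D) = D" by (auto simp: f_def)
      ultimately show "f D \<in> Pow {..<k} \<and> f (f D) = D \<and> ?w (f D) = ?w D" by blast
    qed auto
    also have "{D \<in> Pow {..<k}. f D = D} = {}" by (auto simp: f_def)
    finally show ?thesis using False by simp
  qed
  finally show ?thesis .
qed

text \<open>Squaring is additive, so the sum over masks moves under the square. There each product
  of sums expands into a sum over colourings, and after exchanging the sums
  \<open>sum_masks_covering\<close> counts, for each colouring, the masks that admit it.\<close>

lemma sum_clow_masks:
  fixes y :: "nat \<Rightarrow> nat \<Rightarrow> nat \<Rightarrow> 'a::idom"
  assumes two: "(1::'a) + 1 = 0"
  shows "(\<Sum>m<2 ^ k. clow (mask_matrix k y m) N N) =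
    (\<Sum>p\<in>matchings N. \<Sum>\<phi>\<in>colourings k N p. \<Prod>i\<in>openers N p. y (\<phi> i) i (p i))\<^sup>2"
proof -
  let ?W = "\<lambda>m p. \<Prod>i\<in>openers N p. mask_weight k y m i (p i)"
  have "(\<Sum>m<2 ^ k. clow (mask_matrix k y m) N N) = (\<Sum>m<2 ^ k. (\<Sum>p\<in>matchings N. ?W m p)\<^sup>2)"
    by (subst clow_eq_sum_matchings[OF two])
      (auto simp: mask_matrix_def openers_def intro!: sum.cong prod.cong arg_cong[where f = "\<lambda>x. x\<^sup>2"])
  also have "\<dots> = (\<Sum>m<2 ^ k. \<Sum>p\<in>matchings N. ?W m p)\<^sup>2"
    by (rule sum_square_char2[OF two])
  also have "(\<Sum>m<2 ^ k. \<Sum>p\<in>matchings N. ?W m p) = (\<Sum>p\<in>matchings N. \<Sum>m<2 ^ k. ?W m p)"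
    by (rule sum.swap)
  also have "\<dots> = (\<Sum>p\<in>matchings N. \<Sum>\<phi>\<in>colourings k N p. \<Prod>i\<in>openers N p. y (\<phi> i) i (p i))"
  proof (rule sum.cong[OF refl])
    fix p assume "p \<in> matchings N"
    let ?O = "openers N p"
    let ?y = "\<lambda>\<phi>. \<Prod>i\<in>?O. y (\<phi> i) i (p i)"
    have fin: "finite (?O \<rightarrow>\<^sub>E {..k})" by (simp add: finite_PiE finite_openers)
    have "(\<Sum>m<2 ^ k. ?W m p) =
       (\<Sum>m<2 ^ k. \<Sum>\<phi>\<in>?O \<rightarrow>\<^sub>E {..k}. \<Prod>i\<in>?O. of_bool (enabled m (\<phi> i)) * y (\<phi> i) i (p i))"
      unfolding mask_weight_eq by (intro sum.cong[OF refl] prod_sum_PiE) (auto simp: finite_openers)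
    also have "\<dots> = (\<Sum>\<phi>\<in>?O \<rightarrow>\<^sub>E {..k}. (\<Sum>m<2 ^ k. \<Prod>i\<in>?O. of_bool (enabled m (\<phi> i))) * ?y \<phi>)"
      by (subst sum.swap) (simp add: prod.distrib sum_distrib_right)
    also have "\<dots> = (\<Sum>\<phi>\<in>?O \<rightarrow>\<^sub>E {..k}. of_bool ({1..k} \<subseteq> \<phi> ` ?O) * ?y \<phi>)"
    proof (rule sum.cong[OF refl])
      fix \<phi> assume \<phi>: "\<phi> \<in> ?O \<rightarrow>\<^sub>E {..k}"
      \<comment> \<open>Indicators are idempotent, so repeated colours merge and only the set of
        colours in use matters.\<close>
      have "(\<Prod>i\<in>?O. of_bool (enabled m (\<phi> i)) :: 'a) = (\<Prod>c\<in>\<phi> ` ?O. of_bool (enabled m c))" for m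
      proof -
        have "(\<Prod>i\<in>O'. of_bool (enabled m (\<phi> i)) :: 'a) = (\<Prod>c\<in>\<phi> ` O'. of_bool (enabled m c))" if "finite O'" for O'
          using that by (induction O' rule: finite_induct) (auto simp: insert_absorb prod.insert_if of_bool_def)
        then show ?thesis by (simp add: finite_openers)
      qed
      then show "(\<Sum>m<2 ^ k. \<Prod>i\<in>?O. of_bool (enabled m (\<phi> i))) * ?y \<phi> = of_bool ({1..k} \<subseteq> \<phi> ` ?O) * ?y \<phi>"
        using sum_masks_covering[OF two, of "\<phi> ` ?O" k] \<phi>
        by (simp add: finite_openers PiE_iff image_subset_iff)
    qed
    also have "\<dots> = (\<Sum>\<phi>\<in>?O \<rightarrow>\<^sub>E {..k}. if {1..k} \<subseteq> \<phi> ` ?O then ?y \<phi> else 0)"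
      by (intro sum.cong) auto
    also have "\<dots> = sum ?y (colourings k N p)"
      unfolding colourings_def by (rule sum.inter_filter[symmetric]) (rule fin)
    finally show "(\<Sum>m<2 ^ k. ?W m p) = sum ?y (colourings k N p)" .
  qed
  finally show ?thesis .
qed


section \<open>Zeros of multilinear forms at random bit strings\<close>

definition chunk :: "nat \<Rightarrow> nat \<Rightarrow> 'b list \<Rightarrow> 'b list" where
  "chunk m u r = take m (drop (u * m) r)"

text \<open>A polynomial with squarefree monomials and all coefficients one, given by its set of
  monomials; the zero polynomial is \<open>F = {}\<close>.\<close>

definition multilinear :: "(nat \<Rightarrow> 'a) \<Rightarrow> nat set set \<Rightarrow> 'a::comm_semiring_1" where
  "multilinear y F = (\<Sum>T\<in>F. \<Prod>u\<in>T. y u)"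

lemma chunk_append: "u < n \<Longrightarrow> length r = n * m \<Longrightarrow> chunk m u (r @ r') = chunk m u r"
proof -
  assume "u < n" and r: "length r = n * m"
  then have "Suc u * m \<le> n * m" by (intro mult_le_mono1) simp
  then have "u * m + m \<le> length r" by (simp add: r)
  then show ?thesis by (simp add: chunk_def)
qed

lemma multilinear_chunk_append:
  "F \<subseteq> Pow {..<n} \<Longrightarrow> length r = n * m \<Longrightarrow>
   multilinear (\<lambda>u. g (chunk m u (r @ r'))) F = multilinear (\<lambda>u. g (chunk m u r)) F"
  unfolding multilinear_def by (intro sum.cong prod.cong refl arg_cong[where f = g] chunk_append[of _ n]) auto

lemma card_bit_lists: "card {r :: bool list. length r = n} = 2 ^ n"
  using card_lists_length_eq[of "UNIV :: bool set" n] by simp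

lemma finite_bit_lists: "finite {r :: bool list. length r = n}"
  using finite_lists_length_eq[of "UNIV :: bool set" n] by simp

text \<open>The Schwartz-Zippel argument, by splitting off the last variable as
  \<open>F0 + y n * F1\<close>. If \<open>F1\<close> is empty the induction hypothesis applies to
  \<open>F0\<close>. Otherwise either \<open>F1\<close> vanishes at the first \<open>n\<close>
  chunks, which the induction hypothesis bounds, or the linear equation in \<open>y n\<close> has at
  most one root, hit by at most one chunk since \<open>g\<close> is injective. Multiplying out keeps
  the counting in the natural numbers.\<close>

lemma card_multilinear_zeros:
  fixes g :: "bool list \<Rightarrow> 'a::idom"
  assumes g: "inj_on g {r. length r = m}" and "F \<subseteq> Pow {..<n}" "F \<noteq> {}"
  shows "2 ^ m * card {r. length r = n * m \<and> multilinear (\<lambda>u. g (chunk m u r)) F = 0} \<le> n * 2 ^ (n * m)"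
  using assms(2,3)
proof (induction n arbitrary: F)
  case 0
  then have "F = {{}}" by auto
  then show ?case by (simp add: multilinear_def)
next
  case (Suc n)
  let ?L = "\<lambda>j. {r :: bool list. length r = j}"
  let ?bad = "\<lambda>n F. {r. length r = n * m \<and> multilinear (\<lambda>u. g (chunk m u r)) F = 0}"
  let ?app = "\<lambda>(r1, r2). r1 @ r2 :: bool list"
  define F0 where "F0 = {T \<in> F. n \<notin> T}"
  define F1 where "F1 = (\<lambda>T. T - {n}) ` {T \<in> F. n \<in> T}"
  have F0: "F0 \<subseteq> Pow {..<n}" and F1: "F1 \<subseteq> Pow {..<n}"
    using Suc.prems(1) by (auto simp: F0_def F1_def less_Suc_eq subset_iff)
  have finF: "finite F" using Suc.prems(1) by (rule finite_subset) simp
  have finT: "finite T" if "T \<in> F" for T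
    using that Suc.prems(1) by (meson Pow_iff finite_lessThan finite_subset subsetD)
  have split: "multilinear y F = multilinear y F0 + y n * multilinear y F1" for y :: "nat \<Rightarrow> 'a"
  proof -
    have "multilinear y F = multilinear y F0 + multilinear y {T \<in> F. n \<in> T}"
    proof -
      have "F = F0 \<union> {T \<in> F. n \<in> T}" by (auto simp: F0_def)
      then show ?thesis unfolding multilinear_def
        using sum.union_disjoint[of F0 "{T \<in> F. n \<in> T}" "\<lambda>T. prod y T"] finF by (auto simp: F0_def)
    qed
    also have "multilinear y {T \<in> F. n \<in> T} = (\<Sum>T | T \<in> F \<and> n \<in> T. y n * (\<Prod>u\<in>T - {n}. y u))"
      unfolding multilinear_def using finT by (intro sum.cong) (auto simp: prod.remove)
    also have "\<dots> = y n * multilinear y F1"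
    proof -
      have inj: "inj_on (\<lambda>T. T - {n}) {T \<in> F. n \<in> T}" by (auto intro!: inj_onI)
      show ?thesis unfolding multilinear_def F1_def by (simp add: sum.reindex[OF inj] sum_distrib_left)
    qed
    finally show ?thesis .
  qed
  have decomp: "multilinear (\<lambda>u. g (chunk m u (r1 @ r2))) F =
      multilinear (\<lambda>u. g (chunk m u r1)) F0 + g r2 * multilinear (\<lambda>u. g (chunk m u r1)) F1"
    if "length r1 = n * m" "length r2 = m" for r1 r2
    unfolding split using that
    by (simp add: multilinear_chunk_append[OF F0] multilinear_chunk_append[OF F1]) (simp add: chunk_def)
  have as_app: "r \<in> ?app ` X" if "length r = Suc n * m" "(take (n * m) r, drop (n * m) r) \<in> X" for r X
    using that by (auto intro!: image_eqI[of _ _ "(take (n * m) r, drop (n * m) r)"])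
  show ?case
  proof (cases "F1 = {}")
    case True
    then have "F = F0" by (auto simp: F0_def F1_def)
    then have "F0 \<noteq> {}" using Suc.prems by simp
    have "?bad (Suc n) F \<subseteq> ?app ` (?bad n F0 \<times> ?L m)"
    proof
      fix r assume r: "r \<in> ?bad (Suc n) F"
      then show "r \<in> ?app ` (?bad n F0 \<times> ?L m)"
        using decomp[of "take (n * m) r" "drop (n * m) r"] True
        by (intro as_app) (auto simp: multilinear_def)
    qed
    then have "card (?bad (Suc n) F) \<le> card (?app ` (?bad n F0 \<times> ?L m))"
      by (intro card_mono finite_imageI finite_cartesian_product) (auto simp: finite_bit_lists)
    also have "\<dots> \<le> card (?bad n F0 \<times> ?L m)"
      by (intro card_image_le finite_cartesian_product) (auto simp: finite_bit_lists)
    also have "\<dots> = card (?bad n F0) * 2 ^ m" by (simp add: card_cartesian_product card_bit_lists)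
    finally have "2 ^ m * card (?bad (Suc n) F) \<le> (2 ^ m * card (?bad n F0)) * 2 ^ m" by simp
    also have "\<dots> \<le> n * 2 ^ (n * m) * 2 ^ m" using Suc.IH[OF F0 \<open>F0 \<noteq> {}\<close>] by simp
    also have "\<dots> \<le> Suc n * 2 ^ (Suc n * m)" by (simp add: power_add)
    finally show ?thesis .
  next
    case False
    let ?q = "\<lambda>F r. multilinear (\<lambda>u. g (chunk m u r)) F"
    define R where "R r1 = {r2. length r2 = m \<and> ?q F0 r1 + g r2 * ?q F1 r1 = 0 \<and> ?q F1 r1 \<noteq> 0}" for r1
    have R: "card (R r1) \<le> 1" for r1
    proof -
      have "a = b" if "a \<in> R r1" "b \<in> R r1" for a b
      proof -
        have "?q F0 r1 + g a * ?q F1 r1 = ?q F0 r1 + g b * ?q F1 r1" "?q F1 r1 \<noteq> 0"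
          using that by (auto simp: R_def)
        then have "g a = g b" by simp
        then show ?thesis using that g by (auto simp: R_def inj_on_def)
      qed
      then show ?thesis by (metis card_le_Suc0_iff_eq One_nat_def card.infinite zero_le_one)
    qed
    have finR: "finite (R r1)" for r1
      by (rule finite_subset[OF _ finite_bit_lists[of m]]) (auto simp: R_def)
    let ?X = "?bad n F1 \<times> ?L m" and ?Y = "Sigma (?L (n * m)) R"
    have "?bad (Suc n) F \<subseteq> ?app ` (?X \<union> ?Y)"
    proof
      fix r assume r: "r \<in> ?bad (Suc n) F"
      then show "r \<in> ?app ` (?X \<union> ?Y)"
        using decomp[of "take (n * m) r" "drop (n * m) r"]
        by (intro as_app) (auto simp: R_def)
    qed
    then have "card (?bad (Suc n) F) \<le> card (?app ` (?X \<union> ?Y))"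
      by (intro card_mono finite_imageI finite_UnI finite_cartesian_product finite_SigmaI finR) (auto simp: finite_bit_lists)
    also have "\<dots> \<le> card (?X \<union> ?Y)"
      by (intro card_image_le finite_UnI finite_cartesian_product finite_SigmaI finR) (auto simp: finite_bit_lists)
    also have "\<dots> \<le> card ?X + card ?Y" by (rule card_Un_le)
    also have "card ?X = card (?bad n F1) * 2 ^ m" by (simp add: card_cartesian_product card_bit_lists)
    also have "card ?Y = (\<Sum>r1\<in>?L (n * m). card (R r1))"
      by (rule card_SigmaI) (auto simp: finite_bit_lists finR)
    also have "\<dots> \<le> (\<Sum>r1\<in>?L (n * m). 1)" by (rule sum_mono) (rule R)
    also have "\<dots> = 2 ^ (n * m)" by (simp add: card_bit_lists)
    finally have "2 ^ m * card (?bad (Suc n) F) \<le> 2 ^ m * (card (?bad n F1) * 2 ^ m + 2 ^ (n * m))" by simp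
    also have "\<dots> = (2 ^ m * card (?bad n F1)) * 2 ^ m + 2 ^ (n * m) * 2 ^ m" by (simp add: algebra_simps)
    also have "\<dots> \<le> n * 2 ^ (n * m) * 2 ^ m + 2 ^ (n * m) * 2 ^ m"
      using Suc.IH[OF F1 False] by simp
    also have "\<dots> = Suc n * 2 ^ (Suc n * m)" by (simp add: power_add algebra_simps)
    finally show ?thesis .
  qed
qed

text \<open>The form reads only the first \<open>n * m\<close> bits; the other bits of a string of
  length \<open>T\<close> multiply the counts of bad strings and of all strings by the same power of
  two.\<close>

lemma prob_multilinear_nonzero:
  fixes g :: "bool list \<Rightarrow> 'a::idom"
  assumes g: "inj_on g {r. length r = m}" and F: "F \<subseteq> Pow {..<n}" "F \<noteq> {}" and T: "n * m \<le> T"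
  shows "measure_pmf.prob (pmf_of_set {r :: bool list. length r = T})
    {r. multilinear (\<lambda>u. g (chunk m u r)) F \<noteq> 0} \<ge> 1 - real n / 2 ^ m"
proof -
  let ?L = "{r :: bool list. length r = T}"
  let ?Z = "{r. multilinear (\<lambda>u. g (chunk m u r)) F = 0}"
  let ?bad = "{r. length r = n * m \<and> multilinear (\<lambda>u. g (chunk m u r)) F = 0}"
  have "?L \<inter> ?Z \<subseteq> (\<lambda>(r1, r2). r1 @ r2) ` (?bad \<times> {r. length r = T - n * m})"
  proof
    fix r assume r: "r \<in> ?L \<inter> ?Z"
    have "multilinear (\<lambda>u. g (chunk m u (take (n * m) r))) F = 0"
      using multilinear_chunk_append[OF F(1), of "take (n * m) r" m g "drop (n * m) r"] r T by simp
    then show "r \<in> (\<lambda>(r1, r2). r1 @ r2) ` (?bad \<times> {r. length r = T - n * m})"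
      using r T by (intro image_eqI[of _ _ "(take (n * m) r, drop (n * m) r)"]) auto
  qed
  then have "card (?L \<inter> ?Z) \<le> card ((\<lambda>(r1, r2). r1 @ r2) ` (?bad \<times> {r :: bool list. length r = T - n * m}))"
    by (intro card_mono finite_imageI finite_cartesian_product) (auto simp: finite_bit_lists)
  also have "\<dots> \<le> card (?bad \<times> {r :: bool list. length r = T - n * m})"
    by (intro card_image_le finite_cartesian_product) (auto simp: finite_bit_lists)
  also have "\<dots> = card ?bad * 2 ^ (T - n * m)" by (simp add: card_cartesian_product card_bit_lists)
  finally have "2 ^ m * card (?L \<inter> ?Z) \<le> (2 ^ m * card ?bad) * 2 ^ (T - n * m)" by simp
  also have "\<dots> \<le> n * 2 ^ (n * m) * 2 ^ (T - n * m)"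
    using card_multilinear_zeros[OF g F] by simp
  also have "\<dots> = n * 2 ^ T" using T by (simp flip: power_add)
  finally have "real (2 ^ m * card (?L \<inter> ?Z)) \<le> real (n * 2 ^ T)" by (simp only: of_nat_le_iff)
  then have "real (card (?L \<inter> ?Z)) / 2 ^ T \<le> real n / 2 ^ m" by (simp add: field_simps)
  moreover have "measure_pmf.prob (pmf_of_set ?L) ?Z = real (card (?L \<inter> ?Z)) / 2 ^ T"
    by (subst measure_pmf_of_set) (auto simp: finite_bit_lists card_bit_lists intro: Ex_list_of_length)
  moreover have "measure_pmf.prob (pmf_of_set ?L) (- ?Z) = 1 - measure_pmf.prob (pmf_of_set ?L) ?Z"
    using measure_pmf.prob_compl[of ?Z "pmf_of_set ?L"] by (simp add: Compl_eq_Diff_UNIV)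
  moreover have "- ?Z = {r. multilinear (\<lambda>u. g (chunk m u r)) F \<noteq> 0}" by auto
  ultimately show ?thesis by simp
qed


section \<open>Kronecker substitution\<close>

text \<open>Coefficients below \<open>B\<close> are the base \<open>B\<close> digits of the value at
  \<open>B\<close>, without carries. As \<open>B\<close> is even, the parity of the quotient is that
  of its lowest digit.\<close>

lemma odd_digit_poly:
  fixes P :: "nat poly"
  assumes "\<And>i. coeff P i < B" "even B"
  shows "odd (poly P B div B ^ j) \<longleftrightarrow> odd (coeff P j)"
  using assms(1)
proof (induction j arbitrary: P)
  case 0
  then show ?case using \<open>even B\<close> by (cases P) auto
next
  case (Suc j)
  obtain c P' where P: "P = pCons c P'" by (cases P)
  have "c < B" "\<And>i. coeff P' i < B"
    using Suc.prems[of 0] Suc.prems[of "Suc _"] by (auto simp: P)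
  then show ?case using Suc.IH[of P'] by (simp add: P div_mult2_eq)
qed

text \<open>Evaluation at 1 bounds all coefficients at once, and by \<open>map_clow_total\<close>
  that value is itself a clow sum over the natural numbers, subject to
  \<open>clow_total_le\<close>.\<close>

lemma coeff_le_poly_1: "coeff P i \<le> poly P (1 :: nat)"
proof (induction P arbitrary: i)
  case (pCons a P)
  then show ?case by (cases i) (auto intro: le_trans trans_le_add2)
qed auto

text \<open>Clow sums use only addition and multiplication, hence commute with every semiring
  homomorphism. The two that matter are evaluation of a polynomial and reduction of natural
  coefficients modulo two.\<close>

locale semiring_map =
  fixes h :: "'a::comm_semiring_1 \<Rightarrow> 'b::comm_semiring_1"
  assumes map_0: "h 0 = 0" and map_1: "h 1 = 1"
    and map_add: "h (x + y) = h x + h y" and map_mult: "h (x * y) = h x * h y"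
begin

lemma map_sum: "h (sum f S) = (\<Sum>x\<in>S. h (f x))"
  by (induction S rule: infinite_finite_induct) (auto simp: map_0 map_add)

lemma map_of_nat: "h (of_nat n) = of_nat n"
  by (induction n) (auto simp: map_0 map_1 map_add)

lemma map_clow_open: "h (clow_open A k d l v) = clow_open (\<lambda>u v. h (A u v)) k (\<lambda>l. h (d l)) l v"
  by (induction l arbitrary: v) (auto simp: map_0 map_sum map_mult)

lemma map_clow: "h (clow A k l) = clow (\<lambda>u v. h (A u v)) k l"
  by (induction k arbitrary: l)
    (auto simp: map_0 map_1 map_sum map_mult map_add map_clow_open split: nat.split)

lemma map_mask_matrix: "h (mask_matrix k y m u v) = mask_matrix k (\<lambda>c u v. h (y c u v)) m u v"
  by (auto simp: mask_matrix_def mask_weight_def map_0 map_sum map_mult map_add map_of_nat)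

end

definition clow_total :: "nat \<Rightarrow> nat \<Rightarrow> (nat \<Rightarrow> nat \<Rightarrow> nat \<Rightarrow> 'a::comm_semiring_1) \<Rightarrow> 'a" where
  "clow_total k N y = (\<Sum>m<2 ^ k. clow (mask_matrix k y m) N N)"

lemma (in semiring_map) map_clow_total: "h (clow_total k N y) = clow_total k N (\<lambda>c u v. h (y c u v))"
  by (simp add: clow_total_def map_sum map_clow map_mask_matrix)

interpretation poly_eval: semiring_map "\<lambda>P. poly P (x :: 'a::comm_semiring_1)"
  by unfold_locales auto

lemma coeff_map_of_nat: "coeff (map_poly of_nat P) i = of_nat (coeff P i)"
  by (simp add: coeff_map_poly)

interpretation poly_reduce: semiring_map "map_poly of_nat :: nat poly \<Rightarrow> 'a::comm_semiring_1 poly"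
  by unfold_locales
    (auto simp: poly_eq_iff coeff_map_of_nat coeff_mult)

lemma of_nat_bit_eq_0: "of_nat n = (0 :: bit) \<longleftrightarrow> even n"
  by (induction n) auto

lemma map_of_nat_bit_eq_0: "map_poly of_nat P = (0 :: bit poly) \<longleftrightarrow> (\<forall>j. even (coeff P j))"
  by (simp add: poly_eq_iff coeff_map_of_nat of_nat_bit_eq_0)

lemma bit_poly_two: "(1 :: bit poly) + 1 = 0"
  unfolding one_pCons by simp

text \<open>Lengthening a walk by one edge costs a factor of at most \<open>N * a\<close>, bounded
  by \<open>Z\<close>; \<open>2 <= Z\<close> pays for the two summands of
  \<open>clow A (Suc h)\<close>. Sums over \<open>u < j\<close> are included because the machine's
  accumulator passes through them.\<close>

lemma clow_bounds:
  fixes A :: "nat \<Rightarrow> nat \<Rightarrow> nat"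
  assumes A: "\<And>u v. u < N \<Longrightarrow> v < N \<Longrightarrow> A u v \<le> a" and Z: "N * a \<le> Z" "2 \<le> Z"
  shows clow_le: "h \<le> N \<Longrightarrow> clow A h l \<le> Z ^ (h + l)"
    and clow_open_le: "h < N \<Longrightarrow> v \<le> h \<Longrightarrow> clow_open A h (clow A h) l v \<le> Z ^ (h + l)"
    and clow_open_sum_le: "h < N \<Longrightarrow> v \<le> h \<Longrightarrow> j \<le> Suc h \<Longrightarrow>
      (\<Sum>u<j. clow_open A h (clow A h) l u * A u v) \<le> Z ^ Suc (h + l)"
proof -
  have sums: "(\<Sum>u<j. clow_open A h (clow A h) l u * A u v) \<le> Z ^ Suc (h + l)"
    if "h < N" "v \<le> h" "j \<le> Suc h" and IH: "\<And>u. u \<le> h \<Longrightarrow> clow_open A h (clow A h) l u \<le> Z ^ (h + l)"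
    for h l v j
  proof -
    have "(\<Sum>u<j. clow_open A h (clow A h) l u * A u v) \<le> (\<Sum>u<j. Z ^ (h + l) * a)"
      using that by (intro sum_mono mult_le_mono IH A) auto
    also have "\<dots> \<le> N * (Z ^ (h + l) * a)" using that by simp
    also have "\<dots> \<le> Z * Z ^ (h + l)" using mult_le_mono1[OF Z(1), of "Z ^ (h + l)"] by (simp add: mult_ac)
    finally show ?thesis by simp
  qed
  have opens: "\<forall>v\<le>h. clow_open A h (clow A h) l v \<le> Z ^ (h + l)"
    if "h < N" and IH: "\<And>l. clow A h l \<le> Z ^ (h + l)" for h l
  proof (induction l)
    case 0
    then show ?case using IH[of 0] by auto
  next
    case (Suc l)
    show ?case
      using sums[OF \<open>h < N\<close>, of _ "Suc h" l] Suc IH[of "Suc l"]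
      by (auto simp: lessThan_Suc_atMost simp del: power_Suc)
  qed
  have clow: "clow A h l \<le> Z ^ (h + l)" if "h \<le> N" for h l
    using that
  proof (induction h arbitrary: l)
    case 0
    then show ?case using Z by auto
  next
    case (Suc h)
    show ?case
    proof (cases l)
      case 0
      then show ?thesis using Z by simp
    next
      case (Suc l')
      have "clow A h l \<le> Z ^ (h + l)" by (rule Suc.IH) (use Suc.prems in simp)
      moreover have "(\<Sum>u\<le>h. clow_open A h (clow A h) l' u * A u h) \<le> Z ^ (h + l)"
        using sums[of h h "Suc h" l'] opens[of h] Suc.IH Suc.prems
        by (simp add: lessThan_Suc_atMost Suc)
      ultimately have "clow A (Suc h) l \<le> 2 * Z ^ (h + l)" by (simp add: Suc)
      also have "\<dots> \<le> Z ^ (Suc h + l)" using Z by simp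
      finally show ?thesis .
    qed
  qed
  show "h \<le> N \<Longrightarrow> clow A h l \<le> Z ^ (h + l)" by (rule clow)
  show "h < N \<Longrightarrow> v \<le> h \<Longrightarrow> clow_open A h (clow A h) l v \<le> Z ^ (h + l)"
    using opens clow by simp
  then show "h < N \<Longrightarrow> v \<le> h \<Longrightarrow> j \<le> Suc h \<Longrightarrow>
      (\<Sum>u<j. clow_open A h (clow A h) l u * A u v) \<le> Z ^ Suc (h + l)"
    using sums opens clow by simp
qed

lemma mask_weight_le:
  fixes y :: "nat \<Rightarrow> nat \<Rightarrow> nat \<Rightarrow> nat"
  assumes "\<And>c. c \<le> k \<Longrightarrow> y c u v \<le> b"
  shows "mask_weight k y m u v \<le> Suc k * b"
proof -
  have "mask_weight k y m u v \<le> (\<Sum>c\<le>k. b)"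
    unfolding mask_weight_eq using assms by (intro sum_mono) (auto simp: of_bool_def)
  then show ?thesis by simp
qed

lemma mask_matrix_le:
  fixes y :: "nat \<Rightarrow> nat \<Rightarrow> nat \<Rightarrow> nat"
  assumes "\<And>c u v. c \<le> k \<Longrightarrow> u < N \<Longrightarrow> v < N \<Longrightarrow> y c u v \<le> b" "u < N" "v < N"
  shows "mask_matrix k y m u v \<le> Suc k * b"
  using assms by (auto simp: mask_matrix_def simp del: mult_Suc intro!: mask_weight_le)

lemma clow_total_le:
  fixes y :: "nat \<Rightarrow> nat \<Rightarrow> nat \<Rightarrow> nat"
  assumes "\<And>c u v. c \<le> k \<Longrightarrow> u < N \<Longrightarrow> v < N \<Longrightarrow> y c u v \<le> b"
    and "N * (Suc k * b) \<le> Z" "2 \<le> Z" "M \<le> 2 ^ k"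
  shows "(\<Sum>m<M. clow (mask_matrix k y m) N N) \<le> 2 ^ k * Z ^ (N + N)"
proof -
  have "(\<Sum>m<M. clow (mask_matrix k y m) N N) \<le> (\<Sum>m<M. Z ^ (N + N))"
    using assms by (intro sum_mono clow_le[where a = "Suc k * b"] mask_matrix_le) auto
  also have "\<dots> \<le> 2 ^ k * Z ^ (N + N)" using assms by simp
  finally show ?thesis .
qed

text \<open>The reversal puts the first flip at the highest power, so that one more flip is one step
  of Horner's rule; see \<open>poly_bits_poly_snoc\<close>.\<close>

definition bits_poly :: "bool list \<Rightarrow> 'a::comm_semiring_1 poly" where
  "bits_poly bs = Poly (map of_bool (rev bs))"

lemma map_bits_poly: "map_poly of_nat (bits_poly bs) = bits_poly bs"
  by (simp add: poly_eq_iff coeff_map_of_nat bits_poly_def coeff_Poly_eq nth_default_def)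

lemma inj_bits_poly: "inj_on (bits_poly :: bool list \<Rightarrow> 'a::comm_semiring_1 poly) {r. length r = m}"
proof (rule inj_onI)
  fix a b :: "bool list"
  assume ab: "a \<in> {r. length r = m}" "b \<in> {r. length r = m}" "(bits_poly a :: 'a poly) = bits_poly b"
  have "rev a ! i = rev b ! i" if "i < m" for i
    using arg_cong[OF ab(3), of "\<lambda>P. coeff P i"] ab(1,2) that
    by (auto simp: bits_poly_def coeff_Poly_eq nth_default_def of_bool_def split: if_splits)
  then have "rev a = rev b" using ab by (intro nth_equalityI) auto
  then show "a = b" by simp
qed

lemma poly_bits_poly_Nil: "poly (bits_poly []) B = 0"
  by (simp add: bits_poly_def)

lemma poly_bits_poly_snoc: "poly (bits_poly (bs @ [b])) B = poly (bits_poly bs) B * B + of_bool b"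
  by (simp add: bits_poly_def algebra_simps)

lemma poly_bits_poly_less: "2 \<le> B \<Longrightarrow> poly (bits_poly bs) (B::nat) < B ^ length bs"
proof (induction bs rule: rev_induct)
  case (snoc b bs)
  then have "Suc (poly (bits_poly bs) B) * B \<le> B ^ length bs * B" by (intro mult_le_mono1) auto
  moreover have "poly (bits_poly bs) B * B + of_bool b < Suc (poly (bits_poly bs) B) * B"
    using snoc.prems by (auto simp: of_bool_def)
  ultimately show ?case by (simp add: poly_bits_poly_snoc mult.commute)
qed (simp add: poly_bits_poly_Nil)

lemma poly_bits_poly_1: "poly (bits_poly bs) (1::nat) \<le> length bs"
  by (induction bs rule: rev_induct) (auto simp: poly_bits_poly_Nil poly_bits_poly_snoc of_bool_def)


section \<open>Program logic with step counts\<close>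

text \<open>An exponent \<open>d\<close> such that the value is at most \<open>M^d\<close> in a
  state bounded by \<open>M\<close>, hence of length at most \<open>d * len M\<close>. Constants are
  crudely bounded through \<open>a < 2^a\<close>.\<close>

primrec degr :: "exp \<Rightarrow> nat" where
  "degr (Const a) = Suc a"
| "degr (Get x i) = 1"
| "degr (Plus a b) = degr a + degr b"
| "degr (Minus a b) = degr a + degr b"
| "degr (Times a b) = degr a + degr b"
| "degr (Div a b) = degr a + degr b"

text \<open>The factor of \<open>(len M)^2\<close> in the bound \<open>cost_le\<close>. The square
  is forced by schoolbook multiplication and division; linear charges are absorbed.\<close>

primrec weight :: "exp \<Rightarrow> nat" where
  "weight (Const a) = len a"
| "weight (Get x i) = weight i + degr i + 1"
| "weight (Plus a b) = weight a + weight b + degr a + degr b"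
| "weight (Minus a b) = weight a + weight b + degr a + degr b"
| "weight (Times a b) = weight a + weight b + degr a * degr b"
| "weight (Div a b) = weight a + weight b + degr a * degr b"

definition bounded_state :: "nat \<Rightarrow> state \<Rightarrow> bool" where
  "bounded_state M s \<longleftrightarrow> (\<forall>x i. s x i \<le> M)"

lemma degr_pos: "0 < degr e"
  by (induction e) auto

lemma val_le:
  assumes "bounded_state M s" "2 \<le> M"
  shows "val e s \<le> M ^ degr e"
proof -
  \<comment> \<open>Numbers that are at least 2 have a sum no larger than their product, so addition
    can be treated as multiplication and exponents simply add.\<close>
  have sum: "x + y \<le> M ^ (i + j)" if "x \<le> M ^ i" "y \<le> M ^ j" "0 < i" "0 < j" for x y i j
  proof -
    have "2 \<le> M ^ i" "2 \<le> M ^ j"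
      using that assms(2) self_le_power[of M] by (meson le_trans One_nat_def Suc_leI one_le_numeral)+
    then have "M ^ i + M ^ j \<le> M ^ i * M ^ j"
      by (metis add_le_mono mult_2 mult_le_mono nat_mult_le_cancel_disj le_refl mult.commute nle_le order_trans)
    then show ?thesis using that by (simp add: power_add)
  qed
  show ?thesis
  proof (induction e)
    case (Const a)
    have "a < 2 ^ a" by (rule less_exp)
    also have "\<dots> \<le> M ^ a" using assms(2) by (rule power_mono) simp
    also have "\<dots> \<le> M ^ Suc a" using assms(2) by simp
    finally show ?case by simp
  next
    case (Plus a b)
    then show ?case by (simp add: sum degr_pos)
  next
    case (Minus a b)
    then show ?case using sum[OF Minus degr_pos degr_pos] by simp
  next
    case (Times a b)
    then show ?case by (simp add: power_add mult_le_mono)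
  next
    case (Div a b)
    have "val a s div val b s \<le> val a s + val b s" by (meson div_le_dividend le_add1 order_trans)
    then show ?case using sum[OF Div degr_pos degr_pos] by simp
  qed (use assms in \<open>auto simp: bounded_state_def\<close>)
qed

lemma len_mono: "a \<le> b \<Longrightarrow> len a \<le> len b"
  by (simp add: len_def floorlog_mono)

lemma len_pos: "0 < len a"
  by (simp add: len_def)

lemma len_power: "0 < d \<Longrightarrow> len (M ^ d) \<le> d * len M"
proof -
  assume "0 < d"
  have "M < 2 ^ floorlog 2 M"
    using floorlog_bounds[of M 2] by (cases "M = 0") auto
  then have "M ^ d < 2 ^ (floorlog 2 M * d)"
    using \<open>0 < d\<close> by (simp add: power_mult power_strict_mono)
  then have "floorlog 2 (M ^ d) \<le> floorlog 2 M * d"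
    by (simp add: floorlog_leI)
  then show ?thesis using \<open>0 < d\<close> by (auto simp: len_def algebra_simps)
qed

lemma len_val_le: "bounded_state M s \<Longrightarrow> 2 \<le> M \<Longrightarrow> len (val e s) \<le> degr e * len M"
  using len_mono[OF val_le, of M s e] len_power[OF degr_pos, of M e] by linarith

lemma cost_le:
  assumes "bounded_state M s" "2 \<le> M"
  shows "cost e s \<le> weight e * (len M)\<^sup>2"
proof -
  let ?L = "(len M)\<^sup>2"
  have L: "len M \<le> ?L" "1 \<le> ?L" using len_pos[of M] by (auto simp: power2_eq_square Suc_leI)
  have len: "len (val e s) \<le> degr e * ?L" for e
    using len_val_le[OF assms, of e] mult_le_mono2[OF L(1), of "degr e"] by linarith
  have mult: "len (val a s) * len (val b s) \<le> degr a * degr b * ?L" for a b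
    using mult_le_mono[OF len_val_le[OF assms, of a] len_val_le[OF assms, of b]]
    by (simp add: power2_eq_square mult_ac)
  show ?thesis
  proof (induction e)
    case (Const a)
    then show ?case using L by simp
  next
    case (Get x i)
    have "len (s x (val i s)) \<le> ?L"
      using len_mono[of "s x (val i s)" M] assms(1) L(1) by (simp add: bounded_state_def le_trans)
    then show ?case using Get len[of i] by (simp add: algebra_simps)
  next
    case (Plus a b)
    then show ?case using len[of a] len[of b] by (simp add: algebra_simps)
  next
    case (Minus a b)
    then show ?case using len[of a] len[of b] by (simp add: algebra_simps)
  next
    case (Times a b)
    then show ?case using mult[of a b] by (simp add: algebra_simps)
  next
    case (Div a b)
    then show ?case using mult[of a b] by (simp add: algebra_simps)
  qed
qed

section \<open>Frame conditions and rules for the program constructs\<close>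

primrec writes :: "com \<Rightarrow> vname set" where
  "writes Skip = {}"
| "writes (Put x i a) = {x}"
| "writes (Flip x) = {x}"
| "writes (Seq p q) = writes p \<union> writes q"
| "writes (Cond a p q) = writes p \<union> writes q"
| "writes (While a p) = writes p"

primrec flipless :: "com \<Rightarrow> bool" where
  "flipless Skip = True"
| "flipless (Put x i a) = True"
| "flipless (Flip x) = False"
| "flipless (Seq p q) = (flipless p \<and> flipless q)"
| "flipless (Cond a p q) = (flipless p \<and> flipless q)"
| "flipless (While a p) = flipless p"

text \<open>Frame facts are read off the syntax once and handed to every continuation by
  \<open>wp_mono\<close> and \<open>wp_For\<close>, so specifications need not list untouched arrays
  or unread bits.\<close>

definition framed :: "com \<Rightarrow> state \<Rightarrow> bool list \<Rightarrow> state \<Rightarrow> bool list \<Rightarrow> bool" where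
  "framed p s r s' r' \<longleftrightarrow> (\<forall>x. x \<notin> writes p \<longrightarrow> s' x = s x) \<and> (flipless p \<longrightarrow> r' = r)"

lemma exec_framed: "exec p s r t s' r' \<Longrightarrow> framed p s r s' r'"
  by (induction rule: exec.induct) (auto simp: framed_def)

text \<open>The 300 is a common allowance for the weights and degrees of the expressions in one
  assignment or one guard.\<close>

definition unit_cost :: "nat \<Rightarrow> nat" where
  "unit_cost M = 300 * (len M)\<^sup>2"

text \<open>Time is measured in steps of cost at most \<^term>\<open>unit_cost M\<close>: since all stored numbers stay
  below \<open>M\<close>, the cost of a step is bounded by the shape of its expressions alone.\<close>

definition wp :: "nat \<Rightarrow> nat \<Rightarrow> com \<Rightarrow> (state \<Rightarrow> bool list \<Rightarrow> bool) \<Rightarrow> state \<Rightarrow> bool list \<Rightarrow> bool" where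
  "wp M m p Q s r \<longleftrightarrow> (bounded_state M s \<longrightarrow>
     (\<exists>t s' r'. exec p s r t s' r' \<and> t \<le> m * unit_cost M \<and> bounded_state M s' \<and> Q s' r'))"

lemma wpI_bounded: "(bounded_state M s \<Longrightarrow> wp M m p Q s r) \<Longrightarrow> wp M m p Q s r"
  by (auto simp: wp_def)

lemma wp_mono:
  assumes "wp M m p Q s r" "m \<le> m'" "\<And>s' r'. framed p s r s' r' \<Longrightarrow> Q s' r' \<Longrightarrow> Q' s' r'"
  shows "wp M m' p Q' s r"
  unfolding wp_def
proof
  assume "bounded_state M s"
  then obtain t s' r' where *: "exec p s r t s' r'" "t \<le> m * unit_cost M" "bounded_state M s'" "Q s' r'"
    using assms(1) unfolding wp_def by blast
  then have "t \<le> m' * unit_cost M" using mult_le_mono1[OF assms(2), of "unit_cost M"] by linarith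
  then show "\<exists>t s' r'. exec p s r t s' r' \<and> t \<le> m' * unit_cost M \<and> bounded_state M s' \<and> Q' s' r'"
    using * assms(3) exec_framed by blast
qed

lemma wp_Put:
  assumes "val a s \<le> M" "2 \<le> M" "weight i + weight a + degr i + degr a \<le> 300"
    "Q (s(x := (s x)(val i s := val a s))) r"
  shows "wp M 1 (Put x i a) Q s r"
  unfolding wp_def
proof
  assume b: "bounded_state M s"
  let ?L = "(len M)\<^sup>2"
  have "len M \<le> ?L" using len_pos[of M] by (auto simp: power2_eq_square Suc_leI)
  then have "len (val e s) \<le> degr e * ?L" for e
    using len_val_le[OF b assms(2), of e] mult_le_mono2[of "len M" ?L "degr e"] by linarith
  then have "cost i s + cost a s + len (val i s) + len (val a s) \<le>
      weight i * ?L + weight a * ?L + degr i * ?L + degr a * ?L"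
    using cost_le[OF b assms(2)] by (meson add_mono)
  also have "\<dots> = (weight i + weight a + degr i + degr a) * ?L" by (simp add: algebra_simps)
  also have "\<dots> \<le> 1 * unit_cost M" using assms(3) by (simp add: unit_cost_def)
  finally show "\<exists>t s' r'. exec (Put x i a) s r t s' r' \<and> t \<le> 1 * unit_cost M \<and> bounded_state M s' \<and> Q s' r'"
    using exec.Put[of x i a s r] assms(1,4) b by (fastforce simp: bounded_state_def)
qed

lemma wp_Flip:
  assumes "r = b # r'" "2 \<le> M" "Q (s(x := (s x)(0 := of_bool b))) r'"
  shows "wp M 1 (Flip x) Q s r"
proof -
  have "1 \<le> unit_cost M" using len_pos[of M] by (simp add: unit_cost_def)
  then show ?thesis
    unfolding wp_def using assms exec.Flip[of x s b r'] by (fastforce simp: bounded_state_def of_bool_def)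
qed

lemma wp_Seq:
  assumes "wp M m1 p (\<lambda>s' r'. wp M m2 q Q s' r') s r"
  shows "wp M (m1 + m2) (Seq p q) Q s r"
  unfolding wp_def
proof
  assume "bounded_state M s"
  then obtain t s' r' where 1: "exec p s r t s' r'" "t \<le> m1 * unit_cost M" "bounded_state M s'" "wp M m2 q Q s' r'"
    using assms unfolding wp_def by blast
  then obtain t' s'' r'' where 2: "exec q s' r' t' s'' r''" "t' \<le> m2 * unit_cost M" "bounded_state M s''" "Q s'' r''"
    unfolding wp_def by blast
  have "t + t' \<le> (m1 + m2) * unit_cost M" using 1 2 by (simp add: algebra_simps)
  then show "\<exists>t s' r'. exec (Seq p q) s r t s' r' \<and> t \<le> (m1 + m2) * unit_cost M \<and> bounded_state M s' \<and> Q s' r'"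
    using exec.Seq[OF 1(1) 2(1)] 2 by blast
qed

lemma guard_cost:
  assumes b: "bounded_state M s" and "2 \<le> M" "weight a + degr a \<le> 300"
  shows "cost a s + len (val a s) \<le> unit_cost M"
proof -
  let ?L = "(len M)\<^sup>2"
  have "len M \<le> ?L" using len_pos[of M] by (auto simp: power2_eq_square Suc_leI)
  then have "len (val a s) \<le> degr a * ?L"
    using len_val_le[OF b assms(2), of a] mult_le_mono2[of "len M" ?L "degr a"] by linarith
  then have "cost a s + len (val a s) \<le> weight a * ?L + degr a * ?L"
    using cost_le[OF b assms(2)] by (meson add_mono)
  also have "\<dots> = (weight a + degr a) * ?L" by (simp add: algebra_simps)
  also have "\<dots> \<le> unit_cost M" using assms(3) by (simp add: unit_cost_def)
  finally show ?thesis .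
qed

text \<open>The invariant is indexed by the iteration number and forces exactly \<open>J\<close>
  iterations, which gives termination and time together: one guard per iteration and one final
  guard.\<close>

lemma wp_While:
  assumes M: "2 \<le> M" and w: "weight a + degr a \<le> 300"
    and I0: "I 0 s r"
    and step: "\<And>j s' r'. j < J \<Longrightarrow> I j s' r' \<Longrightarrow> val a s' \<noteq> 0 \<and> wp M m p (I (Suc j)) s' r'"
    and stop: "\<And>s' r'. I J s' r' \<Longrightarrow> val a s' = 0 \<and> Q s' r'"
  shows "wp M (J * (m + 1) + 1) (While a p) Q s r"
proof -
  have "wp M ((J - j) * (m + 1) + 1) (While a p) Q s' r'" if "j \<le> J" "I j s' r'" for j s' r'
    using that
  proof (induction "J - j" arbitrary: j s' r')
    case 0
    then have "j = J" by simp
    show ?case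
      unfolding wp_def
    proof
      assume b: "bounded_state M s'"
      have "val a s' = 0" "Q s' r'" using stop 0 \<open>j = J\<close> by auto
      then show "\<exists>t s'' r''. exec (While a p) s' r' t s'' r'' \<and> t \<le> ((J - j) * (m + 1) + 1) * unit_cost M \<and>
          bounded_state M s'' \<and> Q s'' r''"
        using exec.WhileFalse[of a s' p r'] guard_cost[OF b M w] b \<open>j = J\<close> by fastforce
    qed
  next
    case (Suc d)
    then have j: "j < J" "d = J - Suc j" by auto
    show ?case
      unfolding wp_def
    proof
      assume b: "bounded_state M s'"
      have v: "val a s' \<noteq> 0" and w': "wp M m p (I (Suc j)) s' r'"
        using step[OF j(1) Suc.prems(2)] by auto
      obtain t1 s1 r1 where 1: "exec p s' r' t1 s1 r1" "t1 \<le> m * unit_cost M" "bounded_state M s1" "I (Suc j) s1 r1"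
        using w' b unfolding wp_def by blast
      have "wp M ((J - Suc j) * (m + 1) + 1) (While a p) Q s1 r1"
        using Suc.hyps(1)[OF j(2)] j(1) 1(4) by simp
      then obtain t2 s2 r2 where 2: "exec (While a p) s1 r1 t2 s2 r2"
          "t2 \<le> ((J - Suc j) * (m + 1) + 1) * unit_cost M" "bounded_state M s2" "Q s2 r2"
        using 1(3) unfolding wp_def by blast
      have "cost a s' + len (val a s') + t1 + t2 \<le>
          unit_cost M + m * unit_cost M + ((J - Suc j) * (m + 1) + 1) * unit_cost M"
        using guard_cost[OF b M w] 1(2) 2(2) by linarith
      also have "\<dots> = (Suc (J - Suc j) * (m + 1) + 1) * unit_cost M" by (simp add: algebra_simps)
      also have "Suc (J - Suc j) = J - j" using j by simp
      finally show "\<exists>t s'' r''. exec (While a p) s' r' t s'' r'' \<and> t \<le> ((J - j) * (m + 1) + 1) * unit_cost M \<and>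
          bounded_state M s'' \<and> Q s'' r''"
        using exec.WhileTrue[OF v 1(1) 2(1)] 2 by blast
    qed
  qed
  from this[of 0 s r] I0 show ?thesis by simp
qed

abbreviation Var :: "vname \<Rightarrow> exp" where
  "Var x \<equiv> Get x (Const 0)"

abbreviation Assign :: "vname \<Rightarrow> exp \<Rightarrow> com" where
  "Assign x a \<equiv> Put x (Const 0) a"

text \<open>The machine has no comparison; truncated subtraction is nonzero exactly while the
  counter is below the bound.\<close>

definition For :: "vname \<Rightarrow> exp \<Rightarrow> com \<Rightarrow> com" where
  "For x e p = Seq (Assign x (Const 0))
     (While (Minus e (Var x)) (Seq p (Assign x (Plus (Var x) (Const 1)))))"

lemma writes_For [simp]: "writes (For x e p) = insert x (writes p)"
  by (auto simp: For_def)

lemma flipless_For [simp]: "flipless (For x e p) = flipless p"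
  by (simp add: For_def)

text \<open>Each iteration adds the guard and the increment to the body, hence \<open>m + 2\<close>;
  the final 2 pays for initialisation and the last guard. The body re-establishes the invariant for
  the state after the increment.\<close>

lemma wp_For:
  assumes M: "2 \<le> M" "J \<le> M" and x: "x \<notin> writes p"
    and w: "weight e + 2 * degr e \<le> 200"
    and e: "\<And>s'. (\<forall>y. y \<notin> insert x (writes p) \<longrightarrow> s' y = s y) \<Longrightarrow> val e s' = J"
    and I0: "I 0 (s(x := (s x)(0 := 0))) r"
    and step: "\<And>j s' r'. j < J \<Longrightarrow> I j s' r' \<Longrightarrow> s' x 0 = j \<Longrightarrow> framed (For x e p) s r s' r' \<Longrightarrow>
       wp M m p (\<lambda>s'' r''. I (Suc j) (s''(x := (s'' x)(0 := Suc j))) r'') s' r'"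
    and stop: "\<And>s' r'. I J s' r' \<Longrightarrow> s' x 0 = J \<Longrightarrow> framed (For x e p) s r s' r' \<Longrightarrow> Q s' r'"
    and m: "J * (m + 2) + 2 \<le> m'"
  shows "wp M m' (For x e p) Q s r"
proof -
  have len: "len 0 = 1" "len (Suc 0) = 2" by (auto simp: len_def floorlog_def)
  let ?I = "\<lambda>j s' r'. I j s' r' \<and> s' x 0 = j \<and> framed (For x e p) s r s' r'"
  have "wp M (1 + (J * ((m + 1) + 1) + 1)) (For x e p) Q s r"
    unfolding For_def
  proof (rule wp_Seq, rule wp_Put)
    let ?s = "s(x := (s x)(0 := 0))"
    have "wp M (J * ((m + 1) + 1) + 1) (While (Minus e (Var x)) (Seq p (Assign x (Plus (Var x) (Const 1))))) Q ?s r"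
    proof (rule wp_While[where I = ?I])
      show "?I 0 ?s r" using I0 by (auto simp: framed_def)
      fix j s' r' assume j: "j < J" and I: "?I j s' r'"
      have "val e s' = J" using I by (intro e) (auto simp: framed_def)
      moreover have "wp M (m + 1) (Seq p (Assign x (Plus (Var x) (Const 1)))) (?I (Suc j)) s' r'"
      proof (rule wp_Seq)
        have "wp M m p (\<lambda>s'' r''. I (Suc j) (s''(x := (s'' x)(0 := Suc j))) r'') s' r'"
          using step j I by blast
        then show "wp M m p (wp M 1 (Assign x (Plus (Var x) (Const 1))) (?I (Suc j))) s' r'"
        proof (rule wp_mono[OF _ le_refl])
          fix s'' r'' assume fr: "framed p s' r' s'' r''" and I': "I (Suc j) (s''(x := (s'' x)(0 := Suc j))) r''"
          have "s'' x 0 = j" using fr I x by (simp add: framed_def)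
          then show "wp M 1 (Assign x (Plus (Var x) (Const 1))) (?I (Suc j)) s'' r''"
            using fr I I' j M by (intro wp_Put) (auto simp: len framed_def)
        qed
      qed
      ultimately show "val (Minus e (Var x)) s' \<noteq> 0 \<and>
          wp M (m + 1) (Seq p (Assign x (Plus (Var x) (Const 1)))) (?I (Suc j)) s' r'"
        using j I by simp
    next
      fix s' r' assume I: "?I J s' r'"
      have "val e s' = J" using I by (intro e) (auto simp: framed_def)
      then show "val (Minus e (Var x)) s' = 0 \<and> Q s' r'" using I stop by simp
    qed (use M w in \<open>auto simp: len\<close>)
    then show "wp M (J * ((m + 1) + 1) + 1) (While (Minus e (Var x)) (Seq p (Assign x (Plus (Var x) (Const 1))))) Q
      (s(x := (s x)(val (Const 0) s := val (Const 0) s))) r" by simp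
  qed (use M in \<open>auto simp: len\<close>)
  then show ?thesis by (rule wp_mono) (use m in auto)
qed


section \<open>Matrices and clow sums on the machine\<close>

lemma len_numerals: "len 0 = 1" "len (Suc 0) = 2" "len 1 = 2" "len 2 = 3" "len 8 = 5"
  by (auto simp: len_def compute_floorlog)

text \<open>Row-major addressing. Rows will have the input length as their length, which exceeds
  \<open>N\<close>, so that column \<open>N\<close> of the clow table fits too.\<close>

definition ix :: "nat \<Rightarrow> nat \<Rightarrow> nat \<Rightarrow> nat" where
  "ix n x y = x * n + y"

lemma ix_eq_iff: "y < n \<Longrightarrow> y' < n \<Longrightarrow> ix n x y = ix n x' y' \<longleftrightarrow> x = x' \<and> y = y'"
  unfolding ix_def
proof
  assume y: "y < n" "y' < n" and eq: "x * n + y = x' * n + y'"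
  have "x = (x * n + y) div n" "y = (x * n + y) mod n" using y by auto
  then show "x = x' \<and> y = y'" using y eq by auto
qed auto

text \<open>\<open>Y\<close> is kept parallel to the input: the weight of a matrix entry sits at the
  position of its bit, and \<open>O\<close> is the length of the header.\<close>

definition cell :: "state \<Rightarrow> nat \<Rightarrow> nat \<Rightarrow> nat \<Rightarrow> nat" where
  "cell s c u v = s ''Y'' (s ''O'' 0 + (c * (s ''N'' 0 * s ''N'' 0) + (u * s ''N'' 0 + v)))"

definition cell_exp :: "exp \<Rightarrow> exp" where
  "cell_exp c = Get ''Y'' (Plus (Var ''O'') (Plus (Times c (Times (Var ''N'') (Var ''N'')))
     (Plus (Times (Var ''u'') (Var ''N'')) (Var ''v''))))"

lemma val_cell_exp: "val (cell_exp c) s = cell s (val c s) (s ''u'' 0) (s ''v'' 0)"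
  by (simp add: cell_exp_def cell_def)

lemma degr_cell_exp: "degr (cell_exp c) = 1"
  by (simp add: cell_exp_def)

lemma weight_cell_exp: "weight (cell_exp c) = weight c + 5 * degr c + 41"
  by (simp add: cell_exp_def len_numerals)

lemma cell_cong: "s' ''Y'' = s ''Y'' \<Longrightarrow> s' ''O'' = s ''O'' \<Longrightarrow> s' ''N'' = s ''N'' \<Longrightarrow> cell s' = cell s"
  by (intro ext) (simp add: cell_def)

text \<open>Bits of the mask are peeled off by halving \<open>q\<close>; the low bit is recovered as
  \<open>q - (q div 2) * 2\<close>.\<close>

definition mask_bits :: com where
  "mask_bits = For ''i'' (Var ''K'') (Seq
     (Assign ''a'' (Plus (Var ''a'') (Times (Minus (Var ''q'') (Times (Div (Var ''q'') (Const 2)) (Const 2)))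
        (cell_exp (Plus (Var ''i'') (Const 1))))))
     (Assign ''q'' (Div (Var ''q'') (Const 2))))"

lemma writes_mask_bits: "writes mask_bits = {''i'', ''a'', ''q''}" "flipless mask_bits"
  by (auto simp: mask_bits_def)

lemma mask_weight_Suc:
  "mask_weight (Suc j) y m u v = mask_weight j y m u v + of_nat (m div 2 ^ j mod 2) * y (Suc j) u v"
  by (simp add: mask_weight_def add.assoc)

text \<open>The accumulator runs through these prefix sums, so a bound on the last one keeps all of
  them within the machine bound.\<close>

lemma mask_weight_mono: "j \<le> k \<Longrightarrow> mask_weight j y m u v \<le> (mask_weight k y m u v :: nat)"
  by (auto simp: mask_weight_def intro!: sum_mono2)

locale layout =
  fixes n N k M :: nat
  assumes N: "N < n" and k: "k < n" and M: "n \<le> M" "2 \<le> M"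
begin

definition sized :: "state \<Rightarrow> bool" where
  "sized s \<longleftrightarrow> s ''n'' 0 = n \<and> s ''N'' 0 = N \<and> s ''K'' 0 = k"

lemma wp_mask_bits:
  assumes s: "sized s" "s ''a'' 0 = cell s 0 (s ''u'' 0) (s ''v'' 0)"
    and le: "mask_weight k (cell s) (s ''q'' 0) (s ''u'' 0) (s ''v'' 0) \<le> M"
    and post: "\<And>s'. framed mask_bits s r s' r \<Longrightarrow>
      s' ''a'' 0 = mask_weight k (cell s) (s ''q'' 0) (s ''u'' 0) (s ''v'' 0) \<Longrightarrow> Q s' r"
  shows "wp M (k * 4 + 2) mask_bits Q s r"
proof (rule wpI_bounded)
  assume b: "bounded_state M s"
  let ?w = "\<lambda>j. mask_weight j (cell s) (s ''q'' 0) (s ''u'' 0) (s ''v'' 0)"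
  let ?I = "\<lambda>j s' r'. s' ''a'' 0 = ?w j \<and> s' ''q'' 0 = s ''q'' 0 div 2 ^ j"
  show ?thesis
    unfolding mask_bits_def
  proof (rule wp_For[where I = ?I and J = k and m = "1 + 1"], goal_cases)
    case (7 j s' r')
    have c: "cell s' = cell s" using 7 by (intro cell_cong) (auto simp: framed_def)
    have fr: "s' ''u'' = s ''u''" "s' ''v'' = s ''v''" using 7 by (auto simp: framed_def)
    have div: "x div 2 ^ j div 2 = x div 2 ^ Suc j" for x :: nat by (simp only: power_Suc2 div_mult2_eq)
    have mod: "x div 2 ^ j - x div 2 ^ Suc j * 2 = x div 2 ^ j mod 2" for x :: nat
      by (simp only: minus_div_mult_eq_mod flip: div)
    have *: "?w (Suc j) \<le> M" using mask_weight_mono[of "Suc j" k] 7(1) le order_trans by (metis Suc_leI)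
    have **: "s ''q'' 0 div 2 ^ Suc j \<le> M"
      using b by (meson bounded_state_def div_le_dividend order_trans)
    have "?w j + (s ''q'' 0 div 2 ^ j) mod 2 * cell s (Suc j) (s ''u'' 0) (s ''v'' 0) = ?w (Suc j)"
      by (simp add: mask_weight_Suc)
    then show ?case
      using 7(2,3) M(2) * **
      by (intro wp_Seq wp_Put)
        (simp_all add: len_numerals weight_cell_exp degr_cell_exp val_cell_exp c fr mod div del: power_Suc)
  next
    case (8 s' r')
    then have "r' = r" by (simp add: framed_def writes_mask_bits)
    show ?case using 8 unfolding \<open>r' = r\<close> by (intro post[unfolded mask_bits_def]) auto
  qed (use s M k in \<open>auto simp: sized_def len_numerals mask_weight_def\<close>)
qed


end

definition index_exp :: "exp \<Rightarrow> exp \<Rightarrow> exp" where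
  "index_exp a b = Plus (Times a (Var ''n'')) b"

lemma index_exp_simps [simp]:
  "val (index_exp a b) s = ix (s ''n'' 0) (val a s) (val b s)"
  "degr (index_exp a b) = degr a + degr b + 1"
  "weight (index_exp a b) = weight a + weight b + 2 * degr a + degr b + 4"
  by (auto simp: index_exp_def len_numerals ix_def)

text \<open>Only pairs \<open>u < v\<close> are visited, and each is written to both triangles. The
  diagonal is never written and keeps its initial zero through all masks.\<close>

definition mask_row :: com where
  "mask_row = For ''u'' (Var ''v'') (Seq (Assign ''a'' (cell_exp (Const 0)))
     (Seq (Assign ''q'' (Var ''m'')) (Seq mask_bits
       (Seq (Put ''A'' (index_exp (Var ''u'') (Var ''v'')) (Var ''a''))
         (Put ''A'' (index_exp (Var ''v'') (Var ''u'')) (Var ''a''))))))"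

definition mask_prog :: com where
  "mask_prog = For ''v'' (Var ''N'') mask_row"

lemma writes_mask_row: "writes mask_row = {''u'', ''i'', ''a'', ''q'', ''A''}" "flipless mask_row"
  by (auto simp: mask_row_def writes_mask_bits)

lemma writes_mask_prog: "writes mask_prog = {''v'', ''u'', ''i'', ''a'', ''q'', ''A''}" "flipless mask_prog"
  by (auto simp: mask_prog_def writes_mask_row)

section \<open>The clow recurrence on the machine\<close>

definition sum_prog :: com where
  "sum_prog = For ''u'' (Plus (Var ''h'') (Const 1)) (Assign ''a'' (Plus (Var ''a'')
     (Times (Get ''G'' (index_exp (index_exp (Var ''h'') (Var ''l'')) (Var ''u'')))
       (Get ''A'' (index_exp (Var ''u'') (Var ''v''))))))"

text \<open>The last column treated is \<open>v = h\<close>, so \<open>a\<close> is left holding the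
  sum that closes a clow, which \<open>head_prog\<close> adds to \<open>D\<close>. The same sum is
  also stored in \<open>G\<close> at \<open>v = h\<close>, where it is not the open clow weight; if
  another iteration of \<open>head_prog\<close> follows, it first replaces that cell by an entry of
  \<open>D\<close>.\<close>

definition step_prog :: com where
  "step_prog = For ''v'' (Plus (Var ''h'') (Const 1)) (Seq (Assign ''a'' (Const 0)) (Seq sum_prog
     (Put ''G'' (index_exp (index_exp (Var ''h'') (Plus (Var ''l'') (Const 1))) (Var ''v'')) (Var ''a''))))"

definition head_prog :: com where
  "head_prog = For ''l'' (Var ''N'') (Seq
     (Put ''G'' (index_exp (index_exp (Var ''h'') (Var ''l'')) (Var ''h'')) (Get ''D'' (index_exp (Var ''h'') (Var ''l''))))
     (Seq step_prog (Put ''D'' (index_exp (Plus (Var ''h'') (Const 1)) (Plus (Var ''l'') (Const 1)))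
       (Plus (Get ''D'' (index_exp (Var ''h'') (Plus (Var ''l'') (Const 1)))) (Var ''a'')))))"

definition clow_prog :: com where
  "clow_prog = For ''h'' (Var ''N'') (Seq
     (Put ''D'' (index_exp (Plus (Var ''h'') (Const 1)) (Const 0)) (Const 1)) head_prog)"

lemma writes_sum_prog: "writes sum_prog = {''u'', ''a''}" "flipless sum_prog"
  by (auto simp: sum_prog_def)

lemma writes_step_prog: "writes step_prog = {''v'', ''u'', ''a'', ''G''}" "flipless step_prog"
  by (auto simp: step_prog_def writes_sum_prog)

lemma writes_head_prog: "writes head_prog = {''l'', ''v'', ''u'', ''a'', ''G'', ''D''}" "flipless head_prog"
  by (auto simp: head_prog_def writes_step_prog)

lemma writes_clow_prog: "writes clow_prog = {''h'', ''l'', ''v'', ''u'', ''a'', ''G'', ''D''}" "flipless clow_prog"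
  by (auto simp: clow_prog_def writes_head_prog)

context layout
begin

lemma wp_mask_row:
  assumes s: "sized s" "s ''v'' 0 = v" "v < N"
    and le: "\<And>u. u < v \<Longrightarrow> mask_weight k (cell s) (s ''m'' 0) u v \<le> M"
    and post: "\<And>s'. framed mask_row s r s' r \<Longrightarrow>
      (\<And>u. u < v \<Longrightarrow> s' ''A'' (ix n u v) = mask_weight k (cell s) (s ''m'' 0) u v) \<Longrightarrow>
      (\<And>u. u < v \<Longrightarrow> s' ''A'' (ix n v u) = mask_weight k (cell s) (s ''m'' 0) u v) \<Longrightarrow>
      (\<And>x y. x < N \<Longrightarrow> y < N \<Longrightarrow> \<not> (y = v \<and> x < v) \<Longrightarrow> \<not> (x = v \<and> y < v) \<Longrightarrow>
         s' ''A'' (ix n x y) = s ''A'' (ix n x y)) \<Longrightarrow> Q s' r"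
  shows "wp M (N * (4 * k + 8) + 2) mask_row Q s r"
proof (rule wpI_bounded)
  assume b: "bounded_state M s"
  let ?w = "\<lambda>u. mask_weight k (cell s) (s ''m'' 0) u v"
  let ?I = "\<lambda>j s' r'. (\<forall>u<j. s' ''A'' (ix n u v) = ?w u \<and> s' ''A'' (ix n v u) = ?w u) \<and>
    (\<forall>x<N. \<forall>y<N. \<not> (y = v \<and> x < v) \<longrightarrow> \<not> (x = v \<and> y < v) \<longrightarrow> s' ''A'' (ix n x y) = s ''A'' (ix n x y))"
  show ?thesis
    unfolding mask_row_def
  proof (rule wp_For[where I = ?I and J = v and m = "1 + (1 + ((k * 4 + 2) + (1 + 1)))"], goal_cases)
    case (7 j s' r')
    note st = 7
    have c: "cell s' = cell s" using st by (intro cell_cong) (auto simp: framed_def writes_mask_bits)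
    have fr: "s' ''v'' 0 = v" "s' ''m'' 0 = s ''m'' 0" "s' ''n'' 0 = n" "s' ''N'' 0 = N" "s' ''K'' 0 = k"
      using st(4) s by (auto simp: framed_def writes_mask_bits sized_def)
    have cs: "cell (s'(''a'' := f)) = cell s" "cell (s'(''a'' := f, ''q'' := g)) = cell s" for f g
      unfolding c[symmetric] by (auto intro!: cell_cong)
    have "mask_weight 0 (cell s) (s ''m'' 0) j v \<le> ?w j" by (rule mask_weight_mono) simp
    then have 0: "cell s 0 j v \<le> M" using le[OF st(1)] by (simp add: mask_weight_def)
    have 1: "s ''m'' 0 \<le> M" using b by (simp add: bounded_state_def)
    show ?case
    proof (intro wp_Seq wp_Put, goal_cases)
      case 7
      show ?case
      proof (rule wp_mask_bits, goal_cases)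
        case (4 s'')
        have fr'': "s'' ''v'' 0 = v" "s'' ''u'' 0 = j" "s'' ''n'' 0 = n" "s'' ''A'' = s' ''A''"
          using 4(1) fr \<open>s' ''u'' 0 = j\<close> by (auto simp: framed_def writes_mask_bits)
        have a: "s'' ''a'' 0 = ?w j" using 4(2) fr \<open>s' ''u'' 0 = j\<close> by (simp add: cs)
        show ?case
          using st(1-3) M N s le[OF st(1)]
          by (intro wp_Seq wp_Put) (auto simp: fr'' a len_numerals ix_eq_iff less_Suc_eq)
      qed (use fr \<open>s' ''u'' 0 = j\<close> le[OF st(1)] in \<open>auto simp: sized_def val_cell_exp cs c\<close>)
    qed (use fr \<open>s' ''u'' 0 = j\<close> 0 1 M in \<open>auto simp: len_numerals weight_cell_exp degr_cell_exp val_cell_exp c\<close>)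
  next
    case (8 s' r')
    then have "r' = r" by (simp add: framed_def writes_mask_bits)
    show ?case using 8 unfolding \<open>r' = r\<close> by (intro post[unfolded mask_row_def]) auto
  next
    case 9
    show ?case using mult_le_mono1[of v N "4 * k + 8"] s(3) by (simp add: algebra_simps)
  qed (use s M N in \<open>auto simp: sized_def len_numerals writes_mask_bits\<close>)
qed

lemma wp_mask_prog:
  assumes s: "sized s" and diag: "\<And>x. x < N \<Longrightarrow> s ''A'' (ix n x x) = 0"
    and le: "\<And>u v. u < N \<Longrightarrow> v < N \<Longrightarrow> mask_weight k (cell s) (s ''m'' 0) u v \<le> M"
    and post: "\<And>s'. framed mask_prog s r s' r \<Longrightarrow>
      (\<And>u v. u < N \<Longrightarrow> v < N \<Longrightarrow> s' ''A'' (ix n u v) = mask_matrix k (cell s) (s ''m'' 0) u v) \<Longrightarrow> Q s' r"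
  shows "wp M (N * (N * (4 * k + 8) + 4) + 2) mask_prog Q s r"
proof -
  let ?W = "mask_matrix k (cell s) (s ''m'' 0)"
  let ?I = "\<lambda>j s' r'. (\<forall>u<j. \<forall>v<j. s' ''A'' (ix n u v) = ?W u v) \<and> (\<forall>x<N. s' ''A'' (ix n x x) = 0)"
  show ?thesis
    unfolding mask_prog_def
  proof (rule wp_For[where I = ?I and J = N and m = "N * (4 * k + 8) + 2"], goal_cases)
    case (7 j s' r')
    note st = 7
    have c: "cell s' = cell s" using st by (intro cell_cong) (auto simp: framed_def writes_mask_row)
    have fr: "s' ''m'' 0 = s ''m'' 0" "sized s'"
      using st(4) s by (auto simp: framed_def writes_mask_row sized_def)
    show ?case
    proof (rule wp_mask_row[OF fr(2) st(3) st(1)], goal_cases)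
      case (1 u)
      then show ?case using le[of u j] st(1) by (simp add: c fr)
    next
      case (2 s'')
      have "s'' ''A'' (ix n u v) = ?W u v" if "u < Suc j" "v < Suc j" for u v
        using that 2(2,3)[of u] 2(2,3)[of v] 2(4)[of u v] st(1,2)
        by (cases "u = j"; cases "v = j") (auto simp: less_Suc_eq mask_matrix_def c fr)
      moreover have "s'' ''A'' (ix n x x) = 0" if "x < N" for x
        using that 2(4)[of x x] st(2) by auto
      ultimately show ?case by simp
    qed
  next
    case (8 s' r')
    then have "r' = r" by (simp add: framed_def writes_mask_row)
    show ?case using 8 unfolding \<open>r' = r\<close> by (intro post[unfolded mask_prog_def]) auto
  next
    case 9
    show ?case by (simp add: algebra_simps)
  qed (use s M N diag in \<open>auto simp: sized_def len_numerals writes_mask_row\<close>)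
qed

lemma wp_sum_prog:
  assumes s: "sized s" "s ''h'' 0 = h" "s ''l'' 0 = l" "s ''v'' 0 = v" "s ''a'' 0 = 0"
    and hl: "h < N"
    and g: "\<And>u. u \<le> h \<Longrightarrow> s ''G'' (ix n (ix n h l) u) = g u"
    and A: "\<And>u. u \<le> h \<Longrightarrow> s ''A'' (ix n u v) = A u v"
    and le: "\<And>j. j \<le> Suc h \<Longrightarrow> (\<Sum>u<j. g u * A u v) \<le> M"
    and post: "\<And>s'. framed sum_prog s r s' r \<Longrightarrow> s' ''a'' 0 = (\<Sum>u<Suc h. g u * A u v) \<Longrightarrow> Q s' r"
  shows "wp M (N * 3 + 2) sum_prog Q s r"
  unfolding sum_prog_def
proof (rule wp_For[where I = "\<lambda>j s' r'. s' ''a'' 0 = (\<Sum>u<j. g u * A u v)" and J = "Suc h" and m = 1], goal_cases)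
  case (7 j s' r')
  note st = 7
  have fr: "s' ''h'' 0 = h" "s' ''l'' 0 = l" "s' ''v'' 0 = v" "s' ''n'' 0 = n" "s' ''G'' = s ''G''" "s' ''A'' = s ''A''"
    using st(4) s by (auto simp: framed_def sized_def)
  show ?case
    using st(1-3) M le[of "Suc j"] g[of j] A[of j]
    by (intro wp_Put) (auto simp: fr len_numerals)
next
  case (8 s' r')
  then have "r' = r" by (simp add: framed_def)
  show ?case using 8 unfolding \<open>r' = r\<close> by (intro post[unfolded sum_prog_def]) auto
qed (use s M N hl in \<open>auto simp: sized_def len_numerals\<close>)

lemma wp_step_prog:
  assumes s: "sized s" "s ''h'' 0 = h" "s ''l'' 0 = l"
    and hl: "h < N" "l < N"
    and g: "\<And>u. u \<le> h \<Longrightarrow> s ''G'' (ix n (ix n h l) u) = g u"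
    and A: "\<And>u v. u \<le> h \<Longrightarrow> v \<le> h \<Longrightarrow> s ''A'' (ix n u v) = A u v"
    and le: "\<And>j v. j \<le> Suc h \<Longrightarrow> v \<le> h \<Longrightarrow> (\<Sum>u<j. g u * A u v) \<le> M"
    and post: "\<And>s'. framed step_prog s r s' r \<Longrightarrow> s' ''a'' 0 = (\<Sum>u<Suc h. g u * A u h) \<Longrightarrow>
      (\<And>v. v \<le> h \<Longrightarrow> s' ''G'' (ix n (ix n h (Suc l)) v) = (\<Sum>u<Suc h. g u * A u v)) \<Longrightarrow>
      (\<And>h' v. v < h' \<Longrightarrow> h' < N \<Longrightarrow> s' ''G'' (ix n (ix n h' 0) v) = s ''G'' (ix n (ix n h' 0) v)) \<Longrightarrow> Q s' r"
  shows "wp M (N * (N * 3 + 6) + 2) step_prog Q s r"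
proof -
  let ?S = "\<lambda>v. \<Sum>u<Suc h. g u * A u v"
  let ?I = "\<lambda>j s' r'. (0 < j \<longrightarrow> s' ''a'' 0 = ?S (j - 1)) \<and>
    (\<forall>v<j. s' ''G'' (ix n (ix n h (Suc l)) v) = ?S v) \<and>
    (\<forall>h' l' v. v < n \<longrightarrow> l' < n \<longrightarrow> h' \<noteq> h \<or> l' \<noteq> Suc l \<longrightarrow> s' ''G'' (ix n (ix n h' l') v) = s ''G'' (ix n (ix n h' l') v))"
  show ?thesis
    unfolding step_prog_def
  proof (rule wp_For[where I = ?I and J = "Suc h" and m = "1 + ((N * 3 + 2) + 1)"], goal_cases)
    case (7 j s' r')
    note st = 7
    have fr: "s' ''h'' 0 = h" "s' ''l'' 0 = l" "s' ''A'' = s ''A''" "sized s'"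
      using st(4) s by (auto simp: framed_def sized_def writes_sum_prog)
    have g': "s' ''G'' (ix n (ix n h l) u) = g u" if "u \<le> h" for u
      using that st(2) g[OF that] N hl by simp
    show ?case
    proof (intro wp_Seq wp_Put, goal_cases)
      case 4
      show ?case
      proof (rule wp_sum_prog[of _ h l j g A], goal_cases)
        case (10 s'')
        have fr'': "s'' ''h'' 0 = h" "s'' ''l'' 0 = l" "s'' ''v'' 0 = j" "s'' ''G'' = s' ''G''" "s'' ''n'' 0 = n"
          using 10(1) fr st(3) by (auto simp: framed_def writes_sum_prog sized_def)
        show ?case
          using st(1,2) 10(2) hl N M le[of "Suc h" j]
          by (intro wp_Put) (auto simp: fr'' len_numerals ix_eq_iff less_Suc_eq simp del: sum.lessThan_Suc)
      qed (use fr st(1,3) hl g' A le M in \<open>auto simp: sized_def simp del: sum.lessThan_Suc\<close>)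
    qed (use M in \<open>auto simp: len_numerals\<close>)
  next
    case (8 s' r')
    then have "r' = r" by (simp add: framed_def writes_sum_prog)
    moreover have "s' ''G'' (ix n (ix n h' 0) v) = s ''G'' (ix n (ix n h' 0) v)" if "v < h'" "h' < N" for h' v
      using 8(1) that N by (elim conjE) (drule spec[of _ h'], drule spec[of _ 0], drule spec[of _ v], simp)
    ultimately show ?case using 8 unfolding \<open>r' = r\<close>
      by (intro post[unfolded step_prog_def]) (auto simp del: sum.lessThan_Suc)
  next
    case 9
    show ?case using mult_le_mono1[of "Suc h" N "N * 3 + 6"] hl by (simp add: algebra_simps)
  qed (use s M N hl in \<open>auto simp: sized_def len_numerals writes_sum_prog\<close>)
qed

text \<open>Everything the clow computation stores: table entries and the partial sums in the
  accumulator.\<close>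

definition clow_small :: "(nat \<Rightarrow> nat \<Rightarrow> nat) \<Rightarrow> bool" where
  "clow_small A \<longleftrightarrow> (\<forall>h\<le>N. \<forall>l\<le>N. clow A h l \<le> M) \<and>
     (\<forall>h<N. \<forall>l<N. \<forall>v\<le>h. \<forall>j\<le>Suc h. (\<Sum>u<j. clow_open A h (clow A h) l u * A u v) \<le> M)"

text \<open>These cells are never written, so that they keep their initial value in all rounds.\<close>

definition zero_starts :: "state \<Rightarrow> bool" where
  "zero_starts s \<longleftrightarrow> (\<forall>h<N. \<forall>v<h. s ''G'' (ix n (ix n h 0) v) = 0)"

lemma wp_head_prog:
  assumes s: "sized s" "s ''h'' 0 = h" and h: "h < N" and small: "clow_small A"
    and A: "\<And>u v. u < N \<Longrightarrow> v < N \<Longrightarrow> s ''A'' (ix n u v) = A u v"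
    and z: "zero_starts s"
    and D: "\<And>l. l \<le> N \<Longrightarrow> s ''D'' (ix n h l) = clow A h l" "s ''D'' (ix n (Suc h) 0) = 1"
    and post: "\<And>s'. framed head_prog s r s' r \<Longrightarrow> zero_starts s' \<Longrightarrow>
      (\<And>l. l \<le> N \<Longrightarrow> s' ''D'' (ix n (Suc h) l) = clow A (Suc h) l) \<Longrightarrow>
      (\<And>h' l. h' \<noteq> Suc h \<Longrightarrow> l \<le> N \<Longrightarrow> s' ''D'' (ix n h' l) = s ''D'' (ix n h' l)) \<Longrightarrow> Q s' r"
  shows "wp M (N * (N * (N * 3 + 6) + 6) + 2) head_prog Q s r"
proof -
  let ?g = "clow_open A h (clow A h)"
  \<comment> \<open>Row \<open>j\<close> of \<open>G\<close> is claimed only for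
    \<open>v < h\<close>, as its entry at \<open>h\<close> is set at the start of the iteration. The
    other rows of \<open>D\<close> are tracked so that the outer loop keeps its earlier
    results.\<close>
  let ?I = "\<lambda>j s' r'. (\<forall>l\<le>j. s' ''D'' (ix n (Suc h) l) = clow A (Suc h) l) \<and>
    (\<forall>v<h. s' ''G'' (ix n (ix n h j) v) = ?g j v) \<and> zero_starts s' \<and>
    (\<forall>h' l. h' \<noteq> Suc h \<longrightarrow> l \<le> N \<longrightarrow> s' ''D'' (ix n h' l) = s ''D'' (ix n h' l))"
  show ?thesis
    unfolding head_prog_def
  proof (rule wp_For[where I = ?I and J = N and m = "1 + ((N * (N * 3 + 6) + 2) + 1)"], goal_cases)
    case (7 j s' r')
    note st = 7
    have fr: "s' ''h'' 0 = h" "s' ''A'' = s ''A''" "sized s'" "s' ''n'' 0 = n"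
      using st(4) s by (auto simp: framed_def sized_def writes_step_prog)
    have Dh: "s' ''D'' (ix n h l) = clow A h l" if "l \<le> N" for l
      using that st(2) D(1)[OF that] by simp
    have M': "clow A h l \<le> M" "clow A (Suc h) l \<le> M" if "l \<le> N" for l
      using small that h by (auto simp: clow_small_def simp del: clow.simps)
    let ?s = "s'(''G'' := (s' ''G'')(ix n (ix n h j) (h) := clow A h j))"
    have g: "?s ''G'' (ix n (ix n h j) u) = ?g j u" if "u \<le> h" for u
      using that st(2) N h by (cases "u = h") (auto simp: clow_open_head ix_eq_iff simp del: clow.simps)
    have z': "?s ''G'' (ix n (ix n h' 0) v) = 0" if "v < h'" "h' < N" for h' v
    proof -
      have "ix n (ix n h' 0) v \<noteq> ix n (ix n h j) (h)"
        using that N h st(1) by (auto simp: ix_eq_iff)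
      then show ?thesis using st(2) that by (simp add: zero_starts_def)
    qed
    show ?case
    proof (intro wp_Seq wp_Put, goal_cases)
      case 4
      have s_eq: "s'(''G'' := (s' ''G'')
           (val (index_exp (index_exp (Var ''h'') (Var ''l'')) (Var ''h'')) s' :=
              val (Get ''D'' (index_exp (Var ''h'') (Var ''l''))) s')) = ?s"
        using fr st(1,3) Dh by simp
      show ?case
        unfolding s_eq
      proof (rule wp_step_prog[where h = h and l = j and g = "?g j" and A = A], goal_cases)
        case (9 s'')
        have fr'': "s'' ''h'' 0 = h" "s'' ''l'' 0 = j" "s'' ''D'' = s' ''D''" "s'' ''n'' 0 = n"
          using 9(1) fr st(3) by (auto simp: framed_def writes_step_prog sized_def)
        have new: "clow A (Suc h) (Suc j) = s'' ''D'' (ix n h (Suc j)) + s'' ''a'' 0"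
          using Dh[of "Suc j"] st(1) 9(2) by (simp add: fr'' lessThan_Suc_atMost del: sum.lessThan_Suc)
        have G'': "s'' ''G'' (ix n (ix n h (Suc j)) v) = ?g (Suc j) v" if "v < h" for v
          using 9(3)[of v] that by (simp add: lessThan_Suc_atMost)
        have z'': "zero_starts s''"
          using 9(4) z' by (simp add: zero_starts_def)
        let ?S = "s''(''D'' := (s'' ''D'')(ix n (Suc h) (Suc j) := clow A (Suc h) (Suc j)))"
        have "?I (Suc j) (?S(''l'' := f)) r'" for f
          using G'' z'' st(1,2) N h
          by (auto simp: fr'' zero_starts_def ix_eq_iff le_Suc_eq simp del: clow.simps clow_open.simps)
        note I = this
        have e: "val (Plus (Get ''D'' (index_exp (Var ''h'') (Plus (Var ''l'') (Const 1)))) (Var ''a'')) s'' = clow A (Suc h) (Suc j)"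
          unfolding new by (simp add: fr'')
        have e2: "val (index_exp (Plus (Var ''h'') (Const 1)) (Plus (Var ''l'') (Const 1))) s'' = ix n (Suc h) (Suc j)"
          by (simp add: fr'')
        show ?case
        proof (rule wp_Put, unfold e e2, goal_cases)
          case 1
          show ?case using M'(2)[of "Suc j"] st(1) by simp
        next
          case 4
          show ?case by (rule I)
        qed (use M in \<open>auto simp: len_numerals\<close>)
      qed (use fr st(1,3) h g A small in \<open>auto simp: sized_def clow_small_def simp del: sum.lessThan_Suc clow.simps\<close>)
    qed (use M M'(1)[of j] Dh[of j] fr st(1,3) in \<open>auto simp: len_numerals\<close>)
  next
    case (8 s' r')
    then have "r' = r" by (simp add: framed_def writes_step_prog)
    then show ?case using 8 unfolding \<open>r' = r\<close>
      by (intro post[unfolded head_prog_def]) (auto simp del: clow.simps)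
  next
    case 9
    show ?case by (simp add: algebra_simps)
  qed (use s M N h z D in \<open>auto simp: sized_def len_numerals writes_step_prog zero_starts_def clow_0 simp del: clow.simps\<close>)
qed

text \<open>The conditions on \<open>G\<close> and on row 0 of \<open>D\<close> reappear in the
  postcondition, so the next mask can reuse the tables without clearing them.\<close>

lemma wp_clow_prog:
  assumes s: "sized s" and small: "clow_small A"
    and A: "\<And>u v. u < N \<Longrightarrow> v < N \<Longrightarrow> s ''A'' (ix n u v) = A u v"
    and z: "zero_starts s"
    and D: "\<And>l. l \<le> N \<Longrightarrow> s ''D'' (ix n 0 l) = of_bool (l = 0)"
    and post: "\<And>s'. framed clow_prog s r s' r \<Longrightarrow> zero_starts s' \<Longrightarrow>
      (\<And>l. l \<le> N \<Longrightarrow> s' ''D'' (ix n 0 l) = of_bool (l = 0)) \<Longrightarrow> s' ''D'' (ix n N N) = clow A N N \<Longrightarrow> Q s' r"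
  shows "wp M (N * (N * (N * (N * 3 + 6) + 6) + 5) + 2) clow_prog Q s r"
proof -
  let ?I = "\<lambda>j s' r'. (\<forall>h\<le>j. \<forall>l\<le>N. s' ''D'' (ix n h l) = clow A h l) \<and> zero_starts s'"
  show ?thesis
    unfolding clow_prog_def
  proof (rule wp_For[where I = ?I and J = N and m = "1 + (N * (N * (N * 3 + 6) + 6) + 2)"], goal_cases)
    case (7 j s' r')
    note st = 7
    have fr: "s' ''h'' 0 = j" "s' ''A'' = s ''A''" "sized s'" "s' ''n'' 0 = n"
      using st(3,4) s by (auto simp: framed_def sized_def writes_head_prog)
    show ?case
    proof (intro wp_Seq wp_Put, goal_cases)
      case 4
      show ?case
      proof (rule wp_head_prog[of _ j A], goal_cases)
        case (7 l)
        then show ?case using st(2) N fr by (simp add: ix_eq_iff)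
      next
        case (9 s'')
        have "s'' ''D'' (ix n h l) = clow A h l" if "h \<le> Suc j" "l \<le> N" for h l
        proof (cases "h = Suc j")
          case True
          then show ?thesis using 9(3)[OF that(2)] by simp
        next
          case False
          then show ?thesis using 9(4)[OF False that(2)] st(2) that N fr by (simp add: ix_eq_iff)
        qed
        then show ?case using 9(2) by (simp add: zero_starts_def)
      qed (use fr st small A in \<open>auto simp: sized_def zero_starts_def\<close>)
    qed (use M in \<open>auto simp: len_numerals\<close>)
  next
    case (8 s' r')
    then have "r' = r" by (simp add: framed_def writes_head_prog)
    moreover have "s' ''D'' (ix n 0 l) = of_bool (l = 0)" if "l \<le> N" for l
      using 8(1) that by (elim conjE) (drule spec[of _ 0], simp)
    ultimately show ?case using 8 unfolding \<open>r' = r\<close>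
      by (intro post[unfolded clow_prog_def]) auto
  next
    case 9
    show ?case by (simp add: algebra_simps)
  qed (use s M N z D in \<open>auto simp: sized_def len_numerals writes_head_prog zero_starts_def\<close>)
qed

end


section \<open>The program\<close>

definition scan_prog :: com where
  "scan_prog = Seq (While (Get ''in'' (Var ''N'')) (Assign ''N'' (Plus (Var ''N'') (Const 1))))
     (Seq (While (Get ''in'' (Plus (Plus (Var ''N'') (Const 1)) (Var ''K''))) (Assign ''K'' (Plus (Var ''K'') (Const 1))))
       (Assign ''O'' (Plus (Plus (Var ''N'') (Var ''K'')) (Const 2))))"

text \<open>The number \<open>8 n^2\<close> serves twice: as the exponent of
  \<open>B = 2^(8 n^2)\<close> and as the number of base \<open>B\<close> digits inspected at the
  end.\<close>

definition length_square_exp :: exp where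
  "length_square_exp = Times (Times (Var ''n'') (Var ''n'')) (Const 8)"

text \<open>Besides \<open>B\<close> and the number \<open>P\<close> of masks, this sets the first
  entry of \<open>D\<close>, the empty clow sequence; the rest of row 0 is zero from the
  start.\<close>

definition powers_prog :: com where
  "powers_prog = Seq (Assign ''B'' (Const 1))
     (Seq (For ''i'' length_square_exp (Assign ''B'' (Times (Var ''B'') (Const 2))))
     (Seq (Assign ''P'' (Const 1))
     (Seq (For ''i'' (Var ''K'') (Assign ''P'' (Times (Var ''P'') (Const 2))))
       (Assign ''D'' (Const 1)))))"

text \<open>Coins are flipped even where the input bit is zero. Thus position \<open>p\<close>
  always receives the \<open>p\<close>-th block of \<open>n\<close> random bits, independently of
  the input.\<close>

definition random_cell_prog :: com where
  "random_cell_prog = For ''j'' (Var ''n'') (Seq (Flip ''c'')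
     (Put ''Y'' (Var ''p'') (Plus (Times (Get ''Y'' (Var ''p'')) (Var ''B'')) (Times (Var ''c'') (Get ''in'' (Var ''p''))))))"

definition random_prog :: com where
  "random_prog = For ''p'' (Var ''n'') random_cell_prog"

definition total_prog :: com where
  "total_prog = For ''m'' (Var ''P'') (Seq mask_prog (Seq clow_prog
     (Assign ''t'' (Plus (Var ''t'') (Get ''D'' (index_exp (Var ''N'') (Var ''N'')))))))"

text \<open>\<open>out\<close> counts the odd base \<open>B\<close> digits of \<open>t\<close>, so
  it is nonzero exactly if some inspected digit is odd.\<close>

definition digits_prog :: com where
  "digits_prog = For ''i'' length_square_exp (Seq
     (Assign ''out'' (Plus (Var ''out'') (Minus (Var ''t'') (Times (Div (Var ''t'') (Const 2)) (Const 2)))))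
     (Assign ''t'' (Div (Var ''t'') (Var ''B''))))"

definition pmhc_prog :: com where
  "pmhc_prog = Seq scan_prog (Seq powers_prog (Seq random_prog (Seq total_prog digits_prog)))"

lemma writes_random_cell_prog: "writes random_cell_prog = {''j'', ''c'', ''Y''}"
  by (auto simp: random_cell_prog_def)

lemma length_square_exp: "val length_square_exp s = s ''n'' 0 * s ''n'' 0 * 8"
  "degr length_square_exp = 11" "weight length_square_exp = 30"
  by (auto simp: length_square_exp_def len_numerals)

context layout
begin

section \<open>Correctness and step counts of the phases\<close>

lemma wp_scan_prog:
  assumes n: "N + k + 2 \<le> n"
    and s: "s ''N'' 0 = 0" "s ''K'' 0 = 0"
    and w: "\<And>i. i < N \<Longrightarrow> s ''in'' i = 1" "s ''in'' N = 0"
      "\<And>i. i < k \<Longrightarrow> s ''in'' (N + 1 + i) = 1" "s ''in'' (N + 1 + k) = 0"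
    and post: "\<And>s'. framed scan_prog s r s' r \<Longrightarrow> s' ''N'' 0 = N \<Longrightarrow> s' ''K'' 0 = k \<Longrightarrow>
      s' ''O'' 0 = N + k + 2 \<Longrightarrow> Q s' r"
  shows "wp M (2 * N + 2 * k + 3) scan_prog Q s r"
proof -
  have "wp M ((N * (1 + 1) + 1) + ((k * (1 + 1) + 1) + 1)) scan_prog
      (\<lambda>s' r'. s' ''N'' 0 = N \<and> s' ''K'' 0 = k \<and> s' ''O'' 0 = N + k + 2) s r"
    unfolding scan_prog_def
  proof (intro wp_Seq, rule wp_While[where I = "\<lambda>j s' r'. (\<forall>x. x \<noteq> ''N'' \<longrightarrow> s' x = s x) \<and> s' ''N'' 0 = j"], goal_cases)
    case (4 j s' r')
    have i: "s' ''in'' = s ''in''" using 4(2) by simp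
    show ?case using 4 M N w(1)[of j] by (intro conjI wp_Put) (auto simp: len_numerals i)
  next
    case (5 s1 r1)
    have s1: "s1 ''in'' = s ''in''" "s1 ''K'' = s ''K''" using 5 by simp_all
    have "wp M ((k * (1 + 1) + 1) + 1) (Seq (While (Get ''in'' (Plus (Plus (Var ''N'') (Const 1)) (Var ''K''))) (Assign ''K'' (Plus (Var ''K'') (Const 1))))
       (Assign ''O'' (Plus (Plus (Var ''N'') (Var ''K'')) (Const 2)))) (\<lambda>s' r'. s' ''N'' 0 = N \<and> s' ''K'' 0 = k \<and> s' ''O'' 0 = N + k + 2) s1 r1"
    proof (intro wp_Seq, rule wp_While[where I = "\<lambda>j s' r'. (\<forall>x. x \<noteq> ''K'' \<longrightarrow> s' x = s1 x) \<and> s' ''K'' 0 = j"], goal_cases)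
      case (4 j s' r')
      have i: "s' ''in'' = s ''in''" "s' ''N'' = s1 ''N''" using 4(2) s1 by simp_all
      show ?case using 4 5 M k w(3)[of j] by (intro conjI wp_Put) (auto simp: len_numerals i)
    next
      case (5 s2 r2)
      have i: "s2 ''in'' = s ''in''" "s2 ''N'' = s1 ''N''" using 5 s1 by simp_all
      show ?case using 5 \<open>_ \<and> s1 ''N'' 0 = N\<close> M n w(4) by (intro conjI wp_Put) (auto simp: len_numerals i)
    qed (use s s1 M in \<open>auto simp: len_numerals\<close>)
    then show ?case using 5 s1 w(2) by simp
  qed (use s M in \<open>auto simp: len_numerals\<close>)
  then show ?thesis
  proof (rule wp_mono)
    fix s' r' assume fr: "framed scan_prog s r s' r'" and *: "s' ''N'' 0 = N \<and> s' ''K'' 0 = k \<and> s' ''O'' 0 = N + k + 2"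
    then have "r' = r" by (simp add: framed_def scan_prog_def)
    then show "Q s' r'" using fr * by (simp add: post)
  qed simp
qed

lemma wp_powers_prog:
  assumes s: "sized s" and le: "2 ^ (n * n * 8) \<le> M"
    and post: "\<And>s'. framed powers_prog s r s' r \<Longrightarrow> s' ''B'' 0 = 2 ^ (n * n * 8) \<Longrightarrow> s' ''P'' 0 = 2 ^ k \<Longrightarrow>
      s' ''D'' = (s ''D'')(0 := 1) \<Longrightarrow> Q s' r"
  shows "wp M (24 * (n * n) + 3 * k + 7) powers_prog Q s r"
proof -
  have nM: "n * n * 8 \<le> M" using le less_exp[of "n * n * 8"] by linarith
  have B: "2 ^ j \<le> M" if "j \<le> n * n * 8" for j
    using power_increasing[OF that, of "2::nat"] le by linarith
  have kn: "k \<le> n * n * 8" using k by (cases n) auto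
  have "wp M (1 + ((24 * (n * n) + 2) + (1 + ((3 * k + 2) + 1)))) powers_prog
      (\<lambda>s' r'. s' ''B'' 0 = 2 ^ (n * n * 8) \<and> s' ''P'' 0 = 2 ^ k \<and> s' ''D'' = (s ''D'')(0 := 1)) s r"
    unfolding powers_prog_def
  proof (intro wp_Seq wp_Put, goal_cases)
    case 4
    show ?case
    proof (rule wp_For[where I = "\<lambda>j s' r'. s' ''B'' 0 = 2 ^ j" and J = "n * n * 8" and m = 1], goal_cases)
      case (7 j s' r')
      then show ?case using B[of "Suc j"] M by (intro wp_Put) (auto simp: len_numerals)
    next
      case (8 s1 r1)
      have s1: "s1 ''K'' 0 = k" "s1 ''D'' = s ''D''" using 8(3) s by (auto simp: framed_def sized_def)
      show ?case
      proof (intro wp_Seq wp_Put, goal_cases)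
        case 4
        show ?case
        proof (rule wp_For[where I = "\<lambda>j s' r'. s' ''P'' 0 = 2 ^ j" and J = k and m = 1], goal_cases)
          case (7 j s' r')
          then show ?case using B[of "Suc j"] M kn by (intro wp_Put) (auto simp: len_numerals)
        next
          case (8 s2 r2)
          have s2: "s2 ''B'' = s1 ''B''" "s2 ''D'' = s ''D''" using 8(3) s1 by (auto simp: framed_def)
          show ?case using 8(1) \<open>s1 ''B'' 0 = _\<close> M by (intro wp_Put) (auto simp: len_numerals s2)
        qed (use s1 M k in \<open>auto simp: len_numerals\<close>)
      qed (use M in \<open>auto simp: len_numerals\<close>)
    qed (use s M nM in \<open>auto simp: sized_def len_numerals length_square_exp\<close>)
  qed (use M in \<open>auto simp: len_numerals\<close>)
  then show ?thesis
  proof (rule wp_mono)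
    fix s' r' assume fr: "framed powers_prog s r s' r'"
      and *: "s' ''B'' 0 = 2 ^ (n * n * 8) \<and> s' ''P'' 0 = 2 ^ k \<and> s' ''D'' = (s ''D'')(0 := 1)"
    then have "r' = r" by (simp add: framed_def powers_prog_def)
    then show "Q s' r'" using fr * by (simp add: post)
  qed simp
qed

lemma wp_random_cell_prog:
  assumes s: "sized s" "s ''p'' 0 = p" "s ''B'' 0 = B" "s ''Y'' p = 0" "s ''in'' p = of_bool b"
    and B: "2 \<le> B" "B ^ n \<le> M" and r: "n \<le> length r"
    and post: "\<And>s'. framed random_cell_prog s r s' (drop n r) \<Longrightarrow>
      s' ''Y'' = (s ''Y'')(p := of_bool b * poly (bits_poly (take n r)) B) \<Longrightarrow> Q s' (drop n r)"
  shows "wp M (4 * n + 2) random_cell_prog Q s r"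
  unfolding random_cell_prog_def
proof (rule wp_For[where J = n and m = "1 + 1" and
    I = "\<lambda>j s' r'. r' = drop j r \<and> s' ''Y'' = (s ''Y'')(p := of_bool b * poly (bits_poly (take j r)) B)"], goal_cases)
  case (7 j s' r')
  have fr: "s' ''p'' 0 = p" "s' ''B'' 0 = B" "s' ''in'' p = of_bool b"
    using 7(4) s by (auto simp: framed_def)
  have j: "j < length r" using 7(1) r by simp
  have d: "drop j r = r ! j # drop (Suc j) r" using j by (simp add: Cons_nth_drop_Suc)
  have t: "take (Suc j) r = take j r @ [r ! j]" using j by (simp add: take_Suc_conv_app_nth)
  have "poly (bits_poly (take (Suc j) r)) B < B ^ Suc j"
    using poly_bits_poly_less[OF B(1), of "take (Suc j) r"] j by simp
  also have "\<dots> \<le> B ^ n" using 7(1) B(1) by (intro power_increasing) auto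
  finally have le: "poly (bits_poly (take (Suc j) r)) B \<le> M" using B(2) by linarith
  show ?case
    using 7(2) le M
    by (intro wp_Seq wp_Flip[where r' = "drop (Suc j) r" and b = "r ! j"] wp_Put)
      (auto simp: fr d t len_numerals poly_bits_poly_snoc poly_bits_poly_Nil of_bool_def)
next
  case (8 s' r')
  then have r': "r' = drop n r" by simp
  show ?case unfolding r' by (rule post[unfolded random_cell_prog_def]) (use 8 r' in simp_all)
qed (use s M B r in \<open>auto simp: sized_def len_numerals poly_bits_poly_Nil\<close>)

lemma wp_random_prog:
  assumes s: "sized s" "s ''B'' 0 = B" "\<And>p. s ''Y'' p = 0" "\<And>p. s ''in'' p = of_bool (w p)" "\<And>p. n \<le> p \<Longrightarrow> \<not> w p"
    and B: "2 \<le> B" "B ^ n \<le> M" and r: "n * n \<le> length r"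
    and post: "\<And>s' r'. framed random_prog s r s' r' \<Longrightarrow>
      (\<And>p. s' ''Y'' p = of_bool (w p) * poly (bits_poly (chunk n p r)) B) \<Longrightarrow> Q s' r'"
  shows "wp M (n * (4 * n + 4) + 2) random_prog Q s r"
  unfolding random_prog_def
proof (rule wp_For[where J = n and m = "4 * n + 2" and
    I = "\<lambda>j s' r'. r' = drop (j * n) r \<and>
      (\<forall>p<j. s' ''Y'' p = of_bool (w p) * poly (bits_poly (chunk n p r)) B) \<and> (\<forall>p\<ge>j. s' ''Y'' p = 0)"], goal_cases)
  case (7 j s' r')
  have fr: "s' ''p'' 0 = j" "s' ''B'' 0 = B" "sized s'" "s' ''in'' = s ''in''"
    using 7(3,4) s by (auto simp: framed_def sized_def writes_random_cell_prog)
  have "Suc j * n \<le> n * n" using 7(1) by (intro mult_le_mono1) simp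
  then have r': "n \<le> length r'" using 7(2) r by simp
  show ?case
    using 7(1,2) s B r' fr
    by (intro wp_random_cell_prog[where p = j and B = B and b = "w j"])
      (auto simp: less_Suc_eq chunk_def add.commute)
next
  case (8 s' r')
  have "s' ''Y'' p = of_bool (w p) * poly (bits_poly (chunk n p r)) B" for p
    using 8(1) s(5)[of p] by (cases "p < n") auto
  then show ?case using 8 by (intro post[unfolded random_prog_def]) auto
next
  case 9
  show ?case by (simp add: algebra_simps)
qed (use s M B r in \<open>auto simp: sized_def len_numerals writes_random_cell_prog\<close>)

lemma wp_total_prog:
  assumes s: "sized s" "s ''P'' 0 = 2 ^ k" "2 ^ k \<le> M" "s ''t'' 0 = 0"
    and z: "zero_starts s" and D: "\<And>l. l \<le> N \<Longrightarrow> s ''D'' (ix n 0 l) = of_bool (l = 0)"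
    and A: "\<And>x. x < N \<Longrightarrow> s ''A'' (ix n x x) = 0"
    and w: "\<And>m u v. u < N \<Longrightarrow> v < N \<Longrightarrow> mask_weight k (cell s) m u v \<le> M"
    and small: "\<And>m. clow_small (mask_matrix k (cell s) m)"
    and le: "\<And>j. j \<le> 2 ^ k \<Longrightarrow> (\<Sum>m<j. clow (mask_matrix k (cell s) m) N N) \<le> M"
    and post: "\<And>s'. framed total_prog s r s' r \<Longrightarrow> s' ''t'' 0 = clow_total k N (cell s) \<Longrightarrow> Q s' r"
  shows "wp M (2 ^ k * ((N * (N * (4 * k + 8) + 4) + 2) + (N * (N * (N * (N * 3 + 6) + 6) + 5) + 2) + 3) + 2) total_prog Q s r"
proof -
  let ?I = "\<lambda>j s' r'. s' ''t'' 0 = (\<Sum>m<j. clow (mask_matrix k (cell s) m) N N) \<and> zero_starts s' \<and>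
    (\<forall>l\<le>N. s' ''D'' (ix n 0 l) = of_bool (l = 0)) \<and> (\<forall>x<N. s' ''A'' (ix n x x) = 0)"
  show ?thesis
    unfolding total_prog_def
  proof (rule wp_For[where J = "2 ^ k" and I = ?I and
      m = "(N * (N * (4 * k + 8) + 4) + 2) + ((N * (N * (N * (N * 3 + 6) + 6) + 5) + 2) + 1)"], goal_cases)
    case (7 j s' r')
    note st = 7
    have fr: "s' ''m'' 0 = j" "sized s'"
      using st(3,4) s by (auto simp: framed_def sized_def writes_mask_prog writes_clow_prog)
    have c: "cell s' = cell s"
      using st(4) by (intro cell_cong) (auto simp: framed_def writes_mask_prog writes_clow_prog)
    let ?W = "mask_matrix k (cell s) j"
    show ?case
    proof (intro wp_Seq, rule wp_mask_prog, goal_cases)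
      case (4 s1)
      have fr1: "sized s1" "s1 ''m'' 0 = j" "s1 ''t'' 0 = s' ''t'' 0" "zero_starts s1" "s1 ''D'' = s' ''D''"
        using 4(1) fr st(2) by (auto simp: framed_def sized_def zero_starts_def writes_mask_prog)
      show ?case
      proof (rule wp_Seq, rule wp_clow_prog[where A = ?W], goal_cases)
        case (6 s2)
        have fr2: "s2 ''n'' 0 = n" "s2 ''N'' 0 = N" "s2 ''t'' 0 = s' ''t'' 0" "s2 ''A'' = s1 ''A''"
          using 6(1) fr1 by (auto simp: framed_def sized_def writes_clow_prog)
        show ?case
          using 6(2-4) 4(2) le[of "Suc j"] st(1,2) M
          by (intro wp_Put) (auto simp: fr2 fr c len_numerals zero_starts_def mask_matrix_def)
      qed (use fr1 fr st(2) 4(2) small c in auto)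
    qed (use fr st(2) w c in auto)
  next
    case (8 s' r')
    then have "r' = r" by (simp add: framed_def writes_mask_prog writes_clow_prog)
    show ?case using 8 unfolding \<open>r' = r\<close> by (intro post[unfolded total_prog_def]) (auto simp: clow_total_def)
  next
    case 9
    show ?case by (simp add: algebra_simps)
  qed (use s M z D A in \<open>auto simp: sized_def zero_starts_def len_numerals writes_mask_prog writes_clow_prog\<close>)
qed

lemma wp_digits_prog:
  assumes s: "sized s" "s ''B'' 0 = B" "s ''out'' 0 = 0" and nM: "n * n * 8 \<le> M"
    and post: "\<And>s'. framed digits_prog s r s' r \<Longrightarrow>
      s' ''out'' 0 = (\<Sum>i<n * n * 8. s ''t'' 0 div B ^ i mod 2) \<Longrightarrow> Q s' r"
  shows "wp M (n * n * 32 + 2) digits_prog Q s r"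
proof (rule wpI_bounded)
  assume b: "bounded_state M s"
  let ?t = "\<lambda>i. s ''t'' 0 div B ^ i"
  show ?thesis
    unfolding digits_prog_def
  proof (rule wp_For[where J = "n * n * 8" and m = "1 + 1" and
      I = "\<lambda>j s' r'. s' ''t'' 0 = ?t j \<and> s' ''out'' 0 = (\<Sum>i<j. ?t i mod 2)"], goal_cases)
    case (7 j s' r')
    have fr: "s' ''B'' 0 = B" using 7(4) s by (auto simp: framed_def)
    have "(\<Sum>i<Suc j. ?t i mod 2) \<le> (\<Sum>i<Suc j. 1)" by (intro sum_mono) (simp add: less_Suc_eq_le[symmetric])
    then have o: "(\<Sum>i<Suc j. ?t i mod 2) \<le> M" using 7(1) nM by simp
    have d: "?t j div B = ?t (Suc j)" by (simp only: power_Suc2 div_mult2_eq)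
    have "s ''t'' 0 \<le> M" using b by (simp add: bounded_state_def)
    then have t: "?t (Suc j) \<le> M" by (meson div_le_dividend order_trans)
    have mod: "x - x div 2 * 2 = x mod 2" for x :: nat by (rule minus_div_mult_eq_mod)
    show ?case
      using 7(2) M o t
      by (intro wp_Seq wp_Put) (simp_all add: fr d mod len_numerals del: power_Suc)
  next
    case (8 s' r')
    then have "r' = r" by (simp add: framed_def)
    show ?case using 8 unfolding \<open>r' = r\<close> by (intro post[unfolded digits_prog_def]) auto
  qed (use s M nM in \<open>auto simp: sized_def len_numerals length_square_exp\<close>)
qed

end


section \<open>Coloured matchings and hitting constraints\<close>

lemma matchings_outside: "p \<in> matchings N \<Longrightarrow> \<not> i < N \<Longrightarrow> p i = i"
  by (auto simp: matchings_def permutes_def)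

lemma matchings_involution: "p \<in> matchings N \<Longrightarrow> i < N \<Longrightarrow> p (p i) = i \<and> p i \<noteq> i \<and> p i < N"
  using matchings_lt by (auto simp: matchings_def)

lemma openers_cases:
  assumes "p \<in> matchings N" "i < N"
  obtains "i \<in> openers N p" | "p i \<in> openers N p"
  using matchings_involution[OF assms] assms(2) by (cases "i < p i") (auto simp: openers_def)

lemma matchings_edge_eq:
  assumes "p \<in> matchings N" "i \<in> openers N p" "j \<in> openers N p" "{i, p i} = {j, p j}"
  shows "i = j"
  using assms by (auto simp: openers_def doubleton_eq_iff)

lemma matchingsI:
  assumes "\<And>i. i < N \<Longrightarrow> p i < N \<and> p (p i) = i \<and> p i \<noteq> i" "\<And>i. \<not> i < N \<Longrightarrow> p i = i"
  shows "p \<in> matchings N"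
proof -
  have pp: "p (p i) = i" for i using assms by (cases "i < N") auto
  have "p permutes {..<N}"
    unfolding permutes_def
  proof (intro conjI allI impI)
    fix y show "\<exists>!x. p x = y" using pp by metis
  qed (use assms in auto)
  then show ?thesis using assms by (auto simp: matchings_def)
qed

text \<open>A perfect matching becomes the partner function \<open>p\<close>. The chosen edge
  \<open>e j\<close> gets colour \<open>j + 1\<close> and every other matching edge colour
  0.\<close>

lemma pmhc_imp_colouring:
  assumes inst: "pmhc_instance {..<N} E Es" and pm: "pmhc {..<N} E Es"
  shows "\<exists>p\<in>matchings N. \<exists>\<phi>\<in>colourings (length Es) N p. \<forall>i\<in>openers N p. {i, p i} \<in> (E # Es) ! \<phi> i"
proof -
  obtain M e where M: "perfect_matching {..<N} E M"
    and e: "\<And>j. j < length Es \<Longrightarrow> e j \<in> M \<and> e j \<in> Es ! j" and inj: "inj_on e {..<length Es}"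
    using pm by (auto simp: pmhc_def)
  have ME: "M \<subseteq> E" and unique: "\<And>v. v < N \<Longrightarrow> \<exists>!f. f \<in> M \<and> v \<in> f"
    using M by (auto simp: perfect_matching_def)
  have edge: "f \<subseteq> {..<N} \<and> card f = 2" if "f \<in> M" for f
    using that ME inst by (auto simp: pmhc_instance_def simple_graph_def)
  have mate: "\<exists>!u. u \<noteq> v \<and> {v, u} \<in> M" if v: "v < N" for v
  proof -
    obtain f where f: "f \<in> M" "v \<in> f" "\<And>f'. f' \<in> M \<Longrightarrow> v \<in> f' \<Longrightarrow> f' = f"
      using unique[OF v] by blast
    obtain a b where ab: "f = {a, b}" "a \<noteq> b" using edge[OF f(1)] by (auto simp: card_2_iff)
    define u where "u = (if v = a then b else a)"
    have u: "f = {v, u}" "u \<noteq> v" using f(2) ab by (auto simp: u_def)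
    show ?thesis
    proof (rule ex1I)
      show "u \<noteq> v \<and> {v, u} \<in> M" using u f(1) by simp
      fix u' assume "u' \<noteq> v \<and> {v, u'} \<in> M"
      then have "{v, u'} = {v, u}" using f(3)[of "{v, u'}"] u by simp
      then show "u' = u" by (auto simp: doubleton_eq_iff)
    qed
  qed
  define p where "p v = (if v < N then THE u. u \<noteq> v \<and> {v, u} \<in> M else v)" for v
  have p: "p v \<noteq> v \<and> {v, p v} \<in> M" if "v < N" for v
    using theI'[OF mate[OF that]] that by (simp add: p_def)
  have p_eq: "p v = u" if "v < N" "u \<noteq> v" "{v, u} \<in> M" for u v
    using mate[OF that(1)] p[OF that(1)] that by blast
  have p_lt: "p v < N" if "v < N" for v using edge[of "{v, p v}"] p[OF that] by simp
  have pm: "p \<in> matchings N"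
  proof (rule matchingsI)
    fix i assume i: "i < N"
    have "p (p i) = i" using p[OF i] by (intro p_eq p_lt i) (auto simp: insert_commute)
    then show "p i < N \<and> p (p i) = i \<and> p i \<noteq> i" using p[OF i] p_lt[OF i] by simp
  qed (simp add: p_def)
  let ?O = "openers N p" and ?k = "length Es"
  \<comment> \<open>The description is unambiguous because the chosen edges are distinct.\<close>
  define \<phi> where "\<phi> = (\<lambda>i\<in>?O. if \<exists>j<?k. e j = {i, p i} then Suc (THE j. j < ?k \<and> e j = {i, p i}) else 0)"
  have \<phi>_Suc: "\<phi> i = Suc j" if "i \<in> ?O" "j < ?k" "e j = {i, p i}" for i j
  proof -
    have "(THE j. j < ?k \<and> e j = {i, p i}) = j"
    proof (rule the_equality)
      fix j' assume "j' < ?k \<and> e j' = {i, p i}"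
      then show "j' = j" using inj that inj_onD[OF inj, of j' j] by auto
    qed (use that in simp)
    then show ?thesis using that by (auto simp: \<phi>_def)
  qed
  have cases: "(\<phi> i = 0) \<or> (\<exists>j<?k. e j = {i, p i} \<and> \<phi> i = Suc j)" if "i \<in> ?O" for i
  proof (cases "\<exists>j<?k. e j = {i, p i}")
    case True
    then show ?thesis using \<phi>_Suc[OF that] by blast
  qed (use that in \<open>auto simp: \<phi>_def\<close>)
  have "\<phi> \<in> colourings ?k N p"
    unfolding colourings_def
  proof (intro CollectI conjI subsetI)
    show "\<phi> \<in> ?O \<rightarrow>\<^sub>E {..?k}"
    proof (rule PiE_I)
      fix i assume "i \<in> ?O"
      then show "\<phi> i \<in> {..?k}" using cases[of i] by auto
    qed (simp add: \<phi>_def)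
    fix c assume "c \<in> {1..?k}"
    then obtain j where j: "c = Suc j" "j < ?k" by (cases c) auto
    have ej: "e j \<in> M" using e j by simp
    then obtain a b where ab: "e j = {a, b}" "a < b"
      using edge[of "e j"] by (metis card_2_iff insert_commute linorder_neqE_nat)
    have aN: "a < N" using edge[OF ej] ab by simp
    have "p a = b" using ab ej aN by (intro p_eq) auto
    then have "a \<in> ?O" "e j = {a, p a}" using ab aN by (auto simp: openers_def)
    then show "c \<in> \<phi> ` ?O" using \<phi>_Suc[of a j] j by force
  qed
  moreover have "{i, p i} \<in> (E # Es) ! \<phi> i" if "i \<in> ?O" for i
    using cases[OF that]
  proof
    assume "\<phi> i = 0"
    then show ?thesis using p[of i] that ME by (auto simp: openers_def)
  next
    assume "\<exists>j<?k. e j = {i, p i} \<and> \<phi> i = Suc j"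
    then obtain j where "j < ?k" "e j = {i, p i}" "\<phi> i = Suc j" by blast
    then show ?thesis using e[of j] by simp
  qed
  ultimately show ?thesis using pm by blast
qed

text \<open>Every positive colour is in use, so an edge can be picked for each constraint; an edge
  has a single colour, so the picked edges are distinct. Coloured edges lie in \<open>E\<close>
  because the constraint sets do.\<close>

lemma colouring_imp_pmhc:
  assumes inst: "pmhc_instance {..<N} E Es" and p: "p \<in> matchings N"
    and \<phi>: "\<phi> \<in> colourings (length Es) N p" and E: "\<And>i. i \<in> openers N p \<Longrightarrow> {i, p i} \<in> (E # Es) ! \<phi> i"
  shows "pmhc {..<N} E Es"
proof -
  let ?O = "openers N p" and ?k = "length Es"
  define M where "M = (\<lambda>i. {i, p i}) ` ?O"
  have \<phi>_le: "\<phi> i \<le> ?k" if "i \<in> ?O" for i using \<phi> that by (auto simp: colourings_def)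
  have "M \<subseteq> E"
  proof
    fix f assume "f \<in> M"
    then obtain i where i: "i \<in> ?O" "f = {i, p i}" by (auto simp: M_def)
    show "f \<in> E"
    proof (cases "\<phi> i")
      case 0
      then show ?thesis using E[OF i(1)] i by simp
    next
      case (Suc j)
      then have "Es ! j \<in> set Es" using \<phi>_le[OF i(1)] by simp
      then show ?thesis using E[OF i(1)] i Suc inst by (auto simp: pmhc_instance_def)
    qed
  qed
  moreover have "\<exists>!f. f \<in> M \<and> v \<in> f" if v: "v < N" for v
  proof -
    have mem: "{v, p v} \<in> M"
      using p v
    proof (cases rule: openers_cases)
      case 1
      then show ?thesis by (simp add: M_def)
    next
      case 2
      then have "{p v, p (p v)} \<in> M" by (auto simp: M_def)
      then show ?thesis using matchings_involution[OF p v] by (simp add: insert_commute)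
    qed
    show ?thesis
    proof (rule ex1I)
      show "{v, p v} \<in> M \<and> v \<in> {v, p v}" using mem by simp
      fix f assume f: "f \<in> M \<and> v \<in> f"
      then obtain i where i: "i \<in> ?O" "f = {i, p i}" by (auto simp: M_def)
      then have "p (p i) = i" using matchings_involution[OF p, of i] by (simp add: openers_def)
      then show "f = {v, p v}" using f i by auto
    qed
  qed
  ultimately have "perfect_matching {..<N} E M" by (simp add: perfect_matching_def)
  moreover define s where "s j = (SOME i. i \<in> ?O \<and> \<phi> i = Suc j)" for j
  have s: "s j \<in> ?O \<and> \<phi> (s j) = Suc j" if "j < ?k" for j
  proof -
    have "Suc j \<in> \<phi> ` ?O" using \<phi> that by (auto simp: colourings_def)
    then have "\<exists>i. i \<in> ?O \<and> \<phi> i = Suc j" by force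
    then show ?thesis unfolding s_def by (rule someI_ex)
  qed
  have "\<forall>j<?k. {s j, p (s j)} \<in> M \<and> {s j, p (s j)} \<in> Es ! j"
    using s E by (fastforce simp: M_def)
  moreover have "inj_on (\<lambda>j. {s j, p (s j)}) {..<?k}"
  proof (rule inj_onI)
    fix i j assume ij: "i \<in> {..<?k}" "j \<in> {..<?k}" "{s i, p (s i)} = {s j, p (s j)}"
    then have "s i = s j" using s by (intro matchings_edge_eq[OF p]) auto
    then have "\<phi> (s i) = \<phi> (s j)" by (rule arg_cong)
    then show "i = j" using s[of i] s[of j] ij(1,2) by (simp only: lessThan_iff nat.inject)
  qed
  ultimately show ?thesis
    unfolding pmhc_def by (intro exI[of _ M] exI[of _ "\<lambda>j. {s j, p (s j)}"] conjI)
qed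

section \<open>Monomials of coloured matchings\<close>

definition position :: "nat \<Rightarrow> nat \<Rightarrow> nat \<Rightarrow> nat \<Rightarrow> nat \<Rightarrow> nat" where
  "position pos0 N c u v = pos0 + (c * (N * N) + (u * N + v))"

text \<open>The monomial of a coloured matching, as its set of variables; a variable is named by the
  position of its entry in the input.\<close>

definition cell_set :: "nat \<Rightarrow> nat \<Rightarrow> (nat \<Rightarrow> nat) \<times> (nat \<Rightarrow> nat) \<Rightarrow> nat set" where
  "cell_set pos0 N = (\<lambda>(p, \<phi>). (\<lambda>i. position pos0 N (\<phi> i) i (p i)) ` openers N p)"

definition coloured_matchings :: "nat \<Rightarrow> nat \<Rightarrow> ((nat \<Rightarrow> nat) \<times> (nat \<Rightarrow> nat)) set" where
  "coloured_matchings k N = Sigma (matchings N) (colourings k N)"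

lemma index_less_square:
  fixes u v N :: nat
  assumes "u < N" "v < N"
  shows "u * N + v < N * N"
proof -
  have "u * N + v < Suc u * N" using assms by simp
  also have "\<dots> \<le> N * N" using assms by (intro mult_le_mono1) simp
  finally show ?thesis .
qed

lemma position_eq_iff:
  assumes "u < N" "v < N" "u' < N" "v' < N"
  shows "position pos0 N c u v = position pos0 N c' u' v' \<longleftrightarrow> c = c' \<and> u = u' \<and> v = v'"
proof -
  show ?thesis
    using ix_eq_iff[OF index_less_square[OF assms(1,2)] index_less_square[OF assms(3,4)], of c c'] ix_eq_iff[of v N v' u u'] assms
    by (auto simp: position_def ix_def)
qed

text \<open>No two coloured matchings can cancel modulo two: a position reveals the colour, the
  opener and its partner. The remaining values of \<open>p\<close> follow since it is an involution,
  those of the colouring by extensionality.\<close>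

lemma inj_cell_set: "inj_on (cell_set pos0 N) (coloured_matchings k N)"
proof -
  have sub: "openers N p \<subseteq> openers N p' \<and> (\<forall>i\<in>openers N p. p i = p' i \<and> \<phi> i = \<phi>' i)"
    if pm: "p \<in> matchings N" "p' \<in> matchings N" and "cell_set pos0 N (p, \<phi>) \<subseteq> cell_set pos0 N (p', \<phi>')" for p p' \<phi> \<phi>'
  proof -
    have "i \<in> openers N p' \<and> p i = p' i \<and> \<phi> i = \<phi>' i" if i: "i \<in> openers N p" for i
    proof -
      obtain j where j: "j \<in> openers N p'" "position pos0 N (\<phi> i) i (p i) = position pos0 N (\<phi>' j) j (p' j)"
        using i \<open>cell_set pos0 N (p, \<phi>) \<subseteq> _\<close> by (auto simp: cell_set_def)
      have "i < N" "j < N" using i j by (auto simp: openers_def)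
      then have "\<phi> i = \<phi>' j \<and> i = j \<and> p i = p' j"
        using j(2) matchings_lt[OF pm(1)] matchings_lt[OF pm(2)] by (subst (asm) position_eq_iff) auto
      then show ?thesis using j(1) by auto
    qed
    then show ?thesis by blast
  qed
  show ?thesis
  proof (rule inj_onI)
    fix x x' assume x: "x \<in> coloured_matchings k N" "x' \<in> coloured_matchings k N" "cell_set pos0 N x = cell_set pos0 N x'"
    obtain p \<phi> p' \<phi>' where xs: "x = (p, \<phi>)" "x' = (p', \<phi>')" by (cases x; cases x') auto
    have pm: "p \<in> matchings N" "p' \<in> matchings N" and col: "\<phi> \<in> colourings k N p" "\<phi>' \<in> colourings k N p'"
      using x xs by (auto simp: coloured_matchings_def)
    have O: "openers N p = openers N p'" and eq: "\<And>i. i \<in> openers N p \<Longrightarrow> p i = p' i \<and> \<phi> i = \<phi>' i"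
      using sub[OF pm, of \<phi> \<phi>'] sub[OF pm(2,1), of \<phi>' \<phi>] x(3) xs by auto
    have "p i = p' i" for i
    proof (cases "i < N")
      case True
      with pm(1) show ?thesis
      proof (cases rule: openers_cases)
        case 1
        then show ?thesis using eq by simp
      next
        case 2
        then have "p' (p i) = i" using eq[of "p i"] matchings_involution[OF pm(1) True] by simp
        then show ?thesis
          using matchings_involution[OF pm(2), of "p i"] matchings_involution[OF pm(1) True] by auto
      qed
    next
      case False
      then show ?thesis using matchings_outside[OF pm(1)] matchings_outside[OF pm(2)] by simp
    qed
    moreover have "\<phi> i = \<phi>' i" for i
    proof (cases "i \<in> openers N p")
      case False
      have "\<phi> \<in> openers N p \<rightarrow>\<^sub>E {..k}" "\<phi>' \<in> openers N p \<rightarrow>\<^sub>E {..k}"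
        using col O by (auto simp only: colourings_def mem_Collect_eq)
      then show ?thesis using False by (metis PiE_arb)
    qed (use eq in blast)
    ultimately show "x = x'" unfolding xs by (simp add: fun_eq_iff)
  qed
qed

lemma finite_colourings: "finite (colourings k N p)"
  by (rule finite_subset[of _ "openers N p \<rightarrow>\<^sub>E {..k}"])
    (auto simp: colourings_def finite_openers intro!: finite_PiE)

lemma finite_coloured_matchings: "finite (coloured_matchings k N)"
  unfolding coloured_matchings_def by (intro finite_SigmaI finite_matchings finite_colourings)

text \<open>A monomial that uses an absent entry contains a zero factor. The others are distinct and
  squarefree, so their sum is a form of the shape required by the zero bound.\<close>

lemma sum_coloured_matchings:
  fixes g :: "nat \<Rightarrow> 'a::comm_semiring_1" and w :: "nat \<Rightarrow> bool" and N pos0 :: nat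
  defines "y \<equiv> \<lambda>c u v. of_bool (w (position pos0 N c u v)) * g (position pos0 N c u v)"
  shows "(\<Sum>p\<in>matchings N. \<Sum>\<phi>\<in>colourings k N p. \<Prod>i\<in>openers N p. y (\<phi> i) i (p i)) =
    multilinear g (cell_set pos0 N ` {x \<in> coloured_matchings k N. \<forall>q\<in>cell_set pos0 N x. w q})"
proof -
  let ?X = "{x \<in> coloured_matchings k N. \<forall>q\<in>cell_set pos0 N x. w q}"
  let ?y = "\<lambda>(p, \<phi>). \<Prod>i\<in>openers N p. y (\<phi> i) i (p i)"
  have prod: "?y x = (\<Prod>q\<in>cell_set pos0 N x. of_bool (w q) * g q)" if "x \<in> coloured_matchings k N" for x
  proof -
    obtain p \<phi> where x: "x = (p, \<phi>)" by (cases x)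
    then have p: "p \<in> matchings N" using that by (auto simp: coloured_matchings_def)
    have "inj_on (\<lambda>i. position pos0 N (\<phi> i) i (p i)) (openers N p)"
    proof (rule inj_onI)
      fix i j assume "i \<in> openers N p" "j \<in> openers N p" "position pos0 N (\<phi> i) i (p i) = position pos0 N (\<phi> j) j (p j)"
      then show "i = j"
        using matchings_lt[OF p] by (subst (asm) position_eq_iff) (auto simp: openers_def)
    qed
    then show ?thesis by (simp add: x cell_set_def prod.reindex y_def)
  qed
  have fin: "finite (cell_set pos0 N x)" for x
    by (cases x) (simp add: cell_set_def finite_openers)
  have "(\<Sum>p\<in>matchings N. \<Sum>\<phi>\<in>colourings k N p. \<Prod>i\<in>openers N p. y (\<phi> i) i (p i)) = sum ?y (coloured_matchings k N)"
    unfolding coloured_matchings_def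
    by (rule sum.Sigma) (auto simp: finite_matchings finite_colourings)
  also have "\<dots> = sum ?y ?X"
  proof (rule sum.mono_neutral_right)
    show "\<forall>x\<in>coloured_matchings k N - ?X. ?y x = 0"
    proof
      fix x assume x: "x \<in> coloured_matchings k N - ?X"
      then obtain q where "q \<in> cell_set pos0 N x" "\<not> w q" by auto
      then have "(\<Prod>q\<in>cell_set pos0 N x. of_bool (w q) * g q) = 0"
        using fin by (intro prod_zero) auto
      then show "?y x = 0" using prod[of x] x by simp
    qed
  qed (auto simp: finite_coloured_matchings)
  also have "\<dots> = (\<Sum>x\<in>?X. \<Prod>q\<in>cell_set pos0 N x. g q)"
    by (intro sum.cong) (auto simp: prod[unfolded split_def] split_def intro!: prod.cong)
  also have "\<dots> = multilinear g (cell_set pos0 N ` ?X)"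
    unfolding multilinear_def
    by (subst sum.reindex) (auto intro: inj_on_subset[OF inj_cell_set])
  finally show ?thesis .
qed


section \<open>Input encoding and correctness\<close>

lemma length_encode_edges: "length (encode_edges N F) = N * N"
proof -
  have "sum_list (map (\<lambda>_. N) xs) = length xs * N" for xs :: "nat list"
    by (induction xs) auto
  then show ?thesis by (simp add: encode_edges_def length_concat o_def)
qed

lemma nth_concat_uniform:
  "(\<And>xs. xs \<in> set xss \<Longrightarrow> length xs = m) \<Longrightarrow> i < length xss \<Longrightarrow> j < m \<Longrightarrow> concat xss ! (i * m + j) = xss ! i ! j"
proof (induction xss arbitrary: i)
  case (Cons xs xss)
  then show ?case by (cases i) (auto simp: nth_append)
qed simp

lemma nth_encode_edges: "u < N \<Longrightarrow> v < N \<Longrightarrow> encode_edges N F ! (u * N + v) \<longleftrightarrow> {u, v} \<in> F"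
  unfolding encode_edges_def by (subst nth_concat_uniform[where m = N]) auto

lemma encode_eq:
  "encode N E Es = replicate N True @ [False] @ replicate (length Es) True @ [False] @
     concat (map (encode_edges N) (E # Es))"
  by (simp add: encode_def)

lemma length_encode: "length (encode N E Es) = N + length Es + 2 + Suc (length Es) * (N * N)"
proof -
  have "length (concat (map (encode_edges N) xs)) = length xs * (N * N)" for xs
    by (induction xs) (auto simp: length_encode_edges)
  from this[of "E # Es"] show ?thesis by (simp add: encode_eq length_encode_edges)
qed

lemma nth_encode_header:
  "i < N \<Longrightarrow> encode N E Es ! i" "\<not> encode N E Es ! N"
  "i < length Es \<Longrightarrow> encode N E Es ! (N + 1 + i)" "\<not> encode N E Es ! (N + 1 + length Es)"
  by (auto simp: encode_def nth_append)

lemma nth_encode_position: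
  assumes "c \<le> length Es" "u < N" "v < N"
  shows "encode N E Es ! position (N + length Es + 2) N c u v \<longleftrightarrow> {u, v} \<in> (E # Es) ! c"
proof -
  have j: "u * N + v < N * N" using assms by (intro index_less_square)
  have "encode N E Es ! position (N + length Es + 2) N c u v =
      concat (map (encode_edges N) (E # Es)) ! (c * (N * N) + (u * N + v))"
    unfolding encode_eq position_def by (simp add: nth_append)
  also have "\<dots> = map (encode_edges N) (E # Es) ! c ! (u * N + v)"
    using j assms(1) by (intro nth_concat_uniform) (auto simp: length_encode_edges)
  also have "\<dots> = encode_edges N ((E # Es) ! c) ! (u * N + v)"
    using assms(1) by (subst nth_map) auto
  finally show ?thesis using nth_encode_edges assms by simp
qed

lemma position_less_encode:
  assumes "c \<le> length Es" "u < N" "v < N"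
  shows "position (N + length Es + 2) N c u v < length (encode N E Es)"
proof -
  have "c * (N * N) + (u * N + v) < Suc c * (N * N)" using index_less_square[OF assms(2,3)] by simp
  also have "\<dots> \<le> Suc (length Es) * (N * N)" using assms(1) by (intro mult_le_mono1) simp
  finally show ?thesis unfolding position_def length_encode by simp
qed

definition monomials :: "nat \<Rightarrow> nat \<Rightarrow> (nat \<Rightarrow> bool) \<Rightarrow> nat set set" where
  "monomials k N w = cell_set (N + k + 2) N `
     {x \<in> coloured_matchings k N. \<forall>q\<in>cell_set (N + k + 2) N x. w q}"

definition input_bit :: "bool list \<Rightarrow> nat \<Rightarrow> bool" where
  "input_bit w q \<longleftrightarrow> q < length w \<and> w ! q"

lemma monomials_nonempty_iff_pmhc:
  assumes "pmhc_instance {..<N} E Es"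
  shows "monomials (length Es) N (input_bit (encode N E Es)) \<noteq> {} \<longleftrightarrow> pmhc {..<N} E Es"
proof -
  have eq: "(\<forall>q\<in>cell_set (N + length Es + 2) N (p, \<phi>). input_bit (encode N E Es) q) \<longleftrightarrow>
      (\<forall>i\<in>openers N p. {i, p i} \<in> (E # Es) ! \<phi> i)"
    if "p \<in> matchings N" "\<phi> \<in> colourings (length Es) N p" for p \<phi>
  proof -
    have "input_bit (encode N E Es) (position (N + length Es + 2) N (\<phi> i) i (p i)) \<longleftrightarrow> {i, p i} \<in> (E # Es) ! \<phi> i"
      if i: "i \<in> openers N p" for i
    proof -
      have "\<phi> i \<le> length Es" using \<open>\<phi> \<in> _\<close> i by (auto simp: colourings_def)
      moreover have "i < N" "p i < N" using i matchings_lt[OF \<open>p \<in> _\<close>] by (auto simp: openers_def)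
      ultimately show ?thesis
        using nth_encode_position position_less_encode by (simp add: input_bit_def)
    qed
    then show ?thesis by (simp add: cell_set_def)
  qed
  have "monomials (length Es) N (input_bit (encode N E Es)) \<noteq> {} \<longleftrightarrow>
      (\<exists>p\<in>matchings N. \<exists>\<phi>\<in>colourings (length Es) N p.
        \<forall>q\<in>cell_set (N + length Es + 2) N (p, \<phi>). input_bit (encode N E Es) q)"
    unfolding monomials_def coloured_matchings_def by blast
  also have "\<dots> \<longleftrightarrow>
      (\<exists>p\<in>matchings N. \<exists>\<phi>\<in>colourings (length Es) N p. \<forall>i\<in>openers N p. {i, p i} \<in> (E # Es) ! \<phi> i)"
    using eq by (intro bex_cong refl)
  also have "\<dots> \<longleftrightarrow> pmhc {..<N} E Es"
    using pmhc_imp_colouring[OF assms] colouring_imp_pmhc[OF assms] by blast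
  finally show ?thesis .
qed

lemma monomials_subset: "monomials k N (input_bit w) \<subseteq> Pow {..<length w}"
  by (auto simp: monomials_def input_bit_def)

lemma monomials_0_subset: "monomials k 0 w \<subseteq> Pow {..<0}"
  by (auto simp: monomials_def cell_set_def openers_def)

text \<open>The coefficient type is left open so that the same weights exist over the natural
  numbers, where the machine computes, and over \<open>bit\<close>, where the zero test is
  analysed.\<close>

definition random_weight :: "nat \<Rightarrow> nat \<Rightarrow> nat \<Rightarrow> bool list \<Rightarrow> bool list \<Rightarrow> nat \<Rightarrow> nat \<Rightarrow> nat \<Rightarrow> 'a::comm_semiring_1 poly" where
  "random_weight n k N w r c u v = of_bool (input_bit w (position (N + k + 2) N c u v)) *
     bits_poly (chunk n (position (N + k + 2) N c u v) r)"

lemma clow_total_random_weight: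
  "(clow_total k N (random_weight n k N w r) :: bit poly) =
    (multilinear (\<lambda>q. bits_poly (chunk n q r)) (monomials k N (input_bit w)))\<^sup>2"
  unfolding clow_total_def sum_clow_masks[OF bit_poly_two] random_weight_def[abs_def] monomials_def
  by (subst sum_coloured_matchings) (rule refl)

lemma map_random_weight: "map_poly of_nat (random_weight n k N w r c u v) = random_weight n k N w r c u v"
  by (auto simp: random_weight_def map_bits_poly of_bool_def)

lemma length_chunk_le: "length (chunk m u r) \<le> m"
  by (simp add: chunk_def)

lemma poly_random_weight_1: "poly (random_weight n k N w r c u v) (1 :: nat) \<le> n"
  using poly_bits_poly_1[of "chunk n (position (N + k + 2) N c u v) r"]
    length_chunk_le[of n "position (N + k + 2) N c u v" r]
  by (auto simp: random_weight_def of_bool_def intro: order_trans)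

lemma poly_random_weight_le:
  assumes "2 \<le> B"
  shows "poly (random_weight n k N w r c u v) (B :: nat) \<le> B ^ n"
proof -
  have "poly (bits_poly (chunk n q r)) B \<le> B ^ n" for q
  proof -
    have "B ^ length (chunk n q r) \<le> B ^ n"
      using assms by (intro power_increasing length_chunk_le) auto
    then show ?thesis using poly_bits_poly_less[OF assms, of "chunk n q r"] by linarith
  qed
  then show ?thesis by (auto simp: random_weight_def of_bool_def)
qed

section \<open>Choice of the base and the parity test\<close>

context
  fixes n N k B :: nat
  assumes N: "N < n" and k: "k < n" and n: "2 \<le> n" and B: "B = 2 ^ (n * n * 8)"
begin

text \<open>At \<open>t = 1\<close> a weight is at most \<open>n\<close>, so \<open>n^3\<close>
  bounds \<open>N * Suc k * n\<close> and a coefficient of the total is at most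
  \<open>2^k * (n^3)^(2 N)\<close>. With \<open>n <= 2^n\<close> this is at most
  \<open>2^(k + 6 n^2)\<close>, which the exponent \<open>8 n^2\<close> exceeds.\<close>

lemma base_bounds: "2 \<le> B" "n * n * 8 < B" "even B" "2 ^ k \<le> B" "2 ^ k * (n ^ 3) ^ (N + N) < B"
proof -
  have n: "1 \<le> n * n" "k \<le> n * n" using N k by (cases n; simp)+
  show "2 \<le> B" using power_increasing[of 1 "n * n * 8" "2::nat"] n by (simp add: B)
  show "n * n * 8 < B" unfolding B by (rule less_exp)
  show "even B" using n by (auto simp: B)
  show "2 ^ k \<le> B" unfolding B using n by (intro power_increasing) auto
  have "n ^ 3 \<le> (2 ^ n) ^ 3" by (rule power_mono[OF less_imp_le[OF less_exp]]) simp
  then have "(n ^ 3) ^ (N + N) \<le> ((2 ^ n) ^ 3) ^ (N + N)" by (intro power_mono) auto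
  also have "\<dots> = 2 ^ (n * 3 * (N + N))" by (simp add: power_mult)
  finally have "2 ^ k * (n ^ 3) ^ (N + N) \<le> 2 ^ (k + n * 3 * (N + N))" by (simp add: power_add)
  also have "\<dots> < B"
  proof -
    have "n * 3 * (N + N) \<le> n * 3 * (n + n)" using N by (intro mult_le_mono2) simp
    also have "\<dots> = 6 * (n * n)" by simp
    finally have "k + n * 3 * (N + N) < n * n * 8" using n by linarith
    then show ?thesis unfolding B by (intro power_strict_increasing) auto
  qed
  finally show "2 ^ k * (n ^ 3) ^ (N + N) < B" .
qed

text \<open>Weights at \<open>B\<close> are at most \<open>B^n\<close>; a further factor
  \<open>B\<close> absorbs \<open>N * Suc k\<close>, and one more absorbs \<open>2^k\<close>. The
  resulting exponent \<open>1 + (n + 1) * 2 N\<close> is below \<open>3 n^2\<close> since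
  \<open>N < n\<close>.\<close>

lemma size_bounds:
  "N * (Suc k * B ^ n) \<le> B ^ Suc n" "2 \<le> B ^ Suc n" "2 ^ k * (B ^ Suc n) ^ (N + N) \<le> B ^ (n * n * 3)"
  "Suc k * B ^ n \<le> B ^ (n * n * 3)" "B \<le> B ^ (n * n * 3)"
proof -
  have B2: "2 \<le> B" and B1: "1 \<le> B" using base_bounds(1) by auto
  have "N * Suc k \<le> n * n" using N k by (intro mult_le_mono) auto
  then have NB: "N * Suc k \<le> B" using base_bounds(2) by linarith
  then have "N * Suc k * B ^ n \<le> B * B ^ n" by (rule mult_le_mono1)
  then show "N * (Suc k * B ^ n) \<le> B ^ Suc n" by (simp only: mult.assoc power_Suc)
  have "B ^ 1 \<le> B ^ Suc n" using B1 by (intro power_increasing) auto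
  then show "2 \<le> B ^ Suc n" using B2 unfolding power_one_right by linarith
  have n1: "1 \<le> n" using N by simp
  have "n \<le> n * n" "1 \<le> n * n" using n1 by auto
  then have e1: "Suc n \<le> n * n * 3" "1 \<le> n * n * 3" using n1 by linarith+
  show "B \<le> B ^ (n * n * 3)" using power_increasing[OF e1(2) B1] by simp
  have "n \<le> n * n * 8" using \<open>n \<le> n * n\<close> by linarith
  then have "Suc k \<le> B" using k base_bounds(2) by linarith
  then have "Suc k * B ^ n \<le> B ^ Suc n" unfolding power_Suc by (rule mult_le_mono1)
  also have "\<dots> \<le> B ^ (n * n * 3)" using e1 B1 by (intro power_increasing)
  finally show "Suc k * B ^ n \<le> B ^ (n * n * 3)" .
  have "2 ^ k * (B ^ Suc n) ^ (N + N) \<le> B * (B ^ Suc n) ^ (N + N)"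
    using base_bounds(4) by (rule mult_le_mono1)
  also have "\<dots> = B ^ (1 + Suc n * (N + N))" by (simp only: power_add power_mult power_one_right)
  also have "\<dots> \<le> B ^ (n * n * 3)"
  proof (rule power_increasing[OF _ B1])
    obtain d where d: "n = Suc N + d" using N by (metis add.commute less_imp_add_positive add_Suc Suc_pred add_Suc_right)
    show "1 + Suc n * (N + N) \<le> n * n * 3" unfolding d by (simp add: algebra_simps)
  qed
  finally show "2 ^ k * (B ^ Suc n) ^ (N + N) \<le> B ^ (n * n * 3)" .
qed

text \<open>Odd digits are the nonzero coefficients of the total modulo two. That reduction is the
  square of the form, and a square in a domain is zero only if its root is.\<close>

lemma digits_iff_multilinear:
  fixes w r :: "bool list"
  defines "T \<equiv> clow_total k N (\<lambda>c u v. poly (random_weight n k N w r c u v) B)"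
  shows "(\<Sum>i<n * n * 8. T div B ^ i mod 2) \<noteq> 0 \<longleftrightarrow>
    multilinear (\<lambda>q. bits_poly (chunk n q r) :: bit poly) (monomials k N (input_bit w)) \<noteq> 0"
proof -
  let ?P = "clow_total k N (random_weight n k N w r) :: nat poly"
  have T: "T = poly ?P B" unfolding T_def by (rule poly_eval.map_clow_total[symmetric])
  have "coeff ?P i < B" for i
  proof -
    have "coeff ?P i \<le> poly ?P 1" by (rule coeff_le_poly_1)
    also have "\<dots> = clow_total k N (\<lambda>c u v. poly (random_weight n k N w r c u v) 1)"
      by (rule poly_eval.map_clow_total)
    also have "\<dots> \<le> 2 ^ k * (n ^ 3) ^ (N + N)"
      unfolding clow_total_def
    proof (rule clow_total_le[where b = n])
      have "N * (Suc k * n) \<le> n * (n * n)" using N k by (intro mult_le_mono) auto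
      then show "N * (Suc k * n) \<le> n ^ 3" by (simp add: power3_eq_cube)
      show "2 \<le> n ^ 3" using n self_le_power[of n 3] by simp
    qed (simp_all add: poly_random_weight_1[unfolded One_nat_def])
    also have "\<dots> < B" by (rule base_bounds)
    finally show ?thesis .
  qed
  then have odd: "odd (T div B ^ i) \<longleftrightarrow> odd (coeff ?P i)" for i
    unfolding T by (intro odd_digit_poly base_bounds)
  have small: "T < B ^ (n * n * 8)"
  proof -
    have "T \<le> 2 ^ k * (B ^ Suc n) ^ (N + N)"
      unfolding T_def clow_total_def
      by (rule clow_total_le[where b = "B ^ n"]) (auto simp: poly_random_weight_le base_bounds size_bounds simp del: power_Suc mult_Suc)
    also have "\<dots> \<le> B ^ (n * n * 3)" by (rule size_bounds)
    also have "\<dots> < B ^ (n * n * 8)" using N base_bounds(1) by (intro power_strict_increasing) auto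
    finally show ?thesis .
  qed
  have "(\<Sum>i<n * n * 8. T div B ^ i mod 2) \<noteq> 0 \<longleftrightarrow> (\<exists>i<n * n * 8. odd (T div B ^ i))"
    by (auto simp: odd_iff_mod_2_eq_one)
  \<comment> \<open>The total is below \<open>B^(8 n^2)\<close>, so the digits that are not
    inspected are all zero.\<close>
  also have "\<dots> \<longleftrightarrow> (\<exists>i. odd (T div B ^ i))"
  proof -
    have "T div B ^ i = 0" if "\<not> i < n * n * 8" for i
    proof -
      have "B ^ (n * n * 8) \<le> B ^ i" using that base_bounds(1) by (intro power_increasing) auto
      then show ?thesis using small by simp
    qed
    then show ?thesis by (metis even_zero)
  qed
  also have "\<dots> \<longleftrightarrow> map_poly of_nat ?P \<noteq> (0 :: bit poly)"
    by (simp add: odd map_of_nat_bit_eq_0)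
  also have "map_poly of_nat ?P = (clow_total k N (random_weight n k N w r) :: bit poly)"
    unfolding poly_reduce.map_clow_total map_random_weight by simp
  finally show ?thesis by (simp add: clow_total_random_weight)
qed

end


lemma poly_random_weight:
  "poly (random_weight n k N w r c u v) B = of_bool (input_bit w (position (N + k + 2) N c u v)) *
     poly (bits_poly (chunk n (position (N + k + 2) N c u v) r)) B"
  by (auto simp: random_weight_def of_bool_def)

context layout
begin

text \<open>Of the input only its length and its two unary headers are prescribed. That the
  remaining bits encode a graph enters only through
  \<open>monomials_nonempty_iff_pmhc\<close>.\<close>

lemma wp_pmhc_prog:
  fixes w r :: "bool list"
  defines "B \<equiv> 2 ^ (n * n * 8)"
  assumes M_def: "M = B ^ (n * n * 3)" and w: "length w = n" "N + k + 2 \<le> n"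
    and header: "\<And>i. i < N \<Longrightarrow> w ! i" "\<not> w ! N" "\<And>i. i < k \<Longrightarrow> w ! (N + 1 + i)" "\<not> w ! (N + 1 + k)"
    and r: "n * n \<le> length r"
    and post: "\<And>s' r'. s' ''out'' 0 = (\<Sum>i<n * n * 8. clow_total k N
        (\<lambda>c u v. poly (random_weight n k N w r c u v) B) div B ^ i mod 2) \<Longrightarrow> Q s' r'"
  shows "wp M ((2 * N + 2 * k + 3) + ((24 * (n * n) + 3 * k + 7) + ((n * (4 * n + 4) + 2) +
    ((2 ^ k * ((N * (N * (4 * k + 8) + 4) + 2) + (N * (N * (N * (N * 3 + 6) + 6) + 5) + 2) + 3) + 2) +
    (n * n * 32 + 2))))) pmhc_prog Q (initial w) r"
proof -
  have n2: "2 \<le> n" using w by simp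
  note bb = base_bounds[OF N k n2 meta_eq_to_obj_eq[OF B_def]] and sb = size_bounds[OF N k n2 meta_eq_to_obj_eq[OF B_def], folded M_def]
  let ?y = "\<lambda>c u v. poly (random_weight n k N w r c u v) B"
  have y_le: "?y c u v \<le> B ^ n" for c u v by (rule poly_random_weight_le[OF bb(1)])
  have in_bit: "initial w ''in'' i = of_bool (input_bit w i)" for i
    by (auto simp: initial_def input_bit_def)
  have mw: "mask_weight k ?y m u v \<le> M" for m u v
    using mask_weight_le[of k ?y u v "B ^ n" m] y_le sb(4) by (meson order_trans)
  have Zp: "(B ^ Suc n) ^ (N + N) \<le> M"
  proof -
    have "1 * (B ^ Suc n) ^ (N + N) \<le> 2 ^ k * (B ^ Suc n) ^ (N + N)" by (rule mult_le_mono1) simp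
    then show ?thesis using sb(3) by linarith
  qed
  have small: "clow_small (mask_matrix k ?y m)" for m
  proof -
    let ?A = "mask_matrix k ?y m"
    have A: "?A u v \<le> Suc k * B ^ n" if "u < N" "v < N" for u v
      using that y_le by (intro mask_matrix_le) auto
    have Z: "(B ^ Suc n) ^ e \<le> M" if "e \<le> N + N" for e
      using power_increasing[OF that, of "B ^ Suc n"] Zp sb(2) by linarith
    show ?thesis
      unfolding clow_small_def
    proof (intro conjI allI impI)
      fix h l assume hl: "h \<le> N" "l \<le> N"
      have "clow ?A h l \<le> (B ^ Suc n) ^ (h + l)"
        by (rule clow_le[OF _ sb(1,2) hl(1)]) (rule A)
      also have "\<dots> \<le> M" using hl by (intro Z) simp
      finally show "clow ?A h l \<le> M" .
    next
      fix h l v j assume hl: "h < N" "l < N" "v \<le> h" "j \<le> Suc h"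
      have "(\<Sum>u<j. clow_open ?A h (clow ?A h) l u * ?A u v) \<le> (B ^ Suc n) ^ Suc (h + l)"
        by (rule clow_open_sum_le[OF _ sb(1,2) hl(1,3,4)]) (rule A)
      also have "\<dots> \<le> M" using hl by (intro Z) simp
      finally show "(\<Sum>u<j. clow_open ?A h (clow ?A h) l u * ?A u v) \<le> M" .
    qed
  qed
  show ?thesis
    unfolding pmhc_prog_def
  proof (rule wp_Seq, rule wp_scan_prog[OF w(2)], goal_cases)
    case (7 s1)
    have s1: "sized s1" "s1 ''O'' 0 = N + k + 2" "s1 ''Y'' = (\<lambda>_. 0)" "s1 ''D'' = (\<lambda>_. 0)" "s1 ''G'' = (\<lambda>_. 0)"
        "s1 ''A'' = (\<lambda>_. 0)" "s1 ''t'' = (\<lambda>_. 0)" "s1 ''out'' = (\<lambda>_. 0)" "s1 ''in'' = initial w ''in''"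
      using 7 w by (auto simp: framed_def scan_prog_def sized_def initial_def)
    show ?case
    proof (rule wp_Seq, rule wp_powers_prog[OF s1(1)], goal_cases)
      case 1
      show ?case using sb(5) by (simp add: B_def)
    next
      case (2 s2)
      have s2: "sized s2" "s2 ''O'' 0 = N + k + 2" "s2 ''Y'' = (\<lambda>_. 0)" "s2 ''D'' = (\<lambda>i. of_bool (i = 0))" "s2 ''G'' = (\<lambda>_. 0)"
        "s2 ''A'' = (\<lambda>_. 0)" "s2 ''t'' = (\<lambda>_. 0)" "s2 ''out'' = (\<lambda>_. 0)" "s2 ''in'' = initial w ''in''"
        "s2 ''B'' 0 = B" "s2 ''P'' 0 = 2 ^ k"
      proof -
        have fr: "s2 x = s1 x" if "x \<notin> {''B'', ''i'', ''P'', ''D''}" for x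
          using 2(1) that by (simp add: framed_def powers_prog_def)
        show "sized s2" "s2 ''O'' 0 = N + k + 2" "s2 ''Y'' = (\<lambda>_. 0)" "s2 ''G'' = (\<lambda>_. 0)"
          "s2 ''A'' = (\<lambda>_. 0)" "s2 ''t'' = (\<lambda>_. 0)" "s2 ''out'' = (\<lambda>_. 0)" "s2 ''in'' = initial w ''in''"
          using s1 by (simp_all add: fr sized_def)
        show "s2 ''D'' = (\<lambda>i. of_bool (i = 0))" using 2(4) s1(4) by (simp add: fun_eq_iff)
        show "s2 ''B'' 0 = B" "s2 ''P'' 0 = 2 ^ k" using 2(2,3) by (simp_all add: B_def)
      qed
      show ?case
      proof (rule wp_Seq, rule wp_random_prog[where B = B and w = "input_bit w"], goal_cases)
        case (6)
        show ?case by (rule bb(1))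
      next
        case 7
        have "n \<le> n * n * 3" by simp
        then show ?case unfolding M_def using bb(1) by (intro power_increasing) auto
      next
        case (9 s3 r3)
        have s3: "sized s3" "s3 ''O'' 0 = N + k + 2" "s3 ''D'' = (\<lambda>i. of_bool (i = 0))" "s3 ''G'' = (\<lambda>_. 0)"
          "s3 ''A'' = (\<lambda>_. 0)" "s3 ''t'' = (\<lambda>_. 0)" "s3 ''out'' = (\<lambda>_. 0)" "s3 ''B'' 0 = B" "s3 ''P'' 0 = 2 ^ k"
          using 9(1) s2 by (auto simp: framed_def random_prog_def writes_random_cell_prog sized_def)
        have cell: "cell s3 = ?y"
          using s3(1,2) by (intro ext) (simp add: cell_def 9(2) poly_random_weight position_def sized_def)
        show ?case
        proof (rule wp_Seq, rule wp_total_prog, unfold cell, goal_cases)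
          case (3)
          show ?case using bb(4) sb(5) by linarith
        next
          case (10 j)
          show ?case
            by (rule order_trans[OF clow_total_le[OF _ sb(1,2) 10] sb(3)]) (rule y_le)
        next
          case (11 s4)
          have s4: "sized s4" "s4 ''out'' = (\<lambda>_. 0)" "s4 ''B'' 0 = B"
            using 11(1) s3 by (auto simp: framed_def total_prog_def writes_mask_prog writes_clow_prog sized_def)
          show ?case
          proof (rule wp_digits_prog[where B = B], goal_cases)
            case 4
            show ?case using bb(2) sb(5) by linarith
          next
            case (5 s5)
            then show ?case by (intro post) (simp add: 11(2))
          qed (use s4 in auto)
        qed (use s3 mw small N in \<open>auto simp: zero_starts_def ix_def\<close>)
      qed (use s2 in_bit w r in \<open>auto simp: input_bit_def\<close>)
    qed
  qed (use header w in_bit in \<open>auto simp: input_bit_def initial_def\<close>)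
qed

end

section \<open>Running time and success probability\<close>

lemma step_count:
  fixes n N k :: nat
  assumes "N \<le> n" "k \<le> n" "1 \<le> n"
  shows "(2 * N + 2 * k + 3) + ((24 * (n * n) + 3 * k + 7) + ((n * (4 * n + 4) + 2) +
    ((2 ^ k * ((N * (N * (4 * k + 8) + 4) + 2) + (N * (N * (N * (N * 3 + 6) + 6) + 5) + 2) + 3) + 2) +
    (n * n * 32 + 2)))) \<le> 140 * 2 ^ k * n ^ 4"
proof -
  \<comment> \<open>The nested clow loops dominate; all lower powers of \<open>n\<close> are
    absorbed into \<open>n^4\<close>, and 140 rounds up the sum of the coefficients.\<close>
  let ?p = "2 ^ k * n ^ 4"
  have pw: "n ^ i \<le> n ^ 4" if "i \<le> 4" for i using that assms(3) by (rule power_increasing)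
  have n4: "1 \<le> n ^ 4" "n \<le> n ^ 4" "n * n \<le> n ^ 4" "n * n * n \<le> n ^ 4" "n * n * n * n = n ^ 4"
    using pw[of 0] pw[of 1] pw[of 2] pw[of 3] by (auto simp: power2_eq_square power3_eq_cube power4_eq_xxxx mult.assoc)
  have p: "n ^ 4 \<le> ?p" using mult_le_mono1[of 1 "2 ^ k" "n ^ 4"] by simp
  have "N * (N * (4 * k + 8) + 4) + 2 \<le> n * (n * (4 * n + 8) + 4) + 2"
    using assms by (intro add_mono mult_le_mono) auto
  also have "\<dots> = 4 * (n * n * n) + 8 * (n * n) + 4 * n + 2" by (simp add: algebra_simps)
  also have "\<dots> \<le> 18 * n ^ 4" using n4 by linarith
  finally have 1: "N * (N * (4 * k + 8) + 4) + 2 \<le> 18 * n ^ 4" .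
  have "N * (N * (N * (N * 3 + 6) + 6) + 5) + 2 \<le> n * (n * (n * (n * 3 + 6) + 6) + 5) + 2"
    using assms by (intro add_mono mult_le_mono) auto
  also have "\<dots> = 3 * (n * n * n * n) + 6 * (n * n * n) + 6 * (n * n) + 5 * n + 2" by (simp add: algebra_simps)
  also have "\<dots> \<le> 22 * n ^ 4" using n4 by linarith
  finally have "(N * (N * (4 * k + 8) + 4) + 2) + (N * (N * (N * (N * 3 + 6) + 6) + 5) + 2) + 3 \<le> 43 * n ^ 4"
    using 1 n4(1) by linarith
  then have "2 ^ k * ((N * (N * (4 * k + 8) + 4) + 2) + (N * (N * (N * (N * 3 + 6) + 6) + 5) + 2) + 3) \<le> 2 ^ k * (43 * n ^ 4)"
    by (rule mult_le_mono2)
  also have "\<dots> = 43 * ?p" by simp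
  finally have 2: "2 ^ k * ((N * (N * (4 * k + 8) + 4) + 2) + (N * (N * (N * (N * 3 + 6) + 6) + 5) + 2) + 3) \<le> 43 * ?p" .
  have "n * (4 * n + 4) = 4 * (n * n) + 4 * n" by (simp add: algebra_simps)
  then show ?thesis using 2 p n4 assms by linarith
qed

text \<open>The stored numbers are at most \<open>2^(24 n^4)\<close>, of length at most
  \<open>26 n^4\<close>, and \<open>300 * 26^2 = 202800\<close>.\<close>

lemma unit_cost_le:
  assumes "1 \<le> n"
  shows "unit_cost ((2 ^ (n * n * 8)) ^ (n * n * 3)) \<le> 202800 * n ^ 8"
proof -
  have e: "((2::nat) ^ (n * n * 8)) ^ (n * n * 3) = 2 ^ (24 * n ^ 4)"
    by (simp add: power4_eq_xxxx mult_ac flip: power_mult)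
  have "floorlog 2 ((2::nat) ^ (24 * n ^ 4)) \<le> Suc (24 * n ^ 4)" by (rule floorlog_leI) auto
  then have "len (2 ^ (24 * n ^ 4)) \<le> 26 * n ^ 4"
    unfolding len_def using one_le_power[OF assms, of 4] by linarith
  then have "(len (2 ^ (24 * n ^ 4)))\<^sup>2 \<le> (26 * n ^ 4)\<^sup>2" by (rule power_mono) simp
  also have "\<dots> = 676 * n ^ 8" by (simp add: power_mult_distrib flip: power_mult)
  finally show ?thesis unfolding e unit_cost_def by simp
qed

lemma three_mult_le_power: "4 \<le> n \<Longrightarrow> 3 * n \<le> 2 ^ (n :: nat)"
  by (induction n rule: dec_induct) auto

lemma prob_ge_of_inclusion:
  assumes "measure_pmf.prob (pmf_of_set {r :: bool list. length r = T}) A \<ge> c"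
    and "\<And>r. length r = T \<Longrightarrow> r \<in> A \<Longrightarrow> r \<in> B"
  shows "measure_pmf.prob (pmf_of_set {r :: bool list. length r = T}) B \<ge> c"
proof -
  have "measure_pmf.prob (pmf_of_set {r :: bool list. length r = T}) A \<le>
      measure_pmf.prob (pmf_of_set {r :: bool list. length r = T}) B"
    using assms(2)
    by (intro measure_pmf.finite_measure_mono_AE)
      (auto simp: AE_measure_pmf_iff set_pmf_of_set finite_bit_lists Ex_list_of_length)
  with assms(1) show ?thesis by linarith
qed

lemma prob_monomials:
  assumes n: "n = N + k + 2 + Suc k * (N * N)" "length w = n" "n * n \<le> T" and F: "monomials k N (input_bit w) \<noteq> {}"
  shows "measure_pmf.prob (pmf_of_set {r :: bool list. length r = T})
    {r. multilinear (\<lambda>q. bits_poly (chunk n q r) :: bit poly) (monomials k N (input_bit w)) \<noteq> 0} \<ge> 2 / 3"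
proof (cases "N = 0")
  \<comment> \<open>For \<open>N = 0\<close> the input may have length 2 or 3, where
    \<open>n / 2^n\<close> exceeds 1/3. But then no variable occurs and the form cannot fail; for
    positive \<open>N\<close> one has \<open>n >= 4\<close>.\<close>
  case True
  have "measure_pmf.prob (pmf_of_set {r :: bool list. length r = T})
    {r. multilinear (\<lambda>q. bits_poly (chunk n q r) :: bit poly) (monomials k N (input_bit w)) \<noteq> 0} \<ge> 1 - real 0 / 2 ^ n"
    using F unfolding True by (intro prob_multilinear_nonzero inj_bits_poly monomials_0_subset) auto
  then show ?thesis by simp
next
  case False
  then have "1 \<le> N * N" by (cases N) auto
  also have "\<dots> \<le> Suc k * (N * N)" by simp
  finally have "4 \<le> n" unfolding n(1) using False by linarith
  then have "3 * n \<le> 2 ^ n" by (rule three_mult_le_power)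
  then have "real (3 * n) \<le> real (2 ^ n)" by (simp only: of_nat_le_iff)
  then have "real n / 2 ^ n \<le> 1 / 3" by (simp add: field_simps)
  moreover have "measure_pmf.prob (pmf_of_set {r :: bool list. length r = T})
    {r. multilinear (\<lambda>q. bits_poly (chunk n q r) :: bit poly) (monomials k N (input_bit w)) \<noteq> 0} \<ge> 1 - real n / 2 ^ n"
    using monomials_subset[of k N w] F n by (intro prob_multilinear_nonzero inj_bits_poly) auto
  ultimately show ?thesis by linarith
qed

theorem theorem8:
  "\<exists>(p :: com) (c :: nat) (d :: nat). \<forall>(N :: nat) (E :: nat set set) (Es :: nat set set list).
     pmhc_instance {..<N} E Es \<longrightarrow>
     monte_carlo p (encode N E Es) (pmhc {..<N} E Es)
       (c * 2 ^ length Es * length (encode N E Es) ^ d)"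
proof (intro exI allI impI)
  fix N :: nat and E :: "nat set set" and Es :: "nat set set list"
  assume inst: "pmhc_instance {..<N} E Es"
  define w where "w = encode N E Es"
  define k where "k = length Es"
  define n where "n = length w"
  define B :: nat where "B = 2 ^ (n * n * 8)"
  define M where "M = B ^ (n * n * 3)"
  \<comment> \<open>At most \<open>140 * 2^k * n^4\<close> steps of cost at most
    \<open>202800 * n^8\<close> each.\<close>
  define T where "T = (140 * 202800) * 2 ^ k * n ^ 12"
  define F where "F = monomials k N (input_bit w)"
  define good where "good r \<longleftrightarrow> multilinear (\<lambda>q. bits_poly (chunk n q r) :: bit poly) F \<noteq> 0" for r
  have n: "n = N + k + 2 + Suc k * (N * N)" by (simp add: n_def w_def k_def length_encode)
  have Nk: "N < n" "k < n" "2 \<le> n" "N + k + 2 \<le> n" "1 \<le> n" by (auto simp: n)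
  note sb = size_bounds[OF Nk(1-3) B_def, folded M_def] and bb = base_bounds[OF Nk(1-3) B_def]
  have nM: "n \<le> M"
  proof -
    have "n \<le> n * n * 8" by simp
    then show ?thesis using bb(2) sb(5) by linarith
  qed
  interpret layout n N k M
    by unfold_locales (use Nk nM in auto)
  have nT: "n * n \<le> T"
  proof -
    have "n * n = 1 * n ^ 2" by (simp add: power2_eq_square)
    also have "\<dots> \<le> ((140 * 202800) * 2 ^ k) * n ^ 12"
      using Nk(5) by (intro mult_le_mono power_increasing) auto
    finally show ?thesis by (simp add: T_def)
  qed
  have run: "\<exists>t\<le>T. answers pmhc_prog w r t (good r)" if r: "length r = T" for r
  proof -
    let ?m = "(2 * N + 2 * k + 3) + ((24 * (n * n) + 3 * k + 7) + ((n * (4 * n + 4) + 2) +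
      ((2 ^ k * ((N * (N * (4 * k + 8) + 4) + 2) + (N * (N * (N * (N * 3 + 6) + 6) + 5) + 2) + 3) + 2) +
      (n * n * 32 + 2))))"
    have "wp M ?m pmhc_prog (\<lambda>s' r'. good r \<longleftrightarrow> s' ''out'' 0 \<noteq> 0) (initial w) r"
    proof (rule wp_pmhc_prog, goal_cases)
      case (9 s' r')
      then show ?case
        using digits_iff_multilinear[OF Nk(1-3) B_def, of w r] by (simp add: good_def F_def B_def)
    qed (use nth_encode_header Nk r nT in \<open>auto simp: M_def B_def n_def w_def k_def\<close>)
    moreover have "bounded_state M (initial w)"
      using nM Nk(3) by (auto simp: bounded_state_def initial_def n_def of_bool_def)
    ultimately obtain t s' r' where t: "exec pmhc_prog (initial w) r t s' r'" "t \<le> ?m * unit_cost M"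
        "good r \<longleftrightarrow> s' ''out'' 0 \<noteq> 0"
      unfolding wp_def by blast
    have "?m * unit_cost M \<le> (140 * 2 ^ k * n ^ 4) * (202800 * n ^ 8)"
    proof (rule mult_le_mono)
      show "?m \<le> 140 * 2 ^ k * n ^ 4" by (rule step_count) (use Nk in auto)
      show "unit_cost M \<le> 202800 * n ^ 8" unfolding M_def B_def by (rule unit_cost_le[OF Nk(5)])
    qed
    also have "\<dots> = (140 * 202800) * 2 ^ k * (n ^ 4 * n ^ 8)" by (simp only: mult_ac)
    also have "n ^ 4 * n ^ 8 = n ^ 12" by (simp flip: power_add)
    finally have "t \<le> T" using t(2) unfolding T_def by linarith
    then show ?thesis using t unfolding answers_def by blast
  qed
  have "measure_pmf.prob (pmf_of_set {r :: bool list. length r = T}) {r. good r \<longleftrightarrow> pmhc {..<N} E Es} \<ge> 2 / 3"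
  proof (cases "pmhc {..<N} E Es")
    case True
    then have "F \<noteq> {}" using monomials_nonempty_iff_pmhc[OF inst] by (simp add: F_def k_def w_def)
    then show ?thesis
      using prob_monomials[OF n _ nT, of w] True by (simp add: F_def good_def n_def)
  next
    \<comment> \<open>Without a solution the form has no monomials, so the answer is correct for
      every outcome of the flips.\<close>
    case False
    then have "F = {}" using monomials_nonempty_iff_pmhc[OF inst] by (simp add: F_def k_def w_def)
    then show ?thesis using False by (simp add: good_def multilinear_def)
  qed
  then have "measure_pmf.prob (pmf_of_set {r :: bool list. length r = T})
      {r. \<exists>t. answers pmhc_prog w r t (pmhc {..<N} E Es)} \<ge> 2 / 3"
    by (rule prob_ge_of_inclusion) (use run in fastforce)
  then show "monte_carlo pmhc_prog (encode N E Es) (pmhc {..<N} E Es)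
      ((140 * 202800) * 2 ^ length Es * length (encode N E Es) ^ 12)"
    using run unfolding monte_carlo_def T_def n_def w_def k_def by blast
qed

end
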